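(* Let $n\ge 2$, $G=\operatorname{Euc}(n)$, $H=O(n-1)$, and let $(p:\mathcal P\to N,\omega)$ be a Cartan geometry of type $(G,H)$. Then $\dim N=2n-1$, and $N$ carries canonically (that is, by the pointwise formulas given in the context, which do not depend on the choice of $u\in p^{-1}(x)$ and define smooth objects) a tuple $(\bar g,U,\alpha,\mathcal E,\mathcal B,\Psi)$, where: 1. $\bar g$ is a Riemannian metric on $N$; 2. $U\in\mathfrak X(N)$ is a unit vector field (with respect to $\bar g$); 3. $\alpha:=\bar g(U,\cdot)$; 4. $\mathcal E$ and $\mathcal B$ are distributions on $N$ such that $TN$ splits orthogonally as $TN=\mathbb R U\oplus\mathcal E\oplus\mathcal B$, with $\operatorname{rank}\mathcal E=\operatorname{rank}\mathcal B=n-1$; 5. $\Psi$ is a $(1,1)$-tensor field on $N$ satisfying $$\Psi^2=-\operatorname{Id}+\alpha\otimes U,\qquad \bar g(\Psi(V),\Psi(W))=\bar g(V,W)-\alpha(V)\alpha(W)\quad\text{for all }V,W\in\mathfrak X(N),$$ and $$\Psi(U)=0,\qquad \Psi(\mathcal E)=\mathcal B,\qquad \Psi(\mathcal B)=\mathcal E.$$ In particular, $(\bar g,U,\alpha,\Psi)$ is an almost contact metric structure.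
   Context: All manifolds are smooth, Hausdorff, connected and second countable. Groups. $G=\operatorname{Euc}(n)=\mathbb R^n\rtimes O(n)$ is realized as the matrices $\begin{pmatrix}1&0\\ v&A\end{pmatrix}$ with $v\in\mathbb R^n$, $A\in O(n)$; its Lie algebra $\mathfrak g$ consists of the matrices $\begin{pmatrix}0&0\\ v&B\end{pmatrix}$ with $v\in\mathbb R^n$, $B\in\mathfrak o(n)$. $H=O(n-1)\subset O(n)\subset G$ is embedded by $h\mapsto\begin{pmatrix}1&0\\0&h\end{pmatrix}\in O(n)$, with Lie algebra $\mathfrak h=\mathfrak o(n-1)$. Model. For $v_0\in\mathbb R$, $v,w\in\mathbb R^{n-1}$ put $$(v_0,v,w):=\begin{pmatrix}0&0&0\\ v_0&0&-w^t\\ v&w&0\end{pmatrix}\in\mathfrak g .$$ These matrices form an $\operatorname{Ad}(H)$-invariant complement $\mathfrak m$ of $\mathfrak h$ in $\mathfrak g$, identified with $\mathfrak g/\mathfrak h$ by the quotient map; $H$ acts on $\mathfrak m$ by $\underline{\operatorname{Ad}}(h)(v_0,v,w)=(v_0,hv,hw)$. With $(E_1,\dots,E_{n-1})$ the canonical basis of $\mathbb R^{n-1}$, put $e_0=(1,0,0)$, $e_i=(0,E_i,0)$, $b_i=(0,0,E_i)$, $E=\operatorname{span}\{e_1,\dots,e_{n-1}\}$, $B=\operatorname{span}\{b_1,\dots,b_{n-1}\}$, so $\mathfrak m=\mathbb R e_0\oplus E\oplus B$. Let $\langle\cdot,\cdot\rangle_{\mathfrak m}$ be the inner product for which $(e_0,e_1,\dots,e_{n-1},b_1,\dots,b_{n-1})$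 is orthonormal, and let $\psi:\mathfrak m\to\mathfrak m$ be the linear map with $\psi(e_0)=0$, $\psi(e_i)=b_i$, $\psi(b_i)=-e_i$. Both are $H$-equivariant. Cartan geometry of type $(G,H)$ on $N$: an $H$-principal fiber bundle $p:\mathcal P\to N$ (right action $r^h$) with a $1$-form $\omega\in\Omega^1(\mathcal P,\mathfrak g)$ (Cartan connection) such that each $\omega(u):T_u\mathcal P\to\mathfrak g$ is a linear isomorphism, $(r^h)^*\omega=\operatorname{Ad}(h^{-1})\circ\omega$ for $h\in H$, and $\omega(\zeta_X)=X$ for every $X\in\mathfrak h$, where $\zeta_X$ is the fundamental vector field of $X$. For $u\in\mathcal P$ with $p(u)=x$, there is a unique linear isomorphism $\phi_u:T_xN\to\mathfrak g/\mathfrak h\cong\mathfrak m$ such that $\phi_u(T_up\cdot\xi)=\operatorname{pr}_{\mathfrak m}(\omega(u)(\xi))$ for all $\xi\in T_u\mathcal P$; it satisfies $\phi_{uh}=\underline{\operatorname{Ad}}(h^{-1})\circ\phi_u$. Induced objects. For $x\in N$ and any $u\in p^{-1}(x)$: $\bar g_x(v,w)=\langle\phi_u(v),\phi_u(w)\rangle_{\mathfrak m}$, $U(x)=\phi_u^{-1}(e_0)$, $\mathcal E_x=\phi_u^{-1}(E)$, $\mathcal B_x=\phi_u^{-1}(B)$, $\Psi_x=\phi_u^{-1}\circ\psi\circ\phi_u$. An almost contact metric structure on a manifold is a tuple $(\bar g,U,\alpha,\Psi)$ of a Riemannian metric, a unit vector field $U$, its $\bar g$-dual $1$-form $\alpha$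 and a $(1,1)$-tensor field $\Psi$ with $\Psi^2=-\operatorname{Id}+\alpha\otimes U$ and $\bar g(\Psi V,\Psi W)=\bar g(V,W)-\alpha(V)\alpha(W)$. *)

theory Defs
  imports "HOL-Analysis.Analysis" "HOL-Library.Function_Algebras"
begin

section \<open>Smooth maps between normed spaces\<close>

text \<open>\<open>cont_diff_on k S f\<close> says that \<open>f\<close> is of class \<open>C^k\<close> on the open set \<open>S\<close>.\<close>

fun cont_diff_on :: "nat \<Rightarrow> 'a::real_normed_vector set \<Rightarrow> ('a \<Rightarrow> 'b::real_normed_vector) \<Rightarrow> bool"
where
  "cont_diff_on 0 S f \<longleftrightarrow> continuous_on S f"
| "cont_diff_on (Suc k) S f \<longleftrightarrow>
     (\<forall>x\<in>S. f differentiable (at x)) \<and>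
     (\<forall>v. cont_diff_on k S (\<lambda>x. frechet_derivative f (at x) v))"

definition smooth_on :: "'a::real_normed_vector set \<Rightarrow> ('a \<Rightarrow> 'b::real_normed_vector) \<Rightarrow> bool"
  where "smooth_on S f \<longleftrightarrow> (\<forall>k. cont_diff_on k S f)"

text \<open>Smoothness on a subset that need not be open: local existence of smooth extensions.
  It is used for subsets involving an embedded submanifold of a vector space (a closed matrix
  group), where it coincides with smoothness for the submanifold structure.\<close>

definition smooth_on_subset :: "'a::real_normed_vector set \<Rightarrow> ('a \<Rightarrow> 'b::real_normed_vector) \<Rightarrow> bool"
  where "smooth_on_subset S f \<longleftrightarrow>
    (\<forall>x\<in>S. \<exists>T g. open T \<and> x \<in> T \<and> smooth_on T g \<and> (\<forall>y\<in>S \<inter> T. g y = f y))"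


section \<open>Smooth manifolds\<close>

text \<open>The underlying space of a manifold is a whole type. A chart is a pair of a domain and a
  coordinate map, of which only the restriction to the domain matters. An atlas is any smooth
  atlas, not necessarily a maximal one. The dimension is that of the model space.\<close>

type_synonym ('a, 'e) chart = "'a set \<times> ('a \<Rightarrow> 'e)"

abbreviation cdom :: "('a, 'e) chart \<Rightarrow> 'a set" where "cdom k \<equiv> fst k"
abbreviation cmap :: "('a, 'e) chart \<Rightarrow> 'a \<Rightarrow> 'e" where "cmap k \<equiv> snd k"
abbreviation cinv :: "('a, 'e) chart \<Rightarrow> 'e \<Rightarrow> 'a" where "cinv k \<equiv> inv_into (cdom k) (cmap k)"

definition smooth_atlas ::
    "('a::{t2_space, second_countable_topology}, 'e::euclidean_space) chart set \<Rightarrow> bool"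
  where "smooth_atlas A \<longleftrightarrow>
    (\<Union>k\<in>A. cdom k) = UNIV \<and>
    (\<forall>k\<in>A. open (cdom k) \<and> open (cmap k ` cdom k) \<and>
       homeomorphism (cdom k) (cmap k ` cdom k) (cmap k) (cinv k)) \<and>
    (\<forall>k\<in>A. \<forall>l\<in>A. smooth_on (cmap k ` (cdom k \<inter> cdom l)) (cmap l \<circ> cinv k))"

definition charts_at :: "('a, 'e) chart set \<Rightarrow> 'a \<Rightarrow> ('a, 'e) chart set"
  where "charts_at A x = {k \<in> A. x \<in> cdom k}"

text \<open>Smooth maps between manifolds, defined on an open subset \<open>S\<close> of the source.\<close>

definition smooth_map_on ::
    "('a::topological_space, 'e::euclidean_space) chart set \<Rightarrow>
     ('b::topological_space, 'f::euclidean_space) chart set \<Rightarrow> 'a set \<Rightarrow> ('a \<Rightarrow> 'b) \<Rightarrow> bool"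
  where "smooth_map_on A B S f \<longleftrightarrow>
    continuous_on S f \<and>
    (\<forall>k\<in>A. \<forall>l\<in>B.
       smooth_on (cmap k ` {x \<in> cdom k \<inter> S. f x \<in> cdom l}) (cmap l \<circ> f \<circ> cinv k))"

definition smooth_fun_on ::
    "('a::topological_space, 'e::euclidean_space) chart set \<Rightarrow> 'a set \<Rightarrow>
     ('a \<Rightarrow> 'w::real_normed_vector) \<Rightarrow> bool"
  where "smooth_fun_on A S f \<longleftrightarrow> (\<forall>k\<in>A. smooth_on (cmap k ` (cdom k \<inter> S)) (f \<circ> cinv k))"

text \<open>Smooth maps \<open>S \<times> H \<rightarrow> N\<close>, where \<open>S\<close> is an open subset of a manifold and \<open>H\<close> is an embedded
  submanifold of a vector space.\<close>

definition smooth_prod_map_on ::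
    "('a::topological_space, 'e::euclidean_space) chart set \<Rightarrow>
     ('b::topological_space, 'f::euclidean_space) chart set \<Rightarrow>
     'a set \<Rightarrow> 'w::real_normed_vector set \<Rightarrow> ('a \<Rightarrow> 'w \<Rightarrow> 'b) \<Rightarrow> bool"
  where "smooth_prod_map_on A B S H f \<longleftrightarrow>
    continuous_on (S \<times> H) (\<lambda>(x, h). f x h) \<and>
    (\<forall>k\<in>A. \<forall>l\<in>B.
       smooth_on_subset
         {(a, h). a \<in> cmap k ` (cdom k \<inter> S) \<and> h \<in> H \<and> f (cinv k a) h \<in> cdom l}
         (\<lambda>(a, h). cmap l (f (cinv k a) h)))"


section \<open>Tangent spaces and tensor fields\<close>

instantiation "fun" :: (type, real_vector) real_vector
begin

definition scaleR_fun_def: "r *\<^sub>R f = (\<lambda>x. r *\<^sub>R f x)"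

instance
  by standard
    (simp_all add: scaleR_fun_def fun_eq_iff scaleR_add_right scaleR_add_left)

end

text \<open>A tangent vector at \<open>x\<close> is the family of its coordinate vectors in all charts around \<open>x\<close>,
  transforming with the derivatives of the transition maps (and \<open>0\<close> at the other charts). The
  vector space operations on the tangent space are the pointwise ones.\<close>

type_synonym ('a, 'e) tvec = "('a, 'e) chart \<Rightarrow> 'e"

definition tangent :: "('a, 'e::euclidean_space) chart set \<Rightarrow> 'a \<Rightarrow> ('a, 'e) tvec set"
  where "tangent A x = {\<xi>.
    (\<forall>k. k \<notin> charts_at A x \<longrightarrow> \<xi> k = 0) \<and>
    (\<forall>k\<in>charts_at A x. \<forall>l\<in>charts_at A x.
       \<xi> l = frechet_derivative (cmap l \<circ> cinv k) (at (cmap k x)) (\<xi> k))}"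

text \<open>The tangent vector at \<open>x\<close> with coordinate vector \<open>v\<close> in the chart \<open>k\<close> around \<open>x\<close>.\<close>

definition chart_vec :: "('a, 'e::euclidean_space) chart set \<Rightarrow> ('a, 'e) chart \<Rightarrow> 'a \<Rightarrow> 'e \<Rightarrow> ('a, 'e) tvec"
  where "chart_vec A k x v = (\<lambda>l. if l \<in> charts_at A x
    then frechet_derivative (cmap l \<circ> cinv k) (at (cmap k x)) v else 0)"

text \<open>The tangent map of \<open>f\<close> at \<open>x\<close>; the choice of the chart at \<open>x\<close> is immaterial.\<close>

definition tangent_map ::
    "('a, 'e::euclidean_space) chart set \<Rightarrow> ('b, 'f::euclidean_space) chart set \<Rightarrow>
     ('a \<Rightarrow> 'b) \<Rightarrow> 'a \<Rightarrow> ('a, 'e) tvec \<Rightarrow> ('b, 'f) tvec"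
  where "tangent_map A B f x \<xi> =
    (let k = (SOME k. k \<in> charts_at A x) in
     (\<lambda>l. if l \<in> charts_at B (f x)
       then frechet_derivative (cmap l \<circ> f \<circ> cinv k) (at (cmap k x)) (\<xi> k) else 0))"

definition velocity :: "('a, 'e::euclidean_space) chart set \<Rightarrow> (real \<Rightarrow> 'a) \<Rightarrow> real \<Rightarrow> ('a, 'e) tvec"
  where "velocity A \<gamma> t = (\<lambda>k. if k \<in> charts_at A (\<gamma> t)
    then vector_derivative (cmap k \<circ> \<gamma>) (at t) else 0)"

definition linear_on :: "'a::real_vector set \<Rightarrow> ('a \<Rightarrow> 'b::real_vector) \<Rightarrow> bool"
  where "linear_on V f \<longleftrightarrow>
    (\<forall>x\<in>V. \<forall>y\<in>V. f (x + y) = f x + f y) \<and> (\<forall>r. \<forall>x\<in>V. f (r *\<^sub>R x) = r *\<^sub>R f x)"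

definition linear_iso_on :: "'a::real_vector set \<Rightarrow> 'b::real_vector set \<Rightarrow> ('a \<Rightarrow> 'b) \<Rightarrow> bool"
  where "linear_iso_on V W f \<longleftrightarrow> linear_on V f \<and> bij_betw f V W"

text \<open>Smooth vector fields on an open set \<open>S\<close>.\<close>

definition vector_field_on ::
    "('a::topological_space, 'e::euclidean_space) chart set \<Rightarrow> 'a set \<Rightarrow> ('a \<Rightarrow> ('a, 'e) tvec) \<Rightarrow> bool"
  where "vector_field_on A S X \<longleftrightarrow>
    (\<forall>x\<in>S. X x \<in> tangent A x) \<and>
    (\<forall>k\<in>A. smooth_on (cmap k ` (cdom k \<inter> S)) (\<lambda>a. X (cinv k a) k))"

abbreviation vector_field ::
    "('a::topological_space, 'e::euclidean_space) chart set \<Rightarrow> ('a \<Rightarrow> ('a, 'e) tvec) \<Rightarrow> bool"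
  where "vector_field A \<equiv> vector_field_on A UNIV"

text \<open>Smooth 1-forms with values in a normed space.\<close>

definition one_form ::
    "('a::topological_space, 'e::euclidean_space) chart set \<Rightarrow>
     ('a \<Rightarrow> ('a, 'e) tvec \<Rightarrow> 'w::real_normed_vector) \<Rightarrow> bool"
  where "one_form A \<theta> \<longleftrightarrow>
    (\<forall>x. linear_on (tangent A x) (\<theta> x)) \<and>
    (\<forall>k\<in>A. \<forall>v. smooth_on (cmap k ` cdom k) (\<lambda>a. \<theta> (cinv k a) (chart_vec A k (cinv k a) v)))"

definition tensor_field_11 ::
    "('a::topological_space, 'e::euclidean_space) chart set \<Rightarrow>
     ('a \<Rightarrow> ('a, 'e) tvec \<Rightarrow> ('a, 'e) tvec) \<Rightarrow> bool"
  where "tensor_field_11 A \<Psi> \<longleftrightarrow>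
    (\<forall>x. linear_on (tangent A x) (\<Psi> x) \<and> \<Psi> x ` tangent A x \<subseteq> tangent A x) \<and>
    (\<forall>k\<in>A. \<forall>v. smooth_on (cmap k ` cdom k) (\<lambda>a. \<Psi> (cinv k a) (chart_vec A k (cinv k a) v) k))"

definition riemannian_metric ::
    "('a::topological_space, 'e::euclidean_space) chart set \<Rightarrow>
     ('a \<Rightarrow> ('a, 'e) tvec \<Rightarrow> ('a, 'e) tvec \<Rightarrow> real) \<Rightarrow> bool"
  where "riemannian_metric A g \<longleftrightarrow>
    (\<forall>x. (\<forall>v\<in>tangent A x. linear_on (tangent A x) (g x v)) \<and>
         (\<forall>v\<in>tangent A x. \<forall>w\<in>tangent A x. g x v w = g x w v) \<and>
         (\<forall>v\<in>tangent A x. v \<noteq> 0 \<longrightarrow> g x v v > 0)) \<and>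
    (\<forall>k\<in>A. \<forall>v w. smooth_on (cmap k ` cdom k)
       (\<lambda>a. g (cinv k a) (chart_vec A k (cinv k a) v) (chart_vec A k (cinv k a) w)))"

text \<open>Smooth distributions of constant rank \<open>r\<close>: locally spanned by \<open>r\<close> smooth vector fields
  that are pointwise linearly independent.\<close>

definition distribution ::
    "('a::topological_space, 'e::euclidean_space) chart set \<Rightarrow> nat \<Rightarrow> ('a \<Rightarrow> ('a, 'e) tvec set) \<Rightarrow> bool"
  where "distribution A r D \<longleftrightarrow>
    (\<forall>x. dim (D x) = r) \<and>
    (\<forall>x. \<exists>S X. open S \<and> x \<in> S \<and> (\<forall>i<r. vector_field_on A S (X i)) \<and>
       (\<forall>y\<in>S. D y = span ((\<lambda>i::nat. X i y) ` {..<r})))"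

definition almost_contact_metric ::
    "('a::topological_space, 'e::euclidean_space) chart set \<Rightarrow>
     ('a \<Rightarrow> ('a, 'e) tvec \<Rightarrow> ('a, 'e) tvec \<Rightarrow> real) \<Rightarrow> ('a \<Rightarrow> ('a, 'e) tvec) \<Rightarrow>
     ('a \<Rightarrow> ('a, 'e) tvec \<Rightarrow> real) \<Rightarrow> ('a \<Rightarrow> ('a, 'e) tvec \<Rightarrow> ('a, 'e) tvec) \<Rightarrow> bool"
  where "almost_contact_metric A g U \<alpha> \<Psi> \<longleftrightarrow>
    riemannian_metric A g \<and>
    vector_field A U \<and> (\<forall>x. g x (U x) (U x) = 1) \<and>
    one_form A \<alpha> \<and> (\<forall>x. \<forall>v\<in>tangent A x. \<alpha> x v = g x (U x) v) \<and>
    tensor_field_11 A \<Psi> \<and>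
    (\<forall>x. \<forall>v\<in>tangent A x. \<Psi> x (\<Psi> x v) = - v + \<alpha> x v *\<^sub>R U x) \<and>
    (\<forall>x. \<forall>v\<in>tangent A x. \<forall>w\<in>tangent A x.
       g x (\<Psi> x v) (\<Psi> x w) = g x v w - \<alpha> x v * \<alpha> x w)"


section \<open>Principal bundles and Cartan geometries for matrix groups\<close>

text \<open>The structure group \<open>H\<close> is a closed group of invertible matrices. For a smooth map into
  \<open>H\<close>, smoothness as a map into the space of matrices is the same as smoothness into \<open>H\<close>, since
  \<open>H\<close> is an embedded submanifold. The inverse of a local trivialization
  \<open>u \<mapsto> (p u, \<tau> u)\<close> over \<open>V\<close> is \<open>\<sigma> : V \<times> H \<rightarrow> P\<close>. The total space is not required to
  be connected.\<close>

definition principal_bundle ::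
    "('p::topological_space, 'e::euclidean_space) chart set \<Rightarrow>
     ('x::topological_space, 'f::euclidean_space) chart set \<Rightarrow>
     (real^'k::finite^'k) set \<Rightarrow> ('p \<Rightarrow> 'x) \<Rightarrow> ('p \<Rightarrow> real^'k^'k \<Rightarrow> 'p) \<Rightarrow> bool"
  where "principal_bundle AP AN H p act \<longleftrightarrow>
    smooth_map_on AP AN UNIV p \<and>
    smooth_prod_map_on AP AP UNIV H act \<and>
    (\<forall>u. act u (mat 1) = u) \<and>
    (\<forall>u. \<forall>h\<in>H. \<forall>h'\<in>H. act (act u h) h' = act u (h ** h')) \<and>
    (\<forall>u. \<forall>h\<in>H. p (act u h) = p u) \<and>
    (\<forall>x. \<exists>V \<tau> \<sigma>. open V \<and> x \<in> V \<and>
       smooth_fun_on AP (p -` V) \<tau> \<and> \<tau> ` (p -` V) \<subseteq> H \<and>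
       smooth_prod_map_on AN AP V H \<sigma> \<and>
       (\<forall>u\<in>p -` V. \<sigma> (p u) (\<tau> u) = u) \<and>
       (\<forall>y\<in>V. \<forall>h\<in>H. p (\<sigma> y h) = y \<and> \<tau> (\<sigma> y h) = h) \<and>
       (\<forall>u\<in>p -` V. \<forall>h\<in>H. \<tau> (act u h) = \<tau> u ** h))"

primrec mat_pow :: "real^'k::finite^'k \<Rightarrow> nat \<Rightarrow> real^'k^'k"
  where
    "mat_pow X 0 = mat 1"
  | "mat_pow X (Suc j) = X ** mat_pow X j"

definition mat_exp :: "real^'k::finite^'k \<Rightarrow> real^'k^'k"
  where "mat_exp X = (\<Sum>j. (1 / fact j) *\<^sub>R mat_pow X j)"

definition Ad :: "real^'k::finite^'k \<Rightarrow> real^'k^'k \<Rightarrow> real^'k^'k"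
  where "Ad h X = h ** X ** matrix_inv h"

definition fundamental_field ::
    "('p, 'e::euclidean_space) chart set \<Rightarrow> ('p \<Rightarrow> real^'k::finite^'k \<Rightarrow> 'p) \<Rightarrow>
     real^'k^'k \<Rightarrow> 'p \<Rightarrow> ('p, 'e) tvec"
  where "fundamental_field AP act X u = velocity AP (\<lambda>t. act u (mat_exp (t *\<^sub>R X))) 0"

text \<open>\<open>\<gg>\<close> and \<open>\<hh>\<close> are the Lie algebras of the ambient group and of \<open>H\<close>.\<close>

definition cartan_connection ::
    "('p::topological_space, 'e::euclidean_space) chart set \<Rightarrow>
     (real^'k::finite^'k) set \<Rightarrow> (real^'k^'k) set \<Rightarrow> (real^'k^'k) set \<Rightarrow>
     ('p \<Rightarrow> real^'k^'k \<Rightarrow> 'p) \<Rightarrow> ('p \<Rightarrow> ('p, 'e) tvec \<Rightarrow> real^'k^'k) \<Rightarrow> bool"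
  where "cartan_connection AP \<gg> H \<hh> act \<omega> \<longleftrightarrow>
    one_form AP \<omega> \<and>
    (\<forall>u. linear_iso_on (tangent AP u) \<gg> (\<omega> u)) \<and>
    (\<forall>h\<in>H. \<forall>u. \<forall>\<xi>\<in>tangent AP u.
       \<omega> (act u h) (tangent_map AP AP (\<lambda>u'. act u' h) u \<xi>) = Ad (matrix_inv h) (\<omega> u \<xi>)) \<and>
    (\<forall>X\<in>\<hh>. \<forall>u. \<omega> u (fundamental_field AP act X u) = X)"

definition cartan_geometry ::
    "('p::{t2_space, second_countable_topology}, 'e::euclidean_space) chart set \<Rightarrow>
     ('x::{t2_space, second_countable_topology}, 'f::euclidean_space) chart set \<Rightarrow>
     (real^'k::finite^'k) set \<Rightarrow> (real^'k^'k) set \<Rightarrow> (real^'k^'k) set \<Rightarrow>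
     ('p \<Rightarrow> 'x) \<Rightarrow> ('p \<Rightarrow> real^'k^'k \<Rightarrow> 'p) \<Rightarrow> ('p \<Rightarrow> ('p, 'e) tvec \<Rightarrow> real^'k^'k) \<Rightarrow> bool"
  where "cartan_geometry AP AN \<gg> H \<hh> p act \<omega> \<longleftrightarrow>
    smooth_atlas AP \<and> smooth_atlas AN \<and> connected (UNIV :: 'x set) \<and>
    principal_bundle AP AN H p act \<and> cartan_connection AP \<gg> H \<hh> act \<omega>"


section \<open>The model of type \<open>(Euc(n), O(n-1))\<close>\<close>

text \<open>The type \<open>'m\<close> has \<open>n - 1 \<ge> 1\<close> elements; \<open>\<real>^{n-1}\<close>, \<open>\<real>^n\<close> and \<open>\<real>^{n+1}\<close> are
  indexed by \<open>'m\<close>, \<open>'m option\<close> and \<open>'m option option\<close>, the first index being \<open>None\<close>.\<close>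

type_synonym 'm euc_mat = "real^('m option option)^('m option option)"

text \<open>The vector with first entry \<open>c\<close> and remaining entries \<open>v\<close>, and the block matrix
  with rows \<open>(c, r^t)\<close> and \<open>(v, A)\<close>.\<close>

definition vcons :: "real \<Rightarrow> real^'k::finite \<Rightarrow> real^('k option)"
  where "vcons c v = (\<chi> i. case i of None \<Rightarrow> c | Some a \<Rightarrow> v $ a)"

definition bordered :: "real \<Rightarrow> real^'k::finite \<Rightarrow> real^'k \<Rightarrow> real^'k^'k \<Rightarrow> real^('k option)^('k option)"
  where "bordered c r v A =
    (\<chi> i. case i of None \<Rightarrow> vcons c r | Some a \<Rightarrow> vcons (v $ a) (A $ a))"

definition euc_group :: "'m::finite euc_mat set"
  where "euc_group = {bordered 1 0 v A | v A. orthogonal_matrix A}"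

definition euc_algebra :: "'m::finite euc_mat set"
  where "euc_algebra = {bordered 0 0 v B | v B. transpose B = - B}"

definition isotropy_group :: "'m::finite euc_mat set"
  where "isotropy_group = {bordered 1 0 0 (bordered 1 0 0 h) | h. orthogonal_matrix h}"

definition isotropy_algebra :: "'m::finite euc_mat set"
  where "isotropy_algebra = {bordered 0 0 0 (bordered 0 0 0 B) | B. transpose B = - B}"

definition mvec :: "real \<times> (real^'m) \<times> (real^'m) \<Rightarrow> 'm::finite euc_mat"
  where "mvec = (\<lambda>(v0, v, w). bordered 0 0 (vcons v0 v) (bordered 0 (- w) w 0))"

definition m_space :: "'m::finite euc_mat set"
  where "m_space = range mvec"

definition e0 :: "'m::finite euc_mat" where "e0 = mvec (1, 0, 0)"
definition ee :: "'m::finite \<Rightarrow> 'm euc_mat" where "ee i = mvec (0, axis i 1, 0)"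
definition bb :: "'m::finite \<Rightarrow> 'm euc_mat" where "bb i = mvec (0, 0, axis i 1)"

definition E_space :: "'m::finite euc_mat set" where "E_space = span (range ee)"
definition B_space :: "'m::finite euc_mat set" where "B_space = span (range bb)"

definition m_coords :: "'m::finite euc_mat \<Rightarrow> real \<times> (real^'m) \<times> (real^'m)"
  where "m_coords = inv mvec"

definition m_inner :: "'m::finite euc_mat \<Rightarrow> 'm euc_mat \<Rightarrow> real"
  where "m_inner X Y = m_coords X \<bullet> m_coords Y"

definition m_psi :: "'m::finite euc_mat \<Rightarrow> 'm euc_mat"
  where "m_psi X = (case m_coords X of (v0, v, w) \<Rightarrow> mvec (0, - w, v))"

text \<open>The projection onto \<open>\<mm> \<cong> \<gg>/\<hh>\<close> along \<open>\<hh>\<close>.\<close>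

definition pr_m :: "'m::finite euc_mat \<Rightarrow> 'm euc_mat"
  where "pr_m X = (THE Y. Y \<in> m_space \<and> X - Y \<in> isotropy_algebra)"

text \<open>The linear isomorphism \<open>\<phi>\<^sub>u : T\<^sub>x N \<rightarrow> \<mm>\<close>, \<open>x = p u\<close>, induced by the Cartan connection.
  Extensionality makes it unique as a function on the type of all families of coordinates.\<close>

definition cartan_phi ::
    "('p, 'e::euclidean_space) chart set \<Rightarrow> ('x, 'f::euclidean_space) chart set \<Rightarrow> ('p \<Rightarrow> 'x) \<Rightarrow>
     ('p \<Rightarrow> ('p, 'e) tvec \<Rightarrow> 'm::finite euc_mat) \<Rightarrow> 'p \<Rightarrow> ('x, 'f) tvec \<Rightarrow> 'm euc_mat"
  where "cartan_phi AP AN p \<omega> u = (THE \<phi>.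
    \<phi> \<in> extensional (tangent AN (p u)) \<and>
    linear_iso_on (tangent AN (p u)) m_space \<phi> \<and>
    (\<forall>\<xi>\<in>tangent AP u. \<phi> (tangent_map AP AN p u \<xi>) = pr_m (\<omega> u \<xi>)))"

text \<open>The tuple \<open>(g, U, \<E>, \<B>, \<Psi>)\<close> is given by the pointwise formulas, for every choice of
  \<open>u\<close> in the fibre over a point.\<close>

definition induced_tuple ::
    "('p, 'e::euclidean_space) chart set \<Rightarrow> ('x, 'f::euclidean_space) chart set \<Rightarrow> ('p \<Rightarrow> 'x) \<Rightarrow>
     ('p \<Rightarrow> ('p, 'e) tvec \<Rightarrow> 'm::finite euc_mat) \<Rightarrow>
     ('x \<Rightarrow> ('x, 'f) tvec \<Rightarrow> ('x, 'f) tvec \<Rightarrow> real) \<Rightarrow> ('x \<Rightarrow> ('x, 'f) tvec) \<Rightarrow>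
     ('x \<Rightarrow> ('x, 'f) tvec set) \<Rightarrow> ('x \<Rightarrow> ('x, 'f) tvec set) \<Rightarrow>
     ('x \<Rightarrow> ('x, 'f) tvec \<Rightarrow> ('x, 'f) tvec) \<Rightarrow> bool"
  where "induced_tuple AP AN p \<omega> g U \<E> \<B> \<Psi> \<longleftrightarrow>
    (\<forall>x. \<forall>u\<in>p -` {x}.
      let T = tangent AN x; \<phi> = cartan_phi AP AN p \<omega> u in
      (\<forall>v\<in>T. \<forall>w\<in>T. g x v w = m_inner (\<phi> v) (\<phi> w)) \<and>
      U x = inv_into T \<phi> e0 \<and>
      \<E> x = {v \<in> T. \<phi> v \<in> E_space} \<and>
      \<B> x = {v \<in> T. \<phi> v \<in> B_space} \<and>
      (\<forall>v\<in>T. \<Psi> x v = inv_into T \<phi> (m_psi (\<phi> v))))"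


subsection \<open>Consistency of the explicit formulas\<close>

lemma vcons_nth [simp]: "vcons c v $ None = c" "vcons c v $ Some a = v $ a"
  by (simp_all add: vcons_def)

lemma vcons_eq_iff [simp]: "vcons c v = vcons c' v' \<longleftrightarrow> c = c' \<and> v = v'"
  unfolding vec_eq_iff split_option_all by simp

lemma bordered_nth [simp]:
  "bordered c r v A $ None = vcons c r" "bordered c r v A $ Some a = vcons (v $ a) (A $ a)"
  by (simp_all add: bordered_def)

lemma bordered_eq_iff [simp]:
  "bordered c r v A = bordered c' r' v' A' \<longleftrightarrow> c = c' \<and> r = r' \<and> v = v' \<and> A = A'"
proof -
  have "bordered c r v A = bordered c' r' v' A' \<longleftrightarrow>
      vcons c r = vcons c' r' \<and> (\<forall>a. vcons (v $ a) (A $ a) = vcons (v' $ a) (A' $ a))"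
    by (subst vec_eq_iff) (simp add: split_option_all del: vcons_eq_iff)
  also have "\<dots> \<longleftrightarrow> c = c' \<and> r = r' \<and> v = v' \<and> A = A'"
    unfolding vcons_eq_iff vec_eq_iff[of v] vec_eq_iff[of A] by blast
  finally show ?thesis .
qed

lemma inj_mvec: "inj mvec"
  by (auto simp: inj_def mvec_def)

lemma m_coords_mvec [simp]: "m_coords (mvec z) = z"
  by (simp add: m_coords_def inj_mvec)

lemma mvec_0: "mvec (0, 0, 0) = 0"
  by (simp add: mvec_def vec_eq_iff split_option_all)

lemma mvec_uminus: "mvec (- v0, - v, - w) = - mvec (v0, v, w)"
  by (simp add: mvec_def vec_eq_iff split_option_all)

lemma m_psi_basis: "m_psi e0 = 0" "m_psi (ee i) = bb i" "m_psi (bb i) = - ee i"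
  using mvec_uminus[of 0 "axis i 1" 0]
  by (simp_all add: m_psi_def e0_def ee_def bb_def mvec_0)

lemma m_inner_basis:
  "m_inner e0 e0 = 1" "m_inner e0 (ee i) = 0" "m_inner e0 (bb i) = 0"
  "m_inner (ee i) (ee j) = (if i = j then 1 else 0)" "m_inner (ee i) (bb j) = 0"
  "m_inner (bb i) (bb j) = (if i = j then 1 else 0)"
  by (simp_all add: m_inner_def e0_def ee_def bb_def inner_axis_axis)

lemma isotropy_group_subset: "isotropy_group \<subseteq> euc_group"
proof -
  have "orthogonal_matrix (bordered 1 0 0 h)" if "orthogonal_matrix h" for h :: "real^'a^'a"
  proof -
    have "transpose h ** h = mat 1"
      using that by (simp add: orthogonal_matrix)
    then have *: "(\<Sum>k\<in>UNIV. h $ k $ i * h $ k $ j) = (if i = j then 1 else 0)" for i j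
      by (simp add: matrix_matrix_mult_def transpose_def mat_def vec_eq_iff)
    have "(\<Sum>k\<in>UNIV. bordered 1 0 0 h $ k $ i * bordered 1 0 0 h $ k $ j) =
        (if i = j then 1 else 0)" for i j
      unfolding UNIV_option_conv
      by (cases i; cases j)
        (auto simp: * sum.reindex)
    then show ?thesis
      by (simp add: orthogonal_matrix matrix_matrix_mult_def transpose_def mat_def vec_eq_iff)
  qed
  then show ?thesis
    by (auto simp: isotropy_group_def euc_group_def)
qed

lemma pr_m_eq:
  assumes "transpose B = - B"
  shows "pr_m (bordered 0 0 (vcons v0 v) (bordered 0 (- w) w B)) = mvec (v0, v, w)"
proof -
  let ?X = "bordered 0 0 (vcons v0 v) (bordered 0 (- w) w B)"
  have X: "?X - mvec z = bordered 0 0 (vcons (v0 - fst z) (v - fst (snd z)))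
      (bordered 0 (- (w - snd (snd z))) (w - snd (snd z)) B)" for z
    by (cases z) (simp add: mvec_def vec_eq_iff split_option_all)
  have zero: "vcons 0 0 = (0 :: real^('a option))"
    by (simp add: vec_eq_iff split_option_all)
  have ex: "?X - mvec (v0, v, w) \<in> isotropy_algebra"
  proof -
    have "?X - mvec (v0, v, w) = bordered 0 0 0 (bordered 0 0 0 B)"
      by (simp add: X zero)
    then show ?thesis
      using assms unfolding isotropy_algebra_def by blast
  qed
  have uniq: "z = (v0, v, w)" if z: "?X - mvec z \<in> isotropy_algebra" for z
  proof -
    obtain C where "?X - mvec z = bordered 0 0 0 (bordered 0 0 0 C)"
      using z unfolding isotropy_algebra_def mem_Collect_eq by (elim exE conjE) (rule that)
    then have C: "bordered 0 0 (vcons (v0 - fst z) (v - fst (snd z)))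
        (bordered 0 (- (w - snd (snd z))) (w - snd (snd z)) B) =
      bordered 0 0 (vcons 0 0) (bordered 0 0 0 C)"
      unfolding X zero .
    have "v0 - fst z = 0 \<and> v - fst (snd z) = 0 \<and> w - snd (snd z) = 0"
      using C unfolding bordered_eq_iff vcons_eq_iff by (elim conjE) (intro conjI)
    then show ?thesis
      unfolding prod_eq_iff fst_conv snd_conv right_minus_eq by (elim conjE) (intro conjI; erule sym)
  qed
  show ?thesis
    unfolding pr_m_def m_space_def
  proof (rule the_equality)
    show "mvec (v0, v, w) \<in> range mvec \<and> ?X - mvec (v0, v, w) \<in> isotropy_algebra"
      using ex by (intro conjI rangeI)
  next
    fix Y assume Y: "Y \<in> range mvec \<and> ?X - Y \<in> isotropy_algebra"
    then obtain z where z: "Y = mvec z"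
      by (elim conjE rangeE)
    show "Y = mvec (v0, v, w)"
      unfolding z by (rule arg_cong[OF uniq]) (rule Y[unfolded z, THEN conjunct2])
  qed
qed

end

theory Submission
  imports Defs
begin

text \<open>
  For a point \<open>u\<close> over \<open>x\<close>, the form \<open>pr \<circ> \<omega>(u)\<close>, with values in \<open>\<gg>/\<hh> \<cong> \<mm>\<close>, descends
  along the tangent map \<open>T\<^sub>u p\<close> to a linear isomorphism \<open>T\<^sub>x N \<rightarrow> \<mm>\<close>, that is, to a coframe of \<open>N\<close> at
  \<open>x\<close>. This needs \<open>T\<^sub>u p\<close> to be surjective, which local sections through \<open>u\<close> show, and its kernel to be
  \<open>\<omega>(u)\<^sup>-\<^sup>1(\<hh>)\<close> (\<open>tangent_map_p_eq_0_iff\<close>). For the kernel, a vertical vector is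
  differentiated in a local trivialization: its component along the group is tangent to \<open>O(n-1)\<close>, so it is a
  left translate of some \<open>X \<in> \<hh>\<close>, and the vector is the value at \<open>u\<close> of the fundamental field of \<open>X\<close>, on
  which \<open>\<omega>\<close> is \<open>X\<close>. That fundamental fields are vertical and tangent to the total space rests on the fact
  that \<open>exp(tX)\<close> is a differentiable curve in \<open>O(n-1)\<close>. The coframe shows that the dimension of \<open>N\<close> is that of
  \<open>\<mm> = \<real> \<times> \<real>\<^sup>n\<^sup>-\<^sup>1 \<times> \<real>\<^sup>n\<^sup>-\<^sup>1\<close>.

  Equivariance of \<open>\<omega>\<close> says that another point of the same fibre changes the coframe by
  \<open>(v\<^sub>0, v, w) \<mapsto> (v\<^sub>0, kv, kw)\<close> with \<open>k\<close> orthogonal, and along a local section the coframe depends smoothly on the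
  base point. These properties alone (\<open>coframe_reduction\<close>) give the theorem: the inner product of \<open>\<mm>\<close>,
  the vector \<open>e\<^sub>0\<close>, the subspaces \<open>E\<close> and \<open>B\<close> and the map \<open>\<psi>\<close> are preserved by these rotations, so
  their pullbacks do not depend on the coframe, and all identities hold because they hold in \<open>\<mm>\<close>.
  Smoothness may be checked with a smooth local coframe; the metric and the dual form are
  expressed by the coframe, whereas \<open>U\<close>, \<open>\<E>\<close>, \<open>\<B>\<close> and \<open>\<Psi>\<close> involve its dual frame, which is smooth because
  the inverse of a smooth family of linear isomorphisms is smooth (\<open>smooth_on_linear_inverse\<close>).
\<close>

section \<open>Calculus of smooth maps\<close>

lemma cont_diff_on_cong:
  assumes "open S" "\<And>x. x \<in> S \<Longrightarrow> f x = g x" "cont_diff_on k S f"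
  shows "cont_diff_on k S g"
  using assms(2,3)
proof (induction k arbitrary: f g)
  case 0
  then show ?case by (auto cong: continuous_on_cong)
next
  case (Suc k)
  have eq: "frechet_derivative f (at x) = frechet_derivative g (at x)" if "x \<in> S" for x
    using Suc.prems that assms(1)
    by (intro frechet_derivative_transform_within_open[of _ _ S]) auto
  have "g differentiable (at x)" if "x \<in> S" for x
  proof -
    have "(f has_derivative frechet_derivative f (at x)) (at x)"
      using Suc.prems(2) that by (simp add: frechet_derivative_works[symmetric])
    then have "(g has_derivative frechet_derivative f (at x)) (at x)"
      by (rule has_derivative_transform_within_open[OF _ assms(1) that Suc.prems(1)])
    then show ?thesis by (auto simp: differentiable_def)
  qed
  moreover have "cont_diff_on k S (\<lambda>x. frechet_derivative g (at x) v)" for v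
    by (rule Suc.IH[where f="\<lambda>x. frechet_derivative f (at x) v"])
      (use Suc.prems(2) in \<open>simp_all only: eq cont_diff_on.simps\<close>)
  ultimately show ?case by simp
qed

lemma cont_diff_on_SucI:
  assumes "open S" "\<And>x. x \<in> S \<Longrightarrow> (f has_derivative f' x) (at x)"
    and "\<And>v. cont_diff_on k S (\<lambda>x. f' x v)"
  shows "cont_diff_on (Suc k) S f"
proof -
  have "cont_diff_on k S (\<lambda>x. frechet_derivative f (at x) v)" for v
    by (rule cont_diff_on_cong[OF assms(1) _ assms(3)])
      (rule fun_cong[OF frechet_derivative_at[OF assms(2)]])
  moreover have "f differentiable (at x)" if "x \<in> S" for x
    using assms(2)[OF that] unfolding differentiable_def by blast
  ultimately show ?thesis by simp
qed

lemma cont_diff_on_has_derivative: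
  assumes "cont_diff_on (Suc k) S f" "x \<in> S"
  shows "(f has_derivative frechet_derivative f (at x)) (at x)"
  using assms by (simp add: frechet_derivative_works[symmetric])

lemma cont_diff_on_SucD: "cont_diff_on (Suc k) S f \<Longrightarrow> cont_diff_on k S f"
proof (induction k arbitrary: f)
  case 0
  then have "f differentiable_on S"
    by (auto simp: differentiable_on_def intro: differentiable_at_withinI)
  then show ?case by (simp add: differentiable_imp_continuous_on)
next
  case (Suc k)
  then show ?case by (auto simp del: cont_diff_on.simps(1))
qed

lemma cont_diff_on_continuous_on: "cont_diff_on k S f \<Longrightarrow> continuous_on S f"
  by (induction k) (use cont_diff_on_SucD in auto)

lemma cont_diff_on_local:
  assumes "\<And>x. x \<in> S \<Longrightarrow> \<exists>T. open T \<and> x \<in> T \<and> cont_diff_on k T f"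
  shows "cont_diff_on k S f"
  using assms
proof (induction k arbitrary: f)
  case 0
  have "isCont f x" if "x \<in> S" for x
    using 0[OF that] by (auto simp: continuous_on_eq_continuous_at)
  then show ?case by (simp add: continuous_at_imp_continuous_on)
next
  case (Suc k)
  have "cont_diff_on k S (\<lambda>x. frechet_derivative f (at x) v)" for v
    by (rule Suc.IH) (use Suc.prems in fastforce)
  then show ?case using Suc.prems by fastforce
qed

lemma cont_diff_on_subset: "cont_diff_on k T f \<Longrightarrow> S \<subseteq> T \<Longrightarrow> cont_diff_on k S f"
  by (induction k arbitrary: f) (auto intro: continuous_on_subset)

lemma cont_diff_on_const: "open S \<Longrightarrow> cont_diff_on k S (\<lambda>x. c)"
proof (induction k arbitrary: c)
  case (Suc k)
  show ?case
    by (rule cont_diff_on_SucI[where f'="\<lambda>x v. 0"]) (use Suc in auto)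
qed simp

lemma cont_diff_on_linear:
  assumes "bounded_linear L" "open S" "cont_diff_on k S f"
  shows "cont_diff_on k S (\<lambda>x. L (f x))"
  using assms(3)
proof (induction k arbitrary: f)
  case 0
  then show ?case using bounded_linear.continuous_on[OF assms(1)] by simp
next
  case (Suc k)
  show ?case
    using assms(2) bounded_linear.has_derivative[OF assms(1) cont_diff_on_has_derivative[OF Suc.prems]]
    by (rule cont_diff_on_SucI) (use Suc in auto)
qed

lemma cont_diff_on_id: "open S \<Longrightarrow> cont_diff_on k S (\<lambda>x. x)"
proof (cases k)
  case (Suc j)
  assume "open S"
  then show ?thesis unfolding Suc
    by (rule cont_diff_on_SucI[where f'="\<lambda>x v. v"]) (auto intro: cont_diff_on_const \<open>open S\<close>)
qed simp

lemma cont_diff_on_add: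
  assumes "open S" "cont_diff_on k S f" "cont_diff_on k S g"
  shows "cont_diff_on k S (\<lambda>x. f x + g x)"
  using assms(2,3)
proof (induction k arbitrary: f g)
  case 0
  then show ?case by (auto intro: continuous_on_add)
next
  case (Suc k)
  show ?case
    using assms(1) has_derivative_add[OF cont_diff_on_has_derivative[OF Suc.prems(1)]
        cont_diff_on_has_derivative[OF Suc.prems(2)]]
    by (rule cont_diff_on_SucI) (use Suc in auto)
qed

lemma cont_diff_on_sum:
  assumes "open S" "\<And>i. i \<in> I \<Longrightarrow> cont_diff_on k S (f i)"
  shows "cont_diff_on k S (\<lambda>x. \<Sum>i\<in>I. f i x)"
  using assms(2) by (induction I rule: infinite_finite_induct)
    (auto intro: cont_diff_on_const cont_diff_on_add assms(1))

lemma cont_diff_on_bilinear: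
  assumes "bounded_bilinear pr" "open S" "cont_diff_on k S f" "cont_diff_on k S g"
  shows "cont_diff_on k S (\<lambda>x. pr (f x) (g x))"
  using assms(3,4)
proof (induction k arbitrary: f g)
  case 0
  then show ?case by (auto intro: bounded_bilinear.continuous_on[OF assms(1)])
next
  case (Suc k)
  have "cont_diff_on k S f" "cont_diff_on k S g"
    using Suc.prems[THEN cont_diff_on_SucD] by auto
  then show ?case
    using Suc.prems
    by (intro cont_diff_on_SucI[OF assms(2) bounded_bilinear.FDERIV[OF assms(1)
          cont_diff_on_has_derivative[OF Suc.prems(1)] cont_diff_on_has_derivative[OF Suc.prems(2)]]]
        cont_diff_on_add[OF assms(2)] Suc.IH) auto
qed

lemma linear_eq_sum_Basis:
  fixes f :: "'a::euclidean_space \<Rightarrow> 'b::real_vector"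
  assumes "linear f"
  shows "f v = (\<Sum>i\<in>Basis. (v \<bullet> i) *\<^sub>R f i)"
proof -
  have "f (\<Sum>i\<in>Basis. (v \<bullet> i) *\<^sub>R i) = (\<Sum>i\<in>Basis. (v \<bullet> i) *\<^sub>R f i)"
    by (simp add: linear_sum[OF assms] linear_cmul[OF assms])
  then show ?thesis by (simp add: euclidean_representation)
qed

lemma cont_diff_on_family:
  fixes F :: "'a::real_normed_vector \<Rightarrow> 'b::euclidean_space \<Rightarrow> 'c::real_normed_vector"
  assumes "open S" "\<And>a. a \<in> S \<Longrightarrow> linear (F a)"
    "\<And>i. i \<in> Basis \<Longrightarrow> cont_diff_on k S (\<lambda>a. F a i)" "cont_diff_on k S w"
  shows "cont_diff_on k S (\<lambda>a. F a (w a))"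
proof -
  have "cont_diff_on k S (\<lambda>a. \<Sum>i\<in>Basis. (w a \<bullet> i) *\<^sub>R F a i)"
    using assms by (intro cont_diff_on_sum cont_diff_on_bilinear[OF bounded_bilinear_scaleR]
        cont_diff_on_linear[OF bounded_linear_inner_left]) auto
  then show ?thesis
    by (rule cont_diff_on_cong[OF assms(1), rotated])
      (simp add: linear_eq_sum_Basis[OF assms(2), symmetric])
qed

text \<open>The derivative \<open>D g (f x) (D f x v)\<close> is a family of linear maps, with coefficients obtained from
  partial derivatives of \<open>g\<close> by composition with \<open>f\<close>, applied to a varying vector. It is therefore of class
  \<open>C^k\<close> by the induction hypothesis and the product rule.\<close>

lemma cont_diff_on_compose:
  fixes g :: "'b::euclidean_space \<Rightarrow> 'c::real_normed_vector"
  assumes "open S" "open T" "f ` S \<subseteq> T" "cont_diff_on k T g" "cont_diff_on k S f"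
  shows "cont_diff_on k S (\<lambda>x. g (f x))"
  using assms(4,5)
proof (induction k arbitrary: g)
  case 0
  then show ?case using continuous_on_compose2[of T g S f] assms(3) by auto
next
  case (Suc k)
  note Df = cont_diff_on_has_derivative[OF Suc.prems(2)]
  have Dg: "(g has_derivative frechet_derivative g (at (f x))) (at (f x))" if "x \<in> S" for x
    using cont_diff_on_has_derivative[OF Suc.prems(1)] that assms(3) by auto
  have lin: "linear (frechet_derivative g (at (f x)))" if "x \<in> S" for x
    using Dg[OF that] by (rule has_derivative_linear)
  have "cont_diff_on k S f" by (rule cont_diff_on_SucD[OF Suc.prems(2)])
  then have i: "cont_diff_on k S (\<lambda>x. frechet_derivative g (at (f x)) i)" for i
    using Suc.prems by (intro Suc.IH[where g="\<lambda>y. frechet_derivative g (at y) i"]) auto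
  have D: "((\<lambda>x. g (f x)) has_derivative
      (\<lambda>v. frechet_derivative g (at (f x)) (frechet_derivative f (at x) v))) (at x)" if "x \<in> S" for x
    using has_derivative_compose[OF Df Dg] that by simp
  show ?case
    using assms(1) D
  proof (rule cont_diff_on_SucI)
    show "cont_diff_on k S (\<lambda>x. frechet_derivative g (at (f x)) (frechet_derivative f (at x) v))" for v
      using Suc.prems(2)
      by (intro cont_diff_on_family[OF assms(1) lin i]) auto
  qed
qed

text \<open>At a zero of one factor the product rule needs only continuity of the other factor. This breaks
  the circularity in differentiating an inverse: its continuity suffices.\<close>

lemma has_derivative_vanishing_scaleR:
  fixes r :: "'a::real_normed_vector \<Rightarrow> real" and c :: "'a \<Rightarrow> 'b::real_normed_vector"
  assumes r: "(r has_derivative r') (at x)" and "r x = 0" and c: "isCont c x"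
  shows "((\<lambda>y. r y *\<^sub>R c y) has_derivative (\<lambda>v. r' v *\<^sub>R c x)) (at x)"
proof -
  have bl: "bounded_linear r'" using r by (rule has_derivative_bounded_linear)
  then obtain K where K: "\<And>v. norm (r' v) \<le> norm v * K" using bounded_linear.bounded by blast
  have "((\<lambda>y. norm (r y - r x - r' (y - x)) / norm (y - x)) \<longlongrightarrow> 0) (at x)"
    using r by (simp add: has_derivative_iff_norm)
  then have ev: "\<forall>\<^sub>F y in at x. norm (r y - r x - r' (y - x)) / norm (y - x) < 1"
    by (rule order_tendstoD) simp
  have "((\<lambda>y. r y *\<^sub>R (c y - c x)) has_derivative (\<lambda>v. 0)) (at x)"
    unfolding has_derivative_iff_norm
  proof (intro conjI)
    have "((\<lambda>y. (1 + K) * norm (c y - c x)) \<longlongrightarrow> (1 + K) * norm (c x - c x)) (at x)"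
      using c by (intro tendsto_intros) (simp add: isCont_def)
    then have lim: "((\<lambda>y. (1 + K) * norm (c y - c x)) \<longlongrightarrow> 0) (at x)" by simp
    show "((\<lambda>y. norm (r y *\<^sub>R (c y - c x) - r x *\<^sub>R (c x - c x) - 0) / norm (y - x)) \<longlongrightarrow> 0) (at x)"
    proof (rule Lim_null_comparison[OF _ lim])
      show "\<forall>\<^sub>F y in at x. norm (norm (r y *\<^sub>R (c y - c x) - r x *\<^sub>R (c x - c x) - 0) / norm (y - x))
          \<le> (1 + K) * norm (c y - c x)"
        using ev
      proof eventually_elim
        case (elim y)
        show ?case
        proof (cases "y = x")
          case False
          then have pos: "norm (y - x) > 0" by simp
          have "norm (r y - r' (y - x)) \<le> norm (y - x)"
            using elim(1) pos \<open>r x = 0\<close> by (simp add: field_simps)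
          then have "norm (r y) \<le> norm (y - x) + norm (r' (y - x))"
            using norm_triangle_ineq2[of "r y" "r' (y - x)"] by linarith
          also have "\<dots> \<le> (1 + K) * norm (y - x)" using K[of "y - x"] by (simp add: algebra_simps)
          finally have *: "\<bar>r y\<bar> \<le> (1 + K) * norm (y - x)" by simp
          have "\<bar>r y\<bar> * norm (c y - c x) / norm (y - x) \<le> (1 + K) * norm (c y - c x)"
            using mult_right_mono[OF *, of "norm (c y - c x)"] pos by (simp add: field_simps)
          then show ?thesis using \<open>r x = 0\<close> by simp
        qed (simp)
      qed
    qed
  qed (rule bounded_linear_zero)
  moreover have "((\<lambda>y. r y *\<^sub>R c x) has_derivative (\<lambda>v. r' v *\<^sub>R c x)) (at x)"
    by (rule has_derivative_scaleR_left[OF r])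
  ultimately have "((\<lambda>y. r y *\<^sub>R (c y - c x) + r y *\<^sub>R c x) has_derivative (\<lambda>v. 0 + r' v *\<^sub>R c x)) (at x)"
    by (rule has_derivative_add)
  then show ?thesis by (simp add: algebra_simps)
qed

text \<open>The inverse \<open>G a\<close> of a family \<open>F a\<close> of linear isomorphisms inherits the regularity of \<open>F\<close>. The
  derivative of \<open>G a e\<close> is \<open>- G a (F' (G a e))\<close>, in which only \<open>G\<close> and first derivatives of \<open>F\<close>
  occur, so the order of differentiability can be raised step by step.\<close>

context
  fixes S :: "'a::real_normed_vector set"
    and F :: "'a \<Rightarrow> 'b::euclidean_space \<Rightarrow> 'c::euclidean_space" and G :: "'a \<Rightarrow> 'c \<Rightarrow> 'b"
  assumes S: "open S" and lin: "\<And>a. a \<in> S \<Longrightarrow> linear (F a)"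
    and FG: "\<And>a e. a \<in> S \<Longrightarrow> F a (G a e) = e" and GF: "\<And>a v. a \<in> S \<Longrightarrow> G a (F a v) = v"
begin

lemma linear_inverse_family: "a \<in> S \<Longrightarrow> linear (G a)"
proof (rule linearI)
  assume a: "a \<in> S"
  fix x y r
  have "G a (F a (G a x + G a y)) = G a (x + y)" by (simp add: linear_add[OF lin[OF a]] FG[OF a])
  then show "G a (x + y) = G a x + G a y" by (simp add: GF[OF a])
  have "G a (F a (r *\<^sub>R G a x)) = G a (r *\<^sub>R x)" by (simp add: linear_cmul[OF lin[OF a]] FG[OF a])
  then show "G a (r *\<^sub>R x) = r *\<^sub>R G a x" by (simp add: GF[OF a])
qed

lemma isCont_linear_inverse:
  assumes a: "a \<in> S" and cont: "\<And>v. isCont (\<lambda>a. F a v) a"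
  shows "isCont (\<lambda>a. G a e) a"
proof -
  \<comment> \<open>A bound for the operator norm of the difference of \<open>G a \<circ> F b\<close> and the identity.\<close>
  define \<delta> where "\<delta> b = (\<Sum>i\<in>Basis. norm (G a (F b i - F a i)))" for b
  have bl: "bounded_linear (G a)"
    using linear_inverse_family[OF a] by (simp add: linear_conv_bounded_linear)
  have "(\<delta> \<longlongrightarrow> (\<Sum>i\<in>Basis. norm (G a (F a i - F a i)))) (at a)"
    unfolding \<delta>_def using cont
    by (intro tendsto_intros bounded_linear.tendsto[OF bl]) (auto simp: isCont_def)
  then have \<delta>0: "(\<delta> \<longlongrightarrow> 0) (at a)" by (simp add: linear_0[OF linear_inverse_family[OF a]])
  have key: "norm (G b e - G a e) \<le> norm (G b e) * \<delta> b" if b: "b \<in> S" for b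
  proof -
    have l: "linear (\<lambda>w. G a (F b w - F a w))"
      using linear_compose[OF linear_compose_sub[OF lin[OF b] lin[OF a]] linear_inverse_family[OF a]]
      by (simp add: o_def)
    have "G a e - G b e = G a (F b (G b e) - F a (G b e))"
      using linear_diff[OF linear_inverse_family[OF a]] by (simp add: FG GF a b)
    also have "\<dots> = (\<Sum>i\<in>Basis. (G b e \<bullet> i) *\<^sub>R G a (F b i - F a i))"
      by (rule linear_eq_sum_Basis[OF l])
    also have "norm \<dots> \<le> (\<Sum>i\<in>Basis. norm (G b e) * norm (G a (F b i - F a i)))"
      by (rule order_trans[OF norm_sum]) (auto intro!: sum_mono mult_right_mono Basis_le_norm)
    finally show ?thesis by (simp add: \<delta>_def sum_distrib_left norm_minus_commute)
  qed
  have "\<forall>\<^sub>F b in at a. \<delta> b < 1/2" using \<delta>0 by (rule order_tendstoD) simp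
  moreover have "\<forall>\<^sub>F b in at a. b \<in> S" using S a by (rule eventually_at_in_open')
  ultimately have "\<forall>\<^sub>F b in at a. norm (G b e - G a e) \<le> 2 * norm (G a e) * \<delta> b"
  proof eventually_elim
    case (elim b)
    have "norm (G b e) * \<delta> b \<le> norm (G b e) * (1/2)"
      using elim by (intro mult_left_mono) auto
    then have "norm (G b e) \<le> 2 * norm (G a e)"
      using key[OF elim(2)] norm_triangle_ineq2[of "G b e" "G a e"] by linarith
    moreover have "0 \<le> \<delta> b" unfolding \<delta>_def by (simp add: sum_nonneg)
    ultimately have "norm (G b e) * \<delta> b \<le> 2 * norm (G a e) * \<delta> b" by (intro mult_right_mono) auto
    then show ?case using key[OF elim(2)] by linarith
  qed
  moreover have "((\<lambda>b. 2 * norm (G a e) * \<delta> b) \<longlongrightarrow> 0) (at a)" by (rule tendsto_mult_right_zero[OF \<delta>0])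
  ultimately have "((\<lambda>b. G b e - G a e) \<longlongrightarrow> 0) (at a)" by (rule Lim_null_comparison)
  then show ?thesis by (simp add: isCont_def LIM_zero_iff)
qed

text \<open>With \<open>y = G a e\<close> one has \<open>G b e = y - G b (F b y - e)\<close>, and \<open>F b y - e\<close> vanishes at \<open>b = a\<close>.\<close>

lemma has_derivative_linear_inverse:
  assumes a: "a \<in> S" and D: "\<And>v. ((\<lambda>a. F a v) has_derivative (\<lambda>h. F' h v)) (at a)"
  shows "((\<lambda>a. G a e) has_derivative (\<lambda>h. - (\<Sum>i\<in>Basis. (F' h (G a e) \<bullet> i) *\<^sub>R G a i))) (at a)"
proof -
  let ?y = "G a e"
  have cont: "isCont (\<lambda>a. G a i) a" for i
    using a by (rule isCont_linear_inverse) (rule has_derivative_continuous[OF D])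
  have r: "((\<lambda>b. (F b ?y - e) \<bullet> i) has_derivative (\<lambda>h. F' h ?y \<bullet> i)) (at a)" for i
    using has_derivative_inner_left[OF has_derivative_diff[OF D[of ?y] has_derivative_const[of e]], of i]
    by simp
  have "((\<lambda>b. \<Sum>i\<in>Basis. ((F b ?y - e) \<bullet> i) *\<^sub>R G b i) has_derivative
      (\<lambda>h. \<Sum>i\<in>Basis. (F' h ?y \<bullet> i) *\<^sub>R G a i)) (at a)"
    by (intro has_derivative_sum has_derivative_vanishing_scaleR r cont) (simp add: FG a)
  then have "((\<lambda>b. ?y - (\<Sum>i\<in>Basis. ((F b ?y - e) \<bullet> i) *\<^sub>R G b i)) has_derivative
      (\<lambda>h. 0 - (\<Sum>i\<in>Basis. (F' h ?y \<bullet> i) *\<^sub>R G a i))) (at a)"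
    by (intro has_derivative_diff has_derivative_const)
  then have *: "((\<lambda>b. ?y - (\<Sum>i\<in>Basis. ((F b ?y - e) \<bullet> i) *\<^sub>R G b i)) has_derivative
      (\<lambda>h. - (\<Sum>i\<in>Basis. (F' h ?y \<bullet> i) *\<^sub>R G a i))) (at a)"
    by simp
  show ?thesis
  proof (rule has_derivative_transform_within_open[OF * S a])
    fix b assume b: "b \<in> S"
    have "(\<Sum>i\<in>Basis. ((F b ?y - e) \<bullet> i) *\<^sub>R G b i) = G b (F b ?y - e)"
      by (rule linear_eq_sum_Basis[OF linear_inverse_family[OF b], symmetric])
    then show "?y - (\<Sum>i\<in>Basis. ((F b ?y - e) \<bullet> i) *\<^sub>R G b i) = G b e"
      by (simp add: linear_diff[OF linear_inverse_family[OF b]] GF b)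
  qed
qed

lemma cont_diff_on_linear_inverse:
  assumes "\<And>v. cont_diff_on k S (\<lambda>a. F a v)"
  shows "cont_diff_on k S (\<lambda>a. G a e)"
  using assms
proof (induction k arbitrary: e)
  case 0
  then show ?case
    using isCont_linear_inverse by (auto simp: continuous_on_eq_continuous_at S)
next
  case (Suc k)
  let ?F' = "\<lambda>a h v. frechet_derivative (\<lambda>a. F a v) (at a) h"
  have D: "((\<lambda>a. F a v) has_derivative (\<lambda>h. ?F' a h v)) (at a)" if "a \<in> S" for a v
    using cont_diff_on_has_derivative[OF Suc.prems that] .
  have IH: "cont_diff_on k S (\<lambda>a. G a e)" for e
    by (rule Suc.IH) (rule cont_diff_on_SucD[OF Suc.prems])
  have lin': "linear (?F' a h)" if a: "a \<in> S" for a h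
  proof (rule linearI)
    fix v w :: 'b and r :: real
    have "((\<lambda>a. F a (v + w)) has_derivative (\<lambda>h. ?F' a h v + ?F' a h w)) (at a)"
      by (rule has_derivative_transform_within_open[OF has_derivative_add[OF D[OF a] D[OF a]] S a])
        (simp add: linear_add[OF lin])
    then show "?F' a h (v + w) = ?F' a h v + ?F' a h w"
      by (rule fun_cong[OF frechet_derivative_at, symmetric])
    have "((\<lambda>a. F a (r *\<^sub>R v)) has_derivative (\<lambda>h. r *\<^sub>R ?F' a h v)) (at a)"
      by (rule has_derivative_transform_within_open[OF has_derivative_scaleR_right[OF D[OF a]] S a])
        (simp add: linear_cmul[OF lin])
    then show "?F' a h (r *\<^sub>R v) = r *\<^sub>R ?F' a h v"
      by (rule fun_cong[OF frechet_derivative_at, symmetric])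
  qed
  show ?case
    using S has_derivative_linear_inverse[OF _ D]
  proof (rule cont_diff_on_SucI)
    fix h
    have "cont_diff_on k S (\<lambda>a. ?F' a h (G a e))"
      using Suc.prems by (intro cont_diff_on_family[OF S lin' _ IH]) auto
    then show "cont_diff_on k S (\<lambda>a. - (\<Sum>i\<in>Basis. (?F' a h (G a e) \<bullet> i) *\<^sub>R G a i))"
      by (intro cont_diff_on_linear[OF bounded_linear_minus[OF bounded_linear_ident]] S
          cont_diff_on_sum cont_diff_on_bilinear[OF bounded_bilinear_scaleR]
          cont_diff_on_linear[OF bounded_linear_inner_left] IH)
  qed assumption
qed

end


lemma smooth_on_cong:
  "open S \<Longrightarrow> (\<And>x. x \<in> S \<Longrightarrow> f x = g x) \<Longrightarrow> smooth_on S f \<Longrightarrow> smooth_on S g"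
  unfolding smooth_on_def by (blast intro: cont_diff_on_cong)

lemma smooth_on_mono: "smooth_on T f \<Longrightarrow> S \<subseteq> T \<Longrightarrow> smooth_on S f"
  unfolding smooth_on_def by (blast intro: cont_diff_on_subset)

lemma smooth_on_local:
  assumes "\<And>x. x \<in> S \<Longrightarrow> \<exists>T. open T \<and> x \<in> T \<and> smooth_on T f"
  shows "smooth_on S f"
  unfolding smooth_on_def
proof
  show "cont_diff_on k S f" for k
    by (rule cont_diff_on_local) (use assms in \<open>auto simp: smooth_on_def\<close>)
qed

lemma smooth_on_continuous_on: "smooth_on S f \<Longrightarrow> continuous_on S f"
  by (auto simp: smooth_on_def intro: cont_diff_on_continuous_on)

lemma smooth_on_frechet_derivative:
  "smooth_on S f \<Longrightarrow> smooth_on S (\<lambda>x. frechet_derivative f (at x) v)"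
  unfolding smooth_on_def using cont_diff_on.simps(2) by blast

lemma smooth_on_has_derivative:
  "smooth_on S f \<Longrightarrow> x \<in> S \<Longrightarrow> (f has_derivative frechet_derivative f (at x)) (at x)"
  unfolding smooth_on_def using cont_diff_on_has_derivative by blast

lemma smooth_on_compose:
  fixes g :: "'b::euclidean_space \<Rightarrow> 'c::real_normed_vector"
  shows "open S \<Longrightarrow> open T \<Longrightarrow> f ` S \<subseteq> T \<Longrightarrow> smooth_on T g \<Longrightarrow> smooth_on S f
    \<Longrightarrow> smooth_on S (\<lambda>x. g (f x))"
  unfolding smooth_on_def by (blast intro: cont_diff_on_compose)

lemma smooth_on_const: "open S \<Longrightarrow> smooth_on S (\<lambda>x. c)"
  by (simp add: smooth_on_def cont_diff_on_const)

lemma smooth_on_id: "open S \<Longrightarrow> smooth_on S (\<lambda>x. x)"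
  by (simp add: smooth_on_def cont_diff_on_id)

lemma smooth_on_add:
  "open S \<Longrightarrow> smooth_on S f \<Longrightarrow> smooth_on S g \<Longrightarrow> smooth_on S (\<lambda>x. f x + g x)"
  by (simp add: smooth_on_def cont_diff_on_add)

lemma smooth_on_linear:
  "bounded_linear L \<Longrightarrow> open S \<Longrightarrow> smooth_on S f \<Longrightarrow> smooth_on S (\<lambda>x. L (f x))"
  by (simp add: smooth_on_def cont_diff_on_linear)

lemma smooth_on_bilinear:
  "bounded_bilinear pr \<Longrightarrow> open S \<Longrightarrow> smooth_on S f \<Longrightarrow> smooth_on S g
    \<Longrightarrow> smooth_on S (\<lambda>x. pr (f x) (g x))"
  by (simp add: smooth_on_def cont_diff_on_bilinear)

lemma smooth_on_family:
  fixes F :: "'a::real_normed_vector \<Rightarrow> 'b::euclidean_space \<Rightarrow> 'c::real_normed_vector"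
  assumes "open S" "\<And>a. a \<in> S \<Longrightarrow> linear (F a)"
    "\<And>i. smooth_on S (\<lambda>a. F a i)" "smooth_on S w"
  shows "smooth_on S (\<lambda>a. F a (w a))"
  using assms by (simp add: smooth_on_def cont_diff_on_family)

lemma smooth_on_linear_inverse:
  fixes F :: "'a::real_normed_vector \<Rightarrow> 'b::euclidean_space \<Rightarrow> 'c::euclidean_space"
  assumes "open S" "\<And>a. a \<in> S \<Longrightarrow> linear (F a)"
    and "\<And>a e. a \<in> S \<Longrightarrow> F a (G a e) = e" "\<And>a v. a \<in> S \<Longrightarrow> G a (F a v) = v"
    and "\<And>v. smooth_on S (\<lambda>a. F a v)"
  shows "smooth_on S (\<lambda>a. G a e)"
  unfolding smooth_on_def
  by (intro allI cont_diff_on_linear_inverse[OF assms(1-4)])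
    (use assms(5) in \<open>auto simp: smooth_on_def\<close>)

section \<open>Charts and tangent maps\<close>

lemma in_charts_at: "k \<in> charts_at A x \<longleftrightarrow> k \<in> A \<and> x \<in> cdom k"
  by (simp add: charts_at_def)

lemma charts_at_nonempty:
  assumes "smooth_atlas A"
  obtains k where "k \<in> charts_at A x"
proof -
  have "x \<in> (\<Union>k\<in>A. cdom k)" using assms by (simp add: smooth_atlas_def)
  then show ?thesis using that by (auto simp: in_charts_at)
qed

lemma open_cdom: "smooth_atlas A \<Longrightarrow> k \<in> A \<Longrightarrow> open (cdom k)"
  by (simp add: smooth_atlas_def)

lemma chart_homeomorphism:
  "smooth_atlas A \<Longrightarrow> k \<in> A \<Longrightarrow> homeomorphism (cdom k) (cmap k ` cdom k) (cmap k) (cinv k)"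
  by (simp add: smooth_atlas_def)

lemma cinv_cmap:
  assumes "smooth_atlas A" "k \<in> A" "x \<in> cdom k"
  shows "cinv k (cmap k x) = x"
  using homeomorphism_apply1[OF chart_homeomorphism[OF assms(1,2)] assms(3)] .

lemma open_cmap_image:
  assumes "smooth_atlas A" "k \<in> A" "open W" "W \<subseteq> cdom k"
  shows "open (cmap k ` W)"
proof -
  have "openin (top_of_set (cdom k)) W"
    using assms by (simp add: open_cdom openin_open_eq)
  then have "openin (top_of_set (cmap k ` cdom k)) (cmap k ` W)"
    by (rule homeomorphism_imp_open_map[OF chart_homeomorphism[OF assms(1,2)]])
  moreover have "open (cmap k ` cdom k)" using assms(1,2) by (simp add: smooth_atlas_def)
  ultimately show ?thesis by (simp add: openin_open_eq)
qed

lemma open_chart_preimage: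
  assumes "smooth_atlas A" "smooth_atlas B" "k \<in> A" "l \<in> B" "open S" "continuous_on S f"
  shows "open {x \<in> cdom k \<inter> S. f x \<in> cdom l}"
proof -
  have "open (S \<inter> f -` cdom l)"
    using assms by (intro continuous_open_preimage) (auto intro: open_cdom)
  then have "open (cdom k \<inter> (S \<inter> f -` cdom l))" using assms by (auto intro: open_cdom)
  moreover have "cdom k \<inter> (S \<inter> f -` cdom l) = {x \<in> cdom k \<inter> S. f x \<in> cdom l}" by auto
  ultimately show ?thesis by simp
qed

lemma open_chart_domain:
  assumes "smooth_atlas A" "smooth_atlas B" "k \<in> A" "l \<in> B" "open S" "continuous_on S f"
  shows "open (cmap k ` {x \<in> cdom k \<inter> S. f x \<in> cdom l})"
  by (rule open_cmap_image[OF assms(1,3) open_chart_preimage[OF assms]]) auto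

text \<open>The chain rule for local representatives. Taking one of the maps to be the identity gives the
  change of charts in the source or in the target.\<close>

lemma chart_chain:
  assumes A: "smooth_atlas A" and B: "smooth_atlas B"
    and k: "k \<in> charts_at A x" and l: "l \<in> charts_at B (f x)"
    and S: "open S" "x \<in> S" "continuous_on S f" and eq: "\<And>y. y \<in> S \<Longrightarrow> g (f y) = h y"
    and F: "((cmap l \<circ> f \<circ> cinv k) has_derivative F') (at (cmap k x))"
    and G: "((cmap m \<circ> g \<circ> cinv l) has_derivative G') (at (cmap l (f x)))"
  shows "((cmap m \<circ> h \<circ> cinv k) has_derivative (G' \<circ> F')) (at (cmap k x))"
proof -
  let ?W = "{x \<in> cdom k \<inter> S. f x \<in> cdom l}"
  have W: "open (cmap k ` ?W)"
    using A B k l S by (intro open_chart_domain) (auto simp: in_charts_at)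
  have inv: "cinv k (cmap k y) = y" if "y \<in> cdom k" for y
    using cinv_cmap[OF A _ that] k by (simp add: in_charts_at)
  have x: "x \<in> ?W" using k l S by (auto simp: in_charts_at)
  have "((cmap m \<circ> g \<circ> cinv l) \<circ> (cmap l \<circ> f \<circ> cinv k) has_derivative (G' \<circ> F')) (at (cmap k x))"
    by (rule diff_chain_at[OF F]) (use G x inv in simp)
  then show ?thesis
    by (rule has_derivative_transform_within_open[OF _ W])
      (use x l in \<open>auto simp: inv eq in_charts_at cinv_cmap[OF B]\<close>)
qed

lemma smooth_map_has_derivative:
  assumes A: "smooth_atlas A" and B: "smooth_atlas B"
    and f: "smooth_map_on A B S f" and x: "x \<in> S"
    and k: "k \<in> charts_at A x" and l: "l \<in> charts_at B (f x)"
  shows "((cmap l \<circ> f \<circ> cinv k) has_derivative frechet_derivative (cmap l \<circ> f \<circ> cinv k) (at (cmap k x)))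
    (at (cmap k x))"
proof -
  have "smooth_on (cmap k ` {x \<in> cdom k \<inter> S. f x \<in> cdom l}) (cmap l \<circ> f \<circ> cinv k)"
    using f k l by (auto simp: smooth_map_on_def in_charts_at)
  then show ?thesis
    by (rule smooth_on_has_derivative) (use x k l in \<open>auto simp: in_charts_at\<close>)
qed

lemma smooth_map_on_continuous: "smooth_map_on A B S f \<Longrightarrow> continuous_on S f"
  by (simp add: smooth_map_on_def)

lemma smooth_map_on_ident:
  assumes "smooth_atlas A" "open S"
  shows "smooth_map_on A A S (\<lambda>x. x)"
proof -
  have "smooth_on (cmap k ` {x \<in> cdom k \<inter> S. x \<in> cdom l}) (cmap l \<circ> (\<lambda>x. x) \<circ> cinv k)"
    if "k \<in> A" "l \<in> A" for k l
  proof (rule smooth_on_mono)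
    show "smooth_on (cmap k ` (cdom k \<inter> cdom l)) (cmap l \<circ> (\<lambda>x. x) \<circ> cinv k)"
      using assms(1) that by (simp add: smooth_atlas_def o_def)
  qed auto
  then show ?thesis by (simp add: smooth_map_on_def)
qed

abbreviation transition_deriv :: "('a, 'e::euclidean_space) chart \<Rightarrow> ('a, 'e) chart \<Rightarrow> 'a \<Rightarrow> 'e \<Rightarrow> 'e"
  where "transition_deriv k l x \<equiv> frechet_derivative (cmap l \<circ> cinv k) (at (cmap k x))"

lemma has_derivative_transition:
  assumes A: "smooth_atlas A" and k: "k \<in> charts_at A x" and l: "l \<in> charts_at A x"
  shows "((cmap l \<circ> (\<lambda>y. y) \<circ> cinv k) has_derivative transition_deriv k l x) (at (cmap k x))"
  using smooth_map_has_derivative[OF A A smooth_map_on_ident[OF A open_UNIV] UNIV_I k l]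
  by (simp add: o_def)

lemma transition_deriv_compose:
  assumes A: "smooth_atlas A"
    and k: "k \<in> charts_at A x" and l: "l \<in> charts_at A x" and m: "m \<in> charts_at A x"
  shows "transition_deriv l m x (transition_deriv k l x v) = transition_deriv k m x v"
proof -
  have "((cmap m \<circ> (\<lambda>y. y) \<circ> cinv k) has_derivative (transition_deriv l m x \<circ> transition_deriv k l x))
      (at (cmap k x))"
    by (rule chart_chain[OF A A k l open_UNIV UNIV_I continuous_on_id refl
        has_derivative_transition[OF A k l] has_derivative_transition[OF A l m]])
  from fun_cong[OF frechet_derivative_at[OF this], of v] show ?thesis by (simp add: o_def)
qed

lemma transition_deriv_refl:
  assumes A: "smooth_atlas A" and k: "k \<in> charts_at A x"
  shows "transition_deriv k k x v = v"
proof -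
  have k': "k \<in> A" "x \<in> cdom k" using k by (auto simp: in_charts_at)
  have "((\<lambda>b. b) has_derivative (\<lambda>v. v)) (at (cmap k x))" by simp
  then have "((cmap k \<circ> cinv k) has_derivative (\<lambda>v. v)) (at (cmap k x))"
    by (rule has_derivative_transform_within_open[OF _ open_cmap_image[OF A k'(1) open_cdom[OF A k'(1)] subset_refl]])
      (use k' in \<open>auto simp: cinv_cmap[OF A]\<close>)
  from fun_cong[OF frechet_derivative_at[OF this], of v] show ?thesis by simp
qed

lemma linear_transition_deriv:
  "smooth_atlas A \<Longrightarrow> k \<in> charts_at A x \<Longrightarrow> l \<in> charts_at A x \<Longrightarrow> linear (transition_deriv k l x)"
  by (rule has_derivative_linear[OF has_derivative_transition])

lemma tangentI:
  assumes A: "smooth_atlas A" and k: "k \<in> charts_at A x"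
    and "\<And>l. l \<notin> charts_at A x \<Longrightarrow> \<xi> l = 0"
    and eq: "\<And>l. l \<in> charts_at A x \<Longrightarrow> \<xi> l = transition_deriv k l x (\<xi> k)"
  shows "\<xi> \<in> tangent A x"
proof -
  have "\<xi> m = transition_deriv l m x (\<xi> l)" if "l \<in> charts_at A x" "m \<in> charts_at A x" for l m
    using transition_deriv_compose[OF A k that, of "\<xi> k"] eq[OF that(1)] eq[OF that(2)] by simp
  then show ?thesis using assms(3) unfolding tangent_def by blast
qed

lemma tangent_chart:
  "\<xi> \<in> tangent A x \<Longrightarrow> k \<in> charts_at A x \<Longrightarrow> l \<in> charts_at A x \<Longrightarrow> \<xi> l = transition_deriv k l x (\<xi> k)"
  unfolding tangent_def by blast

lemma tangent_off: "\<xi> \<in> tangent A x \<Longrightarrow> k \<notin> charts_at A x \<Longrightarrow> \<xi> k = 0"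
  unfolding tangent_def by blast

lemma tangent_eqI:
  assumes "\<xi> \<in> tangent A x" "\<eta> \<in> tangent A x" "k \<in> charts_at A x" "\<xi> k = \<eta> k"
  shows "\<xi> = \<eta>"
proof
  fix l show "\<xi> l = \<eta> l"
  proof (cases "l \<in> charts_at A x")
    case True
    show ?thesis
      unfolding tangent_chart[OF assms(1,3) True] tangent_chart[OF assms(2,3) True] assms(4) ..
  next
    case False
    then show ?thesis using tangent_off[OF assms(1)] tangent_off[OF assms(2)] by simp
  qed
qed

lemma chart_vec_tangent:
  assumes A: "smooth_atlas A" and k: "k \<in> charts_at A x"
  shows "chart_vec A k x v \<in> tangent A x"
  by (rule tangentI[OF A k]) (auto simp: chart_vec_def k transition_deriv_refl[OF A k])

lemma chart_vec_self:
  "smooth_atlas A \<Longrightarrow> k \<in> charts_at A x \<Longrightarrow> chart_vec A k x v k = v"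
  by (simp add: chart_vec_def transition_deriv_refl)

lemma chart_vec_of_tangent:
  assumes A: "smooth_atlas A" and k: "k \<in> charts_at A x" and \<xi>: "\<xi> \<in> tangent A x"
  shows "chart_vec A k x (\<xi> k) = \<xi>"
  by (rule tangent_eqI[OF chart_vec_tangent[OF A k] \<xi> k]) (rule chart_vec_self[OF A k])

lemma subspace_tangent:
  assumes A: "smooth_atlas A"
  shows "subspace (tangent A x)"
  unfolding subspace_def
proof (intro conjI ballI allI)
  obtain k where k: "k \<in> charts_at A x" using charts_at_nonempty[OF A] .
  note lin = linear_transition_deriv[OF A k]
  show "0 \<in> tangent A x"
    by (rule tangentI[OF A k]) (auto simp: linear_0[OF lin])
  fix \<xi> assume \<xi>: "\<xi> \<in> tangent A x"
  show "r *\<^sub>R \<xi> \<in> tangent A x" for r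
    by (rule tangentI[OF A k])
      (simp_all add: scaleR_fun_def linear_cmul[OF lin] tangent_off[OF \<xi>] tangent_chart[OF \<xi> k])
  fix \<eta> assume \<eta>: "\<eta> \<in> tangent A x"
  show "\<xi> + \<eta> \<in> tangent A x"
    by (rule tangentI[OF A k])
      (simp_all add: linear_add[OF lin] tangent_off[OF \<xi>] tangent_chart[OF \<xi> k]
        tangent_off[OF \<eta>] tangent_chart[OF \<eta> k])
qed

lemma linear_chart_vec:
  assumes A: "smooth_atlas A" and k: "k \<in> charts_at A x"
  shows "linear (chart_vec A k x)"
proof -
  note lin = linear_transition_deriv[OF A k]
  show ?thesis
    by (rule linearI; rule ext)
      (simp_all add: chart_vec_def scaleR_fun_def linear_add[OF lin] linear_cmul[OF lin])
qed

text \<open>The tangent map is defined by an arbitrarily chosen chart of the source; by the chain rule every other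
  chart represents it too.\<close>

lemma tangent_map_chart:
  assumes A: "smooth_atlas A" and B: "smooth_atlas B"
    and f: "smooth_map_on A B S f" and S: "open S" "x \<in> S" and \<xi>: "\<xi> \<in> tangent A x"
    and k: "k \<in> charts_at A x" and l: "l \<in> charts_at B (f x)"
  shows "tangent_map A B f x \<xi> l = frechet_derivative (cmap l \<circ> f \<circ> cinv k) (at (cmap k x)) (\<xi> k)"
proof -
  define k0 where "k0 = (SOME k. k \<in> charts_at A x)"
  have k0: "k0 \<in> charts_at A x" unfolding k0_def by (rule someI[of _ k]) (rule k)
  have "((cmap l \<circ> f \<circ> cinv k0) has_derivative
      (frechet_derivative (cmap l \<circ> f \<circ> cinv k) (at (cmap k x)) \<circ> transition_deriv k0 k x)) (at (cmap k0 x))"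
    by (rule chart_chain[OF A A k0 k S continuous_on_id refl has_derivative_transition[OF A k0 k]
        smooth_map_has_derivative[OF A B f S(2) k l]])
  from fun_cong[OF frechet_derivative_at[OF this], of "\<xi> k0"] show ?thesis
    using l by (simp add: tangent_map_def Let_def k0_def[symmetric] tangent_chart[OF \<xi> k0 k])
qed

lemma tangent_map_tangent:
  assumes A: "smooth_atlas A" and B: "smooth_atlas B"
    and f: "smooth_map_on A B S f" and S: "open S" "x \<in> S" and \<xi>: "\<xi> \<in> tangent A x"
  shows "tangent_map A B f x \<xi> \<in> tangent B (f x)"
proof -
  obtain k where k: "k \<in> charts_at A x" using charts_at_nonempty[OF A] .
  obtain l where l: "l \<in> charts_at B (f x)" using charts_at_nonempty[OF B] .
  show ?thesis
  proof (rule tangentI[OF B l])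
    show "tangent_map A B f x \<xi> m = 0" if "m \<notin> charts_at B (f x)" for m
      using that by (simp add: tangent_map_def Let_def)
    fix m assume m: "m \<in> charts_at B (f x)"
    have "((cmap m \<circ> f \<circ> cinv k) has_derivative
        (transition_deriv l m (f x) \<circ> frechet_derivative (cmap l \<circ> f \<circ> cinv k) (at (cmap k x)))) (at (cmap k x))"
      by (rule chart_chain[OF A B k l S smooth_map_on_continuous[OF f] refl
          smooth_map_has_derivative[OF A B f S(2) k l] has_derivative_transition[OF B l m]])
    from fun_cong[OF frechet_derivative_at[OF this], of "\<xi> k"]
    show "tangent_map A B f x \<xi> m = transition_deriv l m (f x) (tangent_map A B f x \<xi> l)"
      by (simp add: tangent_map_chart[OF A B f S \<xi> k l] tangent_map_chart[OF A B f S \<xi> k m])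
  qed
qed

lemma tangent_map_compose:
  assumes A: "smooth_atlas A" and B: "smooth_atlas B" and C: "smooth_atlas C"
    and f: "smooth_map_on A B S f" and S: "open S" "x \<in> S" and \<xi>: "\<xi> \<in> tangent A x"
    and g: "smooth_map_on B C T g" and T: "open T" "f x \<in> T"
    and h: "smooth_map_on A C S h" and eq: "\<And>y. y \<in> S \<Longrightarrow> g (f y) = h y"
  shows "tangent_map B C g (f x) (tangent_map A B f x \<xi>) = tangent_map A C h x \<xi>"
proof -
  obtain k where k: "k \<in> charts_at A x" using charts_at_nonempty[OF A] .
  obtain l where l: "l \<in> charts_at B (f x)" using charts_at_nonempty[OF B] .
  obtain m where m: "m \<in> charts_at C (h x)" using charts_at_nonempty[OF C] .
  have hx: "h x = g (f x)" using eq[OF S(2)] by simp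
  then have m': "m \<in> charts_at C (g (f x))" using m by simp
  note f\<xi> = tangent_map_tangent[OF A B f S \<xi>]
  have "((cmap m \<circ> h \<circ> cinv k) has_derivative
      (frechet_derivative (cmap m \<circ> g \<circ> cinv l) (at (cmap l (f x)))
        \<circ> frechet_derivative (cmap l \<circ> f \<circ> cinv k) (at (cmap k x)))) (at (cmap k x))"
    by (rule chart_chain[OF A B k l S smooth_map_on_continuous[OF f] eq
          smooth_map_has_derivative[OF A B f S(2) k l] smooth_map_has_derivative[OF B C g T(2) l m']])
  from fun_cong[OF frechet_derivative_at[OF this], of "\<xi> k"]
  have "tangent_map B C g (f x) (tangent_map A B f x \<xi>) m = tangent_map A C h x \<xi> m"
    by (simp add: tangent_map_chart[OF A B f S \<xi> k l] tangent_map_chart[OF A C h S \<xi> k m]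
        tangent_map_chart[OF B C g T f\<xi> l m'])
  then show ?thesis
    using tangent_eqI[OF tangent_map_tangent[OF B C g T f\<xi>] _ m'] tangent_map_tangent[OF A C h S \<xi>]
    by (simp add: hx)
qed

lemma tangent_map_ident:
  assumes A: "smooth_atlas A" and \<xi>: "\<xi> \<in> tangent A x"
  shows "tangent_map A A (\<lambda>y. y) x \<xi> = \<xi>"
proof -
  obtain k where k: "k \<in> charts_at A x" using charts_at_nonempty[OF A] .
  note i = smooth_map_on_ident[OF A open_UNIV]
  have "tangent_map A A (\<lambda>y. y) x \<xi> k = \<xi> k"
    using tangent_map_chart[OF A A i open_UNIV UNIV_I \<xi> k k] transition_deriv_refl[OF A k]
    by (simp add: o_def)
  then show ?thesis
    by (rule tangent_eqI[OF tangent_map_tangent[OF A A i open_UNIV UNIV_I \<xi>] \<xi> k])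
qed

lemma linear_on_tangent_map:
  assumes A: "smooth_atlas A" and B: "smooth_atlas B"
    and f: "smooth_map_on A B S f" and S: "open S" "x \<in> S"
  shows "linear_on (tangent A x) (tangent_map A B f x)"
proof -
  obtain k where k: "k \<in> charts_at A x" using charts_at_nonempty[OF A] .
  obtain l where l: "l \<in> charts_at B (f x)" using charts_at_nonempty[OF B] .
  note T = tangent_map_tangent[OF A B f S] and E = tangent_map_chart[OF A B f S _ k l]
  note lin = has_derivative_linear[OF smooth_map_has_derivative[OF A B f S(2) k l]]
  note sub = subspace_tangent[OF A, of x] subspace_tangent[OF B, of "f x"]
  show ?thesis
    unfolding linear_on_def
  proof (intro conjI ballI allI)
    fix \<xi> assume \<xi>: "\<xi> \<in> tangent A x"
    show "tangent_map A B f x (r *\<^sub>R \<xi>) = r *\<^sub>R tangent_map A B f x \<xi>" for r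
    proof (rule tangent_eqI[OF T _ l])
      show "r *\<^sub>R \<xi> \<in> tangent A x" using \<xi> by (rule subspace_scale[OF sub(1)])
      from E[OF this] E[OF \<xi>]
      show "tangent_map A B f x (r *\<^sub>R \<xi>) l = (r *\<^sub>R tangent_map A B f x \<xi>) l"
        by (simp add: scaleR_fun_def linear_cmul[OF lin])
      show "r *\<^sub>R tangent_map A B f x \<xi> \<in> tangent B (f x)"
        using T[OF \<xi>] by (rule subspace_scale[OF sub(2)])
    qed
    fix \<eta> assume \<eta>: "\<eta> \<in> tangent A x"
    show "tangent_map A B f x (\<xi> + \<eta>) = tangent_map A B f x \<xi> + tangent_map A B f x \<eta>"
      by (rule tangent_eqI[OF T _ l])
        (simp_all add: \<xi> \<eta> T E subspace_add[OF sub(1)] subspace_add[OF sub(2)] linear_add[OF lin])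
  qed
qed

text \<open>Smoothness on \<open>V \<times> H\<close> provides a smooth function on an open set of the ambient vector space, which
  can be differentiated in all directions although \<open>H\<close> is not open.\<close>

lemma smooth_prod_map_extension:
  fixes AN :: "('x::{t2_space, second_countable_topology}, 'f::euclidean_space) chart set"
    and AP :: "('p::{t2_space, second_countable_topology}, 'e::euclidean_space) chart set"
  assumes N: "smooth_atlas AN" and \<sigma>: "smooth_prod_map_on AN AP V H \<sigma>"
    and y: "y \<in> V" "h \<in> H" and k: "k \<in> charts_at AN y" and l: "l \<in> charts_at AP (\<sigma> y h)"
  obtains T g where "open T" "(cmap k y, h) \<in> T" "smooth_on T g"
    "\<And>y' h'. y' \<in> V \<Longrightarrow> y' \<in> cdom k \<Longrightarrow> h' \<in> H \<Longrightarrow> \<sigma> y' h' \<in> cdom l \<Longrightarrow> (cmap k y', h') \<in> T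
      \<Longrightarrow> g (cmap k y', h') = cmap l (\<sigma> y' h')"
proof -
  let ?D = "{(a, h). a \<in> cmap k ` (cdom k \<inter> V) \<and> h \<in> H \<and> \<sigma> (cinv k a) h \<in> cdom l}"
  have kl: "k \<in> AN" "y \<in> cdom k" "l \<in> AP" "\<sigma> y h \<in> cdom l" using k l by (auto simp: in_charts_at)
  have "smooth_on_subset ?D (\<lambda>(a, h). cmap l (\<sigma> (cinv k a) h))"
    using \<sigma> kl by (auto simp: smooth_prod_map_on_def)
  moreover have "(cmap k y, h) \<in> ?D" using kl y by (auto simp: cinv_cmap[OF N])
  ultimately obtain T g where Tg: "open T" "(cmap k y, h) \<in> T" "smooth_on T g"
    "\<forall>z\<in>?D \<inter> T. g z = (\<lambda>(a, h). cmap l (\<sigma> (cinv k a) h)) z"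
    unfolding smooth_on_subset_def by blast
  show ?thesis
  proof (rule that[OF Tg(1-3)])
    fix y' h' assume *: "y' \<in> V" "y' \<in> cdom k" "h' \<in> H" "\<sigma> y' h' \<in> cdom l" "(cmap k y', h') \<in> T"
    then have "(cmap k y', h') \<in> ?D \<inter> T" using kl by (auto simp: cinv_cmap[OF N])
    from bspec[OF Tg(4) this] show "g (cmap k y', h') = cmap l (\<sigma> y' h')"
      using * kl by (simp add: cinv_cmap[OF N])
  qed
qed

lemma smooth_prod_map_slice:
  fixes AN :: "('x::{t2_space, second_countable_topology}, 'f::euclidean_space) chart set"
    and AP :: "('p::{t2_space, second_countable_topology}, 'e::euclidean_space) chart set"
    and H :: "'w::euclidean_space set"
  assumes N: "smooth_atlas AN" and P: "smooth_atlas AP" and V: "open V"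
    and \<sigma>: "smooth_prod_map_on AN AP V H \<sigma>" and h: "h \<in> H"
  shows "smooth_map_on AN AP V (\<lambda>y. \<sigma> y h)"
  unfolding smooth_map_on_def
proof (intro conjI ballI)
  have "continuous_on (V \<times> H) (\<lambda>(x, h). \<sigma> x h)" using \<sigma> by (simp add: smooth_prod_map_on_def)
  then have "continuous_on V (\<lambda>y. (\<lambda>(x, h). \<sigma> x h) (y, h))"
    by (rule continuous_on_compose2) (use h in \<open>auto intro!: continuous_intros\<close>)
  then show cont: "continuous_on V (\<lambda>y. \<sigma> y h)" by simp
  fix k l assume kl: "k \<in> AN" "l \<in> AP"
  let ?W = "{x \<in> cdom k \<inter> V. \<sigma> x h \<in> cdom l}"
  have W: "open (cmap k ` ?W)" by (rule open_chart_domain[OF N P kl V cont])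
  show "smooth_on (cmap k ` ?W) (cmap l \<circ> (\<lambda>y. \<sigma> y h) \<circ> cinv k)"
  proof (rule smooth_on_local)
    fix a assume "a \<in> cmap k ` ?W"
    then obtain y where y: "a = cmap k y" "y \<in> V" "y \<in> cdom k" "\<sigma> y h \<in> cdom l" by auto
    obtain T g where Tg: "open T" "(cmap k y, h) \<in> T" "smooth_on T g"
      and g: "\<And>y' h'. y' \<in> V \<Longrightarrow> y' \<in> cdom k \<Longrightarrow> h' \<in> H \<Longrightarrow> \<sigma> y' h' \<in> cdom l \<Longrightarrow> (cmap k y', h') \<in> T
      \<Longrightarrow> g (cmap k y', h') = cmap l (\<sigma> y' h')"
      by (rule smooth_prod_map_extension[OF N \<sigma> y(2) h, of k l]) (use kl y in \<open>auto simp: in_charts_at\<close>)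
    let ?T = "(\<lambda>a. (a, h)) -` T \<inter> cmap k ` ?W"
    have T: "open ?T"
      by (intro open_Int W open_vimage Tg(1) continuous_on_Pair continuous_on_id continuous_on_const)
    have "smooth_on ?T (\<lambda>a. (a, 0) + (0, h))"
      by (rule smooth_on_add[OF T smooth_on_linear[OF bounded_linear_Pair[OF bounded_linear_ident
            bounded_linear_zero] T smooth_on_id[OF T]] smooth_on_const[OF T]])
    then have "smooth_on ?T (\<lambda>a. g (a, h))"
      using smooth_on_compose[OF T Tg(1) _ Tg(3), of "\<lambda>a. (a, h)"] by auto
    then have "smooth_on ?T (cmap l \<circ> (\<lambda>y. \<sigma> y h) \<circ> cinv k)"
      by (rule smooth_on_cong[OF T, rotated])
        (use h g kl in \<open>auto simp: cinv_cmap[OF N]\<close>)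
    then show "\<exists>T. open T \<and> a \<in> T \<and> smooth_on T (cmap l \<circ> (\<lambda>y. \<sigma> y h) \<circ> cinv k)"
      using T Tg(2) y by (intro exI[of _ ?T]) auto
  qed
qed

section \<open>The matrix exponential and the model space\<close>

lemma matrix_inv_orthogonal:
  fixes h :: "real^'k::finite^'k"
  assumes "orthogonal_matrix h"
  shows "matrix_inv h = transpose h"
proof -
  have h: "h ** transpose h = mat 1" "transpose h ** h = mat 1"
    using assms by (auto simp: orthogonal_matrix_def)
  then have "h ** matrix_inv h = mat 1 \<and> matrix_inv h ** h = mat 1"
    unfolding matrix_inv_def by (intro someI[of "\<lambda>A'. h ** A' = mat 1 \<and> A' ** h = mat 1"]) auto
  then have "matrix_inv h = (transpose h ** h) ** matrix_inv h" by (simp add: h)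
  also have "\<dots> = transpose h"
    using \<open>h ** matrix_inv h = mat 1 \<and> _\<close> by (simp only: matrix_mul_assoc[symmetric] matrix_mul_rid)
  finally show ?thesis .
qed

lemma matrix_mult_nth: "(A ** B) $ a $ b = (\<Sum>c\<in>UNIV. A $ a $ c * B $ c $ b)"
  by (simp add: matrix_matrix_mult_def)

lemma mat_nth: "mat c $ a $ b = (if a = b then c else 0)"
  by (simp add: mat_def)

lemma transpose_nth: "transpose A $ a $ b = A $ b $ a"
  by (simp add: transpose_def)

lemma matrix_add_rdistrib: "(A + B) ** C = A ** C + B ** C"
  for A :: "real^'n::finite^'m::finite"
  by (simp add: vec_eq_iff matrix_mult_nth distrib_right sum.distrib)

lemma has_vector_derivative_vec:
  fixes f :: "real \<Rightarrow> 'b::euclidean_space^'n::finite"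
  assumes "\<And>i. ((\<lambda>t. f t $ i) has_vector_derivative D $ i) (at t)"
  shows "(f has_vector_derivative D) (at t)"
  unfolding has_vector_derivative_def
proof (subst has_derivative_componentwise_within, rule ballI)
  fix b :: "'b^'n" assume "b \<in> Basis"
  then obtain i u where b: "b = axis i u" by (auto simp: Basis_vec_def)
  have "((\<lambda>t. f t $ i \<bullet> u) has_derivative (\<lambda>h. (h *\<^sub>R D $ i) \<bullet> u)) (at t)"
    using assms[of i] unfolding has_vector_derivative_def by (rule has_derivative_inner_left)
  then show "((\<lambda>t. f t \<bullet> b) has_derivative (\<lambda>h. (h *\<^sub>R D) \<bullet> b)) (at t)"
    by (simp add: b inner_axis)
qed

lemma mat_pow_scaleR: "mat_pow (t *\<^sub>R X) j = t ^ j *\<^sub>R mat_pow X j"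
  by (induction j) (simp_all add: vec_eq_iff matrix_mult_nth sum_distrib_left mult_ac)

lemma mat_pow_bound:
  fixes X :: "real^'k::finite^'k"
  shows "\<bar>mat_pow X j $ a $ b\<bar> \<le> (\<Sum>a\<in>UNIV. \<Sum>c\<in>UNIV. \<bar>X $ a $ c\<bar>) ^ j"
proof (induction j arbitrary: a b)
  case 0
  then show ?case by (simp add: mat_nth)
next
  case (Suc j)
  let ?K = "\<Sum>a\<in>UNIV. \<Sum>c\<in>UNIV. \<bar>X $ a $ c\<bar>"
  have row: "(\<Sum>c\<in>UNIV. \<bar>X $ a $ c\<bar>) \<le> ?K"
    by (rule member_le_sum) (auto intro: sum_nonneg)
  have "0 \<le> ?K" by (intro sum_nonneg) auto
  have "\<bar>mat_pow X (Suc j) $ a $ b\<bar> \<le> (\<Sum>c\<in>UNIV. \<bar>X $ a $ c\<bar> * \<bar>mat_pow X j $ c $ b\<bar>)"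
    by (simp add: matrix_mult_nth abs_mult[symmetric] sum_abs)
  also have "\<dots> \<le> (\<Sum>c\<in>UNIV. \<bar>X $ a $ c\<bar> * ?K ^ j)"
    by (intro sum_mono mult_left_mono Suc.IH) auto
  also have "\<dots> \<le> ?K ^ Suc j"
    using mult_right_mono[OF row, of "?K ^ j"] \<open>0 \<le> ?K\<close> by (simp add: sum_distrib_right[symmetric])
  finally show ?case .
qed

context
  fixes X :: "real^'k::finite^'k"
begin

lemma summable_mat_exp_entry: "summable (\<lambda>j. mat_pow X j $ a $ b / fact j * t ^ j)"
proof (rule summable_comparison_test')
  let ?K = "\<Sum>a\<in>UNIV. \<Sum>c\<in>UNIV. \<bar>X $ a $ c\<bar>"
  show "summable (\<lambda>j. inverse (fact j) * (?K * \<bar>t\<bar>) ^ j)" by (rule summable_exp)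
  show "norm (mat_pow X j $ a $ b / fact j * t ^ j) \<le> inverse (fact j) * (?K * \<bar>t\<bar>) ^ j" for j
    using mult_right_mono[OF mat_pow_bound[of X j a b], of "\<bar>t\<bar> ^ j"]
    by (simp add: abs_mult power_abs power_mult_distrib field_simps)
qed

text \<open>Entrywise, the exponential along a line is a scalar power series with infinite radius of
  convergence; this gives its derivative without a normed algebra of matrices.\<close>

lemma mat_exp_nth: "mat_exp (t *\<^sub>R X) $ a $ b = (\<Sum>j. mat_pow X j $ a $ b / fact j * t ^ j)"
proof -
  have "(\<lambda>j. (1 / fact j) *\<^sub>R mat_pow (t *\<^sub>R X) j) sums
      (\<chi> a b. \<Sum>j. mat_pow X j $ a $ b / fact j * t ^ j)"
    unfolding sums_def
  proof (intro vec_tendstoI)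
    fix a b
    show "((\<lambda>n. (\<Sum>j<n. (1 / fact j) *\<^sub>R mat_pow (t *\<^sub>R X) j) $ a $ b) \<longlongrightarrow>
      (\<chi> a b. \<Sum>j. mat_pow X j $ a $ b / fact j * t ^ j) $ a $ b) sequentially"
      using summable_LIMSEQ[OF summable_mat_exp_entry[of a b t]]
      by (simp add: mat_pow_scaleR mult.commute)
  qed
  then show ?thesis by (simp add: mat_exp_def sums_iff)
qed

lemma mat_exp_0: "mat_exp (0 *\<^sub>R X) = mat 1"
  unfolding vec_eq_iff mat_exp_nth powser_zero by simp

lemma has_derivative_mat_exp_entry:
  "((\<lambda>t. mat_exp (t *\<^sub>R X) $ a $ b) has_field_derivative (X ** mat_exp (t *\<^sub>R X)) $ a $ b) (at t)"
proof -
  have "diffs (\<lambda>j. mat_pow X j $ a $ b / fact j) j * t ^ j =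
      (\<Sum>c\<in>UNIV. X $ a $ c * (mat_pow X j $ c $ b / fact j * t ^ j))" for j
  proof -
    have "diffs (\<lambda>j. mat_pow X j $ a $ b / fact j) j = mat_pow X (Suc j) $ a $ b / fact j"
      by (simp add: diffs_def del: of_nat_Suc mat_pow.simps)
    then show ?thesis
      by (simp add: matrix_mult_nth sum_divide_distrib sum_distrib_right sum_distrib_left mult_ac)
  qed
  moreover have "(\<Sum>j. \<Sum>c\<in>UNIV. X $ a $ c * (mat_pow X j $ c $ b / fact j * t ^ j)) =
      (\<Sum>c\<in>UNIV. X $ a $ c * (\<Sum>j. mat_pow X j $ c $ b / fact j * t ^ j))"
    by (subst suminf_sum)
      (simp_all only: summable_mult[OF summable_mat_exp_entry] suminf_mult[OF summable_mat_exp_entry])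
  ultimately have "(\<Sum>j. diffs (\<lambda>j. mat_pow X j $ a $ b / fact j) j * t ^ j) =
      (X ** mat_exp (t *\<^sub>R X)) $ a $ b"
    by (simp only: matrix_mult_nth mat_exp_nth)
  then show ?thesis
    using termdiffs_strong_converges_everywhere[of "\<lambda>j. mat_pow X j $ a $ b / fact j" t]
      summable_mat_exp_entry[of a b]
    unfolding mat_exp_nth by simp
qed

lemma has_vector_derivative_mat_exp:
  "((\<lambda>t. mat_exp (t *\<^sub>R X)) has_vector_derivative X ** mat_exp (t *\<^sub>R X)) (at t)"
  by (intro has_vector_derivative_vec)
    (simp add: has_derivative_mat_exp_entry has_real_derivative_iff_has_vector_derivative[symmetric])

lemma has_vector_derivative_mat_exp_0: "((\<lambda>t. mat_exp (t *\<^sub>R X)) has_vector_derivative X) (at 0)"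
  using has_vector_derivative_mat_exp[of 0] by (simp only: mat_exp_0 matrix_mul_rid)

lemma continuous_on_mat_exp: "continuous_on UNIV (\<lambda>t. mat_exp (t *\<^sub>R X))"
  using has_vector_derivative_mat_exp has_vector_derivative_continuous continuous_at_imp_continuous_on
  by blast

text \<open>For \<open>E(t) = exp(tX)\<close>, the derivative of \<open>E(t)\<^sup>T E(t)\<close> is \<open>E(t)\<^sup>T (X\<^sup>T + X) E(t) = 0\<close>.\<close>

lemma mat_exp_skew_orthogonal:
  assumes "transpose X = - X"
  shows "orthogonal_matrix (mat_exp (t *\<^sub>R X))"
proof -
  let ?E = "\<lambda>t. mat_exp (t *\<^sub>R X)"
  let ?P = "\<lambda>t. transpose (?E t) ** ?E t"
  have "((\<lambda>t. ?P t $ a $ b) has_field_derivative 0) (at t)" for a b t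
  proof -
    have "((\<lambda>t. \<Sum>c\<in>UNIV. ?E t $ c $ a * ?E t $ c $ b) has_field_derivative
        (\<Sum>c\<in>UNIV. (X ** ?E t) $ c $ a * ?E t $ c $ b + (X ** ?E t) $ c $ b * ?E t $ c $ a)) (at t)"
      by (intro DERIV_sum DERIV_mult has_derivative_mat_exp_entry)
    also have "(\<Sum>c\<in>UNIV. (X ** ?E t) $ c $ a * ?E t $ c $ b + (X ** ?E t) $ c $ b * ?E t $ c $ a) =
        (transpose (X ** ?E t) ** ?E t + transpose (?E t) ** (X ** ?E t)) $ a $ b"
      by (simp add: matrix_mult_nth[of "transpose _"] transpose_nth sum.distrib mult.commute)
    also have "transpose (X ** ?E t) ** ?E t + transpose (?E t) ** (X ** ?E t) =
        transpose (?E t) ** ((transpose X + X) ** ?E t)"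
      by (simp add: matrix_transpose_mul matrix_add_ldistrib matrix_add_rdistrib matrix_mul_assoc)
    also have "\<dots> = 0" by (simp add: assms)
    finally show ?thesis by (simp add: matrix_mult_nth transpose_nth)
  qed
  then have "?P t $ a $ b = ?P 0 $ a $ b" for a b
    using DERIV_isconst_all[of "\<lambda>t. ?P t $ a $ b" t 0] by blast
  then have "?P t = mat 1" unfolding vec_eq_iff by (simp only: mat_exp_0) (simp add: transpose_mat)
  then show ?thesis by (simp add: orthogonal_matrix)
qed

lemma mat_exp_zero_row:
  assumes "\<And>c. X $ a $ c = 0"
  shows "mat_exp (t *\<^sub>R X) $ a $ b = (if a = b then 1 else 0)"
proof -
  have "mat_pow X j $ a $ b / fact j * t ^ j = (if j = 0 then if a = b then 1 else 0 else 0)" for j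
    using assms by (cases j) (simp_all add: matrix_mult_nth mat_nth)
  then show ?thesis
    unfolding mat_exp_nth using sums_unique[OF sums_single[of 0 "\<lambda>_. if a = b then 1 else 0 :: real"]]
    by (simp only:)
qed

lemma mat_exp_zero_column:
  assumes "\<And>c. X $ c $ b = 0"
  shows "mat_exp (t *\<^sub>R X) $ a $ b = (if a = b then 1 else 0)"
proof -
  have "mat_pow X (Suc j) $ a $ b = 0" for j a
    using assms by (induction j arbitrary: a) (simp_all add: matrix_mult_nth mat_nth)
  then have "mat_pow X j $ a $ b / fact j * t ^ j = (if j = 0 then if a = b then 1 else 0 else 0)" for j
    by (cases j) (simp_all add: mat_nth del: mat_pow.simps(2))
  then show ?thesis
    unfolding mat_exp_nth using sums_unique[OF sums_single[of 0 "\<lambda>_. if a = b then 1 else 0 :: real"]]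
    by (simp only:)
qed

end

lemma sum_option: "(\<Sum>c\<in>UNIV. f c) = f None + (\<Sum>c\<in>UNIV. f (Some c))"
  for f :: "'k::finite option \<Rightarrow> 'a::comm_monoid_add"
  unfolding UNIV_option_conv by (simp add: sum.reindex)

lemma isotropy_group_iff:
  fixes h :: "'m::finite euc_mat"
  shows "h \<in> isotropy_group \<longleftrightarrow> orthogonal_matrix h \<and>
    (\<forall>a\<in>{None, Some None}. \<forall>b. h $ a $ b = (if a = b then 1 else 0) \<and> h $ b $ a = (if a = b then 1 else 0))"
    (is "_ \<longleftrightarrow> ?R")
proof
  assume "h \<in> isotropy_group"
  then obtain k :: "real^'m^'m" where k: "orthogonal_matrix k" and h: "h = bordered 1 0 0 (bordered 1 0 0 k)"
    unfolding isotropy_group_def by blast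
  have "transpose k ** k = mat 1" using k by (simp add: orthogonal_matrix)
  then have "(transpose k ** k) $ i $ j = mat 1 $ i $ j" for i j by simp
  then have *: "(\<Sum>c\<in>UNIV. k $ c $ i * k $ c $ j) = (if i = j then 1 else 0)" for i j
    by (simp add: matrix_mult_nth transpose_nth mat_nth)
  show ?R
    by (auto simp: h orthogonal_matrix vec_eq_iff matrix_mult_nth transpose_nth mat_nth sum_option
        split_option_all *)
next
  assume R: ?R
  define k :: "real^'m^'m" where "k = (\<chi> i j. h $ Some (Some i) $ Some (Some j))"
  have h: "h = bordered 1 0 0 (bordered 1 0 0 k)"
    using R by (auto simp: vec_eq_iff split_option_all k_def)
  have "transpose h ** h = mat 1" using R by (simp add: orthogonal_matrix)
  then have "(transpose h ** h) $ Some (Some i) $ Some (Some j) = mat 1 $ Some (Some i) $ Some (Some j)" for i j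
    by simp
  then have "transpose k ** k = mat 1"
    by (simp add: vec_eq_iff h matrix_mult_nth transpose_nth mat_nth sum_option)
  then show "h \<in> isotropy_group" using h unfolding isotropy_group_def orthogonal_matrix by blast
qed

lemma skew_nth: "transpose B = - B \<longleftrightarrow> (\<forall>a b. B $ a $ b = - B $ b $ a)"
  for B :: "real^'k::finite^'k"
proof -
  have "transpose B = - B \<longleftrightarrow> (\<forall>a b. B $ b $ a = - B $ a $ b)"
    unfolding vec_eq_iff by (simp add: transpose_nth)
  then show ?thesis by blast
qed

lemma euc_algebra_iff:
  fixes X :: "'m::finite euc_mat"
  shows "X \<in> euc_algebra \<longleftrightarrow>
    (\<forall>b. X $ None $ b = 0) \<and> (\<forall>a b. X $ Some a $ Some b = - X $ Some b $ Some a)" (is "_ \<longleftrightarrow> ?R")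
proof
  assume "X \<in> euc_algebra"
  then obtain v :: "real^'m option" and B where X: "X = bordered 0 0 v B" and "transpose B = - B"
    unfolding euc_algebra_def by blast
  then have B: "\<forall>a b. B $ a $ b = - B $ b $ a" unfolding skew_nth by - assumption
  have "X $ None $ b = 0" for b by (cases b) (simp_all add: X)
  moreover have "X $ Some a $ Some b = - X $ Some b $ Some a" for a b
    using B[rule_format, of a b] by (simp add: X)
  ultimately show ?R by (intro conjI allI)
next
  assume R: ?R
  define v :: "real^'m option" where "v = (\<chi> i. X $ Some i $ None)"
  define B :: "real^'m option^'m option" where "B = (\<chi> i j. X $ Some i $ Some j)"
  have "X $ None $ b = 0" for b using R by (elim conjE allE)
  then have "X $ a $ b = bordered 0 0 v B $ a $ b" for a b
    by (cases a; cases b) (simp_all add: v_def B_def)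
  then have "X = bordered 0 0 v B" by (simp add: vec_eq_iff)
  moreover have "transpose B = - B"
    unfolding skew_nth B_def vec_lambda_beta by (intro allI conjunct2[OF R, rule_format])
  ultimately show "X \<in> euc_algebra" unfolding euc_algebra_def by blast
qed

lemma isotropy_algebra_iff:
  fixes X :: "'m::finite euc_mat"
  shows "X \<in> isotropy_algebra \<longleftrightarrow> transpose X = - X \<and> (\<forall>a\<in>{None, Some None}. \<forall>b. X $ a $ b = 0)"
    (is "_ \<longleftrightarrow> ?R")
proof
  assume "X \<in> isotropy_algebra"
  then obtain B :: "real^'m^'m" where X: "X = bordered 0 0 0 (bordered 0 0 0 B)" and "transpose B = - B"
    unfolding isotropy_algebra_def by blast
  then have B: "\<forall>a b. B $ a $ b = - B $ b $ a" unfolding skew_nth by - assumption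
  have inner: "X $ Some (Some a) $ Some (Some b) = - X $ Some (Some b) $ Some (Some a)" for a b
    using B[rule_format, of a b] by (simp add: X)
  have zero: "X $ a $ b = 0" "X $ b $ a = 0" if "a \<in> {None, Some None}" for a b
    using that by (cases b; cases "the b"; auto simp: X)+
  have "X $ a $ b = - X $ b $ a" for a b
  proof (cases "a \<in> {None, Some None} \<or> b \<in> {None, Some None}")
    case True
    then have "X $ a $ b = 0 \<and> X $ b $ a = 0" using zero by blast
    then show ?thesis by simp
  next
    case False
    then obtain i j where "a = Some (Some i)" "b = Some (Some j)"
      by (metis insertCI option.exhaust)
    then show ?thesis by (simp only: inner[of i j])
  qed
  then show ?R unfolding skew_nth by (intro conjI ballI allI zero(1))
next
  assume R: ?R
  have skew: "X $ a $ b = - X $ b $ a" for a b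
    using R unfolding skew_nth by (elim conjE allE)
  have zero: "X $ a $ b = 0" if "a \<in> {None, Some None}" for a b using R that by blast
  then have zero': "X $ b $ a = 0" if "a \<in> {None, Some None}" for a b
    using that skew[of b a] by simp
  define B :: "real^'m^'m" where "B = (\<chi> i j. X $ Some (Some i) $ Some (Some j))"
  have "X = bordered 0 0 0 (bordered 0 0 0 B)"
    by (simp add: vec_eq_iff split_option_all B_def zero zero')
  moreover have "transpose B = - B"
    unfolding skew_nth B_def vec_lambda_beta by (intro allI skew)
  ultimately show "X \<in> isotropy_algebra" unfolding isotropy_algebra_def by blast
qed

lemma isotropy_algebra_entries:
  fixes X :: "'m::finite euc_mat"
  assumes "X \<in> isotropy_algebra"
  shows "transpose X = - X" "X $ a $ b = - X $ b $ a"
    and "c \<in> {None, Some None} \<Longrightarrow> X $ c $ b = 0" "c \<in> {None, Some None} \<Longrightarrow> X $ b $ c = 0"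
proof -
  have X: "transpose X = - X" and row: "\<forall>a\<in>{None, Some None}. \<forall>b. X $ a $ b = 0"
    using assms unfolding isotropy_algebra_iff by (rule conjunct1, rule conjunct2)
  show "transpose X = - X" by (rule X)
  have skew: "X $ a $ b = - X $ b $ a" for a b by (rule X[unfolded skew_nth, rule_format])
  show "X $ a $ b = - X $ b $ a" by (rule skew)
  assume c: "c \<in> {None, Some None}"
  show 0: "X $ c $ b = 0" by (rule row[rule_format, OF c])
  show "X $ b $ c = 0" using skew[of b c] 0 by simp
qed

lemma mat_exp_isotropy:
  assumes "X \<in> isotropy_algebra"
  shows "mat_exp (t *\<^sub>R X) \<in> isotropy_group"
proof -
  note X = isotropy_algebra_entries[OF assms]
  show ?thesis
    unfolding isotropy_group_iff
  proof (intro conjI ballI allI)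
    show "orthogonal_matrix (mat_exp (t *\<^sub>R X))" by (rule mat_exp_skew_orthogonal[OF X(1)])
    fix a b :: "'a option option" assume a: "a \<in> {None, Some None}"
    show "mat_exp (t *\<^sub>R X) $ a $ b = (if a = b then 1 else 0)"
      by (rule mat_exp_zero_row[OF X(3)[OF a]])
    show "mat_exp (t *\<^sub>R X) $ b $ a = (if a = b then 1 else 0)"
      using mat_exp_zero_column[OF X(4)[OF a], of t b] by auto
  qed
qed

lemma isotropy_group_orthogonal: "h \<in> isotropy_group \<Longrightarrow> orthogonal_matrix h"
  by (simp add: isotropy_group_iff)

lemma isotropy_group_transpose: "h \<in> isotropy_group \<Longrightarrow> transpose h \<in> isotropy_group"
  by (auto simp: isotropy_group_iff transpose_nth)

lemma isotropy_group_mult: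
  assumes h: "h \<in> isotropy_group" and h': "h' \<in> isotropy_group"
  shows "h ** h' \<in> isotropy_group"
proof -
  note * = assms[unfolded isotropy_group_iff]
  have row: "(h ** h') $ a $ b = (if a = b then 1 else 0)" if "a \<in> {None, Some None}" for a b
  proof -
    have "h $ a $ c * h' $ c $ b = (if a = c then h' $ a $ b else 0)" for c
      using *(1) that by auto
    then have "(h ** h') $ a $ b = h' $ a $ b" by (simp add: matrix_mult_nth)
    then show ?thesis using *(2) that by auto
  qed
  have col: "(h ** h') $ b $ a = (if a = b then 1 else 0)" if "a \<in> {None, Some None}" for a b
  proof -
    have "h $ b $ c * h' $ c $ a = (if a = c then h $ b $ a else 0)" for c
      using *(2) that by auto
    then have "(h ** h') $ b $ a = h $ b $ a" by (simp add: matrix_mult_nth)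
    then show ?thesis using *(1) that by auto
  qed
  show ?thesis
    unfolding isotropy_group_iff
  proof (intro conjI ballI allI row col)
    show "orthogonal_matrix (h ** h')" using * by (intro orthogonal_matrix_mul) auto
  qed
qed

lemma mat_1_isotropy: "mat 1 \<in> isotropy_group"
  by (auto simp: isotropy_group_iff orthogonal_matrix_id mat_nth)

text \<open>The \<open>\<mm>\<close>-component as a linear map on all matrices. On \<open>\<gg>\<close> it gives the coordinates of the
  projection along \<open>\<hh>\<close>.\<close>

definition m_part :: "'m::finite euc_mat \<Rightarrow> real \<times> (real^'m) \<times> (real^'m)"
  where "m_part X = (X $ Some None $ None, (\<chi> i. X $ Some (Some i) $ None),
    (\<chi> i. X $ Some (Some i) $ Some None))"

lemma linear_m_part: "linear m_part"
  by (rule linearI) (simp_all add: m_part_def vec_eq_iff)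

lemma m_part_mvec [simp]: "m_part (mvec z) = z"
  by (cases z) (simp add: mvec_def m_part_def vec_eq_iff)

lemma mvec_in_euc_algebra: "mvec z \<in> euc_algebra"
  by (cases z) (simp add: mvec_def euc_algebra_iff split_option_all)

lemma euc_algebra_entries:
  fixes X :: "'m::finite euc_mat"
  assumes "X \<in> euc_algebra"
  shows "X $ None $ b = 0" "X $ Some None $ Some None = 0"
    "X $ Some None $ Some (Some j) = - X $ Some (Some j) $ Some None"
    "X $ Some (Some i) $ Some (Some j) = - X $ Some (Some j) $ Some (Some i)"
proof -
  note X = assms[unfolded euc_algebra_iff]
  show "X $ None $ b = 0" using X by (elim conjE allE)
  have skew: "X $ Some a $ Some b = - X $ Some b $ Some a" for a b
    using X by (elim conjE allE)
  show "X $ Some None $ Some None = 0" using skew[of None None] by simp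
  show "X $ Some None $ Some (Some j) = - X $ Some (Some j) $ Some None" by (rule skew)
  show "X $ Some (Some i) $ Some (Some j) = - X $ Some (Some j) $ Some (Some i)" by (rule skew)
qed

lemma pr_m_m_part:
  assumes "X \<in> euc_algebra"
  shows "pr_m X = mvec (m_part X)"
proof -
  define B where "B = (\<chi> i j. X $ Some (Some i) $ Some (Some j))"
  note X = euc_algebra_entries[OF assms]
  have "X = bordered 0 0 (vcons (X $ Some None $ None) (\<chi> i. X $ Some (Some i) $ None))
    (bordered 0 (- (\<chi> i. X $ Some (Some i) $ Some None)) (\<chi> i. X $ Some (Some i) $ Some None) B)"
    by (simp add: vec_eq_iff split_option_all B_def X(1-3))
  moreover have "transpose B = - B"
    unfolding skew_nth B_def vec_lambda_beta by (intro allI X(4))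
  ultimately show ?thesis using pr_m_eq[of B] unfolding m_part_def by metis
qed

lemma m_part_eq_0_iff:
  assumes "X \<in> euc_algebra"
  shows "m_part X = 0 \<longleftrightarrow> X \<in> isotropy_algebra"
proof
  note X = euc_algebra_entries[OF assms]
  assume "m_part X = 0"
  then have 0: "X $ Some None $ None = 0" "X $ Some (Some i) $ None = 0"
    "X $ Some (Some i) $ Some None = 0" for i
    by (simp_all add: m_part_def zero_prod_def vec_eq_iff)
  have col: "X $ a $ None = 0" for a
    by (cases a; cases "the a") (simp_all add: 0 X(1))
  have skew: "X $ Some a $ Some b = - X $ Some b $ Some a" for a b
    using assms unfolding euc_algebra_iff by (elim conjE allE)
  have "X $ a $ b = - X $ b $ a" for a b
  proof (cases "a = None \<or> b = None")
    case False
    then obtain i j where "a = Some i" "b = Some j" by auto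
    then show ?thesis by (simp only: skew[of i j])
  qed (auto simp: col X(1))
  moreover have row: "X $ Some None $ b = 0" for b
    by (cases b; cases "the b") (simp_all add: 0 X(2,3))
  ultimately show "X \<in> isotropy_algebra"
    unfolding isotropy_algebra_iff skew_nth
  proof (intro conjI ballI allI)
    fix a b :: "'a option option" assume "a \<in> {None, Some None}"
    then show "X $ a $ b = 0" by (auto simp: row X(1))
  qed
next
  note X = euc_algebra_entries[OF assms]
  assume "X \<in> isotropy_algebra"
  then show "m_part X = 0"
    by (simp add: m_part_def zero_prod_def vec_eq_iff isotropy_algebra_entries(3,4))
qed

text \<open>The tangent vectors of \<open>O(n-1)\<close> at \<open>h\<close> are left translates \<open>h X\<close> of elements of \<open>\<hh>\<close>, here for a map
  into the group whose derivative is taken in the space of all matrices: the border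
  entries are constant, and differentiating \<open>F\<^sup>T F = 1\<close> gives skewness.\<close>

lemma isotropy_group_tangent:
  fixes F :: "'a::real_normed_vector \<Rightarrow> 'm::finite euc_mat"
  assumes S: "open S" "x \<in> S" and F: "F ` S \<subseteq> isotropy_group"
    and D: "(F has_derivative D) (at x)"
  shows "transpose (F x) ** D v \<in> isotropy_algebra"
proof -
  have Dij: "((\<lambda>y. F y $ a $ b) has_derivative (\<lambda>v. D v $ a $ b)) (at x)" for a b
    using bounded_linear.has_derivative[OF bounded_linear_vec_nth
        bounded_linear.has_derivative[OF bounded_linear_vec_nth D]] .
  have const: "D' v = 0" if "(f has_derivative D') (at x)" "\<And>y. y \<in> S \<Longrightarrow> f y = c"
    for f :: "'a \<Rightarrow> real" and D' c
  proof -
    have "((\<lambda>y. c) has_derivative D') (at x)"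
      using has_derivative_transform_within_open[OF that(1) S that(2)] .
    then show ?thesis using has_derivative_unique[OF _ has_derivative_const[of c]] by metis
  qed
  have Fy: "F y \<in> isotropy_group" if "y \<in> S" for y using F that by blast
  have border: "D v $ a $ b = 0" if "a \<in> {None, Some None}" for a b
    by (rule const[OF Dij, of _ _ "if a = b then 1 else 0"])
      (use Fy that in \<open>auto simp: isotropy_group_iff\<close>)
  have skew: "(\<Sum>c\<in>UNIV. F x $ c $ a * D v $ c $ b + D v $ c $ a * F x $ c $ b) = 0" for a b
  proof (rule const)
    show "((\<lambda>y. \<Sum>c\<in>UNIV. F y $ c $ a * F y $ c $ b) has_derivative
        (\<lambda>v. \<Sum>c\<in>UNIV. F x $ c $ a * D v $ c $ b + D v $ c $ a * F x $ c $ b)) (at x)"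
      by (intro has_derivative_sum has_derivative_mult Dij)
    show "(\<Sum>c\<in>UNIV. F y $ c $ a * F y $ c $ b) = mat 1 $ a $ b" if "y \<in> S" for y
    proof -
      have "(transpose (F y) ** F y) $ a $ b = mat 1 $ a $ b"
        using isotropy_group_orthogonal[OF Fy[OF that]] by (simp add: orthogonal_matrix)
      then show ?thesis by (simp add: matrix_mult_nth transpose_nth)
    qed
  qed
  show ?thesis
    unfolding isotropy_algebra_iff skew_nth
  proof (intro conjI ballI allI)
    show "(transpose (F x) ** D v) $ a $ b = - (transpose (F x) ** D v) $ b $ a" for a b
      using skew[of a b] by (simp add: matrix_mult_nth transpose_nth sum.distrib mult.commute)
    fix a b :: "'m option option" assume a: "a \<in> {None, Some None}"
    have "transpose (F x) $ a $ c * D v $ c $ b = (if a = c then D v $ a $ b else 0)" for c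
      using Fy[OF S(2)] a by (auto simp: isotropy_group_iff transpose_nth)
    then have "(transpose (F x) ** D v) $ a $ b = D v $ a $ b" by (simp add: matrix_mult_nth)
    then show "(transpose (F x) ** D v) $ a $ b = 0" using border[OF a] by simp
  qed
qed

text \<open>The isotropy representation of \<open>O(n-1)\<close> on \<open>\<mm>\<close>.\<close>

definition m_rotate :: "real^'m::finite^'m \<Rightarrow> real \<times> (real^'m) \<times> (real^'m) \<Rightarrow> real \<times> (real^'m) \<times> (real^'m)"
  where "m_rotate k z = (fst z, k *v fst (snd z), k *v snd (snd z))"

lemma m_part_Ad:
  assumes "h \<in> isotropy_group"
  obtains k where "orthogonal_matrix k"
    "\<forall>X\<in>euc_algebra. m_part (Ad (matrix_inv h) X) = m_rotate k (m_part X)"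
proof -
  obtain k :: "real^'a^'a" where k: "orthogonal_matrix k" and h: "h = bordered 1 0 0 (bordered 1 0 0 k)"
    using assms unfolding isotropy_group_def by blast
  have inv: "matrix_inv h = transpose h" "matrix_inv (transpose h) = h"
    using isotropy_group_orthogonal[OF assms] by (simp_all add: matrix_inv_orthogonal)
  show ?thesis
  proof (rule that[of "transpose k"]; (intro ballI)?)
    show "orthogonal_matrix (transpose k)" using k by simp
    fix X :: "'a euc_mat" assume "X \<in> euc_algebra"
    note X = euc_algebra_entries(1,2)[OF this]
    show "m_part (Ad (matrix_inv h) X) = m_rotate (transpose k) (m_part X)"
      unfolding Ad_def inv
      by (simp add: m_part_def m_rotate_def h matrix_mult_nth transpose_nth sum_option X vec_eq_iff
          matrix_vector_mult_def)
  qed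
qed

section \<open>Velocities of curves\<close>

lemma linear_onD:
  assumes "linear_on V f"
  shows "x \<in> V \<Longrightarrow> y \<in> V \<Longrightarrow> f (x + y) = f x + f y" "x \<in> V \<Longrightarrow> f (r *\<^sub>R x) = r *\<^sub>R f x"
  using assms by (simp_all add: linear_on_def)

lemma linear_on_diff:
  assumes "linear_on V f" "subspace V" "x \<in> V" "y \<in> V"
  shows "f (x - y) = f x - f y"
proof -
  have y: "(-1) *\<^sub>R y \<in> V" using assms(2,4) by (rule subspace_scale)
  have "f (x - y) = f (x + (-1) *\<^sub>R y)" by simp
  also have "\<dots> = f x + (-1) *\<^sub>R f y"
    by (simp only: linear_onD(1)[OF assms(1,3) y] linear_onD(2)[OF assms(1,4)])
  finally show ?thesis by simp
qed

lemma velocity_chain: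
  assumes A: "smooth_atlas A" and B: "smooth_atlas B" and f: "smooth_map_on A B S f"
    and \<gamma>: "continuous_on UNIV \<gamma>" and S: "\<gamma> t \<in> S"
    and k: "k \<in> charts_at A (\<gamma> t)" and l: "l \<in> charts_at B (f (\<gamma> t))"
    and w: "((cmap k \<circ> \<gamma>) has_vector_derivative w) (at t)"
  shows "((cmap l \<circ> (\<lambda>t. f (\<gamma> t))) has_vector_derivative
    frechet_derivative (cmap l \<circ> f \<circ> cinv k) (at (cmap k (\<gamma> t))) w) (at t)"
proof -
  let ?D = "frechet_derivative (cmap l \<circ> f \<circ> cinv k) (at (cmap k (\<gamma> t)))"
  note D = smooth_map_has_derivative[OF A B f S k l]
  have "((cmap k \<circ> \<gamma>) has_derivative (\<lambda>h. h *\<^sub>R w)) (at t)"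
    using w by (simp add: has_vector_derivative_def)
  from diff_chain_at[OF this, of "cmap l \<circ> f \<circ> cinv k" ?D]
  have "((cmap l \<circ> f \<circ> cinv k) \<circ> (cmap k \<circ> \<gamma>) has_derivative ?D \<circ> (\<lambda>h. h *\<^sub>R w)) (at t)"
    using D by simp
  then have "((cmap l \<circ> f \<circ> cinv k) \<circ> (cmap k \<circ> \<gamma>) has_vector_derivative ?D w) (at t)"
    unfolding has_vector_derivative_def comp_def[of ?D] linear_cmul[OF has_derivative_linear[OF D]] .
  moreover have "open (\<gamma> -` cdom k)"
    using k by (intro open_vimage \<gamma> open_cdom[OF A]) (simp add: in_charts_at)
  ultimately show ?thesis
    by (rule has_vector_derivative_transform_within_open)
      (use k in \<open>auto simp: in_charts_at cinv_cmap[OF A]\<close>)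
qed

lemma velocity_chart:
  assumes "k \<in> charts_at A (\<gamma> t)" "((cmap k \<circ> \<gamma>) has_vector_derivative w) (at t)"
  shows "velocity A \<gamma> t k = w"
  using assms by (simp add: velocity_def vector_derivative_at)

lemma velocity_tangent:
  assumes A: "smooth_atlas A" and \<gamma>: "continuous_on UNIV \<gamma>"
    and k: "k \<in> charts_at A (\<gamma> t)" and w: "((cmap k \<circ> \<gamma>) has_vector_derivative w) (at t)"
  shows "velocity A \<gamma> t \<in> tangent A (\<gamma> t)"
proof (rule tangentI[OF A k])
  show "velocity A \<gamma> t l = 0" if "l \<notin> charts_at A (\<gamma> t)" for l
    using that by (simp add: velocity_def)
  fix l assume l: "l \<in> charts_at A (\<gamma> t)"
  have "((cmap l \<circ> \<gamma>) has_vector_derivative transition_deriv k l (\<gamma> t) w) (at t)"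
    using velocity_chain[OF A A smooth_map_on_ident[OF A open_UNIV] \<gamma> UNIV_I k l w] by (simp add: o_def)
  then show "velocity A \<gamma> t l = transition_deriv k l (\<gamma> t) (velocity A \<gamma> t k)"
    using velocity_chart[of k A \<gamma> t w, OF k w] velocity_chart[of l A \<gamma> t, OF l] by simp
qed

lemma tangent_map_velocity_const:
  assumes A: "smooth_atlas A" and B: "smooth_atlas B" and f: "smooth_map_on A B UNIV f"
    and \<gamma>: "continuous_on UNIV \<gamma>" and const: "\<And>s. f (\<gamma> s) = y"
    and k: "k \<in> charts_at A (\<gamma> t)" and w: "((cmap k \<circ> \<gamma>) has_vector_derivative w) (at t)"
  shows "tangent_map A B f (\<gamma> t) (velocity A \<gamma> t) = 0"
proof -
  obtain l where l: "l \<in> charts_at B (f (\<gamma> t))" using charts_at_nonempty[OF B] .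
  note v = velocity_tangent[OF A \<gamma> k w]
  have "tangent_map A B f (\<gamma> t) (velocity A \<gamma> t) l = 0"
    using tangent_map_chart[OF A B f open_UNIV UNIV_I v k l] velocity_chart[of k A \<gamma> t w, OF k w]
      vector_derivative_unique_at[OF velocity_chain[OF A B f \<gamma> UNIV_I k l w]]
    by (simp add: const o_def has_vector_derivative_const)
  then show ?thesis
    using tangent_eqI[OF tangent_map_tangent[OF A B f open_UNIV UNIV_I v] subspace_0[OF subspace_tangent[OF B]] l]
    by simp
qed

section \<open>The coframe induced by a point of the total space\<close>

text \<open>Any preimage \<open>\<xi>\<close> of \<open>v\<close> may be chosen: \<open>coframe_tangent_map\<close> shows that the value does not
  depend on it.\<close>

definition coframe ::
    "('p, 'e::euclidean_space) chart set \<Rightarrow> ('x, 'f::euclidean_space) chart set \<Rightarrow> ('p \<Rightarrow> 'x) \<Rightarrow>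
     ('p \<Rightarrow> ('p, 'e) tvec \<Rightarrow> 'm::finite euc_mat) \<Rightarrow> 'p \<Rightarrow> ('x, 'f) tvec \<Rightarrow> real \<times> (real^'m) \<times> (real^'m)"
  where "coframe AP AN p \<omega> u v =
    m_part (\<omega> u (SOME \<xi>. \<xi> \<in> tangent AP u \<and> tangent_map AP AN p u \<xi> = v))"

context
  fixes AP :: "('p::{t2_space, second_countable_topology}, 'e::euclidean_space) chart set"
    and AN :: "('x::{t2_space, second_countable_topology}, 'f::euclidean_space) chart set"
    and p :: "'p \<Rightarrow> 'x"
    and act :: "'p \<Rightarrow> 'm::finite euc_mat \<Rightarrow> 'p"
    and \<omega> :: "'p \<Rightarrow> ('p, 'e) tvec \<Rightarrow> 'm euc_mat"
  assumes cartan: "cartan_geometry AP AN euc_algebra isotropy_group isotropy_algebra p act \<omega>"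
begin

lemma
  shows atlas_P: "smooth_atlas AP" and atlas_N: "smooth_atlas AN"
  and principal: "principal_bundle AP AN isotropy_group p act"
  and connection: "cartan_connection AP euc_algebra isotropy_group isotropy_algebra act \<omega>"
  using cartan by (simp_all add: cartan_geometry_def)

lemma
  shows smooth_p: "smooth_map_on AP AN UNIV p"
  and smooth_act: "smooth_prod_map_on AP AP UNIV isotropy_group act"
  and act_1: "act u (mat 1) = u"
  and p_act: "h \<in> isotropy_group \<Longrightarrow> p (act u h) = p u"
  using principal by (simp_all add: principal_bundle_def)

lemma continuous_p: "continuous_on UNIV p"
  using smooth_p by (rule smooth_map_on_continuous)

lemma local_trivialization:
  obtains V \<tau> \<sigma> where "open V" "x \<in> V" "smooth_fun_on AP (p -` V) \<tau>" "\<tau> ` (p -` V) \<subseteq> isotropy_group"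
    "smooth_prod_map_on AN AP V isotropy_group \<sigma>" "\<forall>u. p u \<in> V \<longrightarrow> \<sigma> (p u) (\<tau> u) = u"
    "\<forall>y h. y \<in> V \<longrightarrow> h \<in> isotropy_group \<longrightarrow> p (\<sigma> y h) = y"
    "\<forall>u h. p u \<in> V \<longrightarrow> h \<in> isotropy_group \<longrightarrow> \<tau> (act u h) = \<tau> u ** h"
proof -
  have "\<exists>V \<tau> \<sigma>. open V \<and> x \<in> V \<and>
       smooth_fun_on AP (p -` V) \<tau> \<and> \<tau> ` (p -` V) \<subseteq> isotropy_group \<and>
       smooth_prod_map_on AN AP V isotropy_group \<sigma> \<and>
       (\<forall>u\<in>p -` V. \<sigma> (p u) (\<tau> u) = u) \<and>
       (\<forall>y\<in>V. \<forall>h\<in>isotropy_group. p (\<sigma> y h) = y \<and> \<tau> (\<sigma> y h) = h) \<and>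
       (\<forall>u\<in>p -` V. \<forall>h\<in>isotropy_group. \<tau> (act u h) = \<tau> u ** h)"
    using principal unfolding principal_bundle_def by blast
  then obtain V \<tau> \<sigma> where *: "open V" "x \<in> V" "smooth_fun_on AP (p -` V) \<tau>"
    "\<tau> ` (p -` V) \<subseteq> isotropy_group" "smooth_prod_map_on AN AP V isotropy_group \<sigma>"
    "\<forall>u\<in>p -` V. \<sigma> (p u) (\<tau> u) = u"
    "\<forall>y\<in>V. \<forall>h\<in>isotropy_group. p (\<sigma> y h) = y \<and> \<tau> (\<sigma> y h) = h"
    "\<forall>u\<in>p -` V. \<forall>h\<in>isotropy_group. \<tau> (act u h) = \<tau> u ** h"
    by (elim exE conjE)
  show ?thesis
  proof (rule that[OF *(1-5)])
    show "\<forall>u. p u \<in> V \<longrightarrow> \<sigma> (p u) (\<tau> u) = u" using *(6) by simp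
    show "\<forall>y h. y \<in> V \<longrightarrow> h \<in> isotropy_group \<longrightarrow> p (\<sigma> y h) = y" using *(7) by blast
    show "\<forall>u h. p u \<in> V \<longrightarrow> h \<in> isotropy_group \<longrightarrow> \<tau> (act u h) = \<tau> u ** h" using *(8) by simp
  qed
qed

lemma
  shows linear_iso_\<omega>: "linear_iso_on (tangent AP u) euc_algebra (\<omega> u)"
  and one_form_\<omega>: "one_form AP \<omega>"
  and \<omega>_equivariant: "h \<in> isotropy_group \<Longrightarrow> \<xi> \<in> tangent AP u \<Longrightarrow>
    \<omega> (act u h) (tangent_map AP AP (\<lambda>u'. act u' h) u \<xi>) = Ad (matrix_inv h) (\<omega> u \<xi>)"
  and \<omega>_fundamental: "X \<in> isotropy_algebra \<Longrightarrow> \<omega> u (fundamental_field AP act X u) = X"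
  using connection by (simp_all add: cartan_connection_def)

lemma
  shows \<omega>_bij: "bij_betw (\<omega> u) (tangent AP u) euc_algebra" and \<omega>_linear: "linear_on (tangent AP u) (\<omega> u)"
  using linear_iso_\<omega> by (simp_all add: linear_iso_on_def)

lemma \<omega>_euc_algebra: "\<xi> \<in> tangent AP u \<Longrightarrow> \<omega> u \<xi> \<in> euc_algebra"
  using \<omega>_bij by (rule bij_betwE[THEN bspec])

text \<open>In a trivialization, \<open>u'\<close> is obtained from \<open>u\<close> by the group element \<open>(\<tau> u)\<^sup>-\<^sup>1 (\<tau> u')\<close>.\<close>

lemma fibre_transitive:
  assumes "p u = p u'"
  obtains h where "h \<in> isotropy_group" "u' = act u h"
proof -
  obtain V \<tau> \<sigma> where V: "open V" "p u \<in> V" and s\<tau>: "smooth_fun_on AP (p -` V) \<tau>"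
    and \<tau>: "\<tau> ` (p -` V) \<subseteq> isotropy_group"
    and \<sigma>: "smooth_prod_map_on AN AP V isotropy_group \<sigma>"
    and \<sigma>\<tau>: "\<forall>u. p u \<in> V \<longrightarrow> \<sigma> (p u) (\<tau> u) = u"
    and p\<sigma>: "\<forall>y h. y \<in> V \<longrightarrow> h \<in> isotropy_group \<longrightarrow> p (\<sigma> y h) = y"
    and \<tau>_act: "\<forall>u h. p u \<in> V \<longrightarrow> h \<in> isotropy_group \<longrightarrow> \<tau> (act u h) = \<tau> u ** h"
    by (rule local_trivialization[of "p u"])
  note \<sigma>\<tau> = \<sigma>\<tau>[rule_format] and p\<sigma> = p\<sigma>[rule_format] and \<tau>_act = \<tau>_act[rule_format]
  have u: "\<tau> u \<in> isotropy_group" "\<tau> u' \<in> isotropy_group" using \<tau> V assms by auto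
  define h where "h = transpose (\<tau> u) ** \<tau> u'"
  have h: "h \<in> isotropy_group" unfolding h_def using u by (intro isotropy_group_mult isotropy_group_transpose)
  have "\<tau> u ** h = \<tau> u'"
    using isotropy_group_orthogonal[OF u(1)]
    by (simp add: h_def matrix_mul_assoc orthogonal_matrix_def)
  then have \<tau>_h: "\<tau> (act u h) = \<tau> u'" using \<tau>_act[OF V(2) h] by simp
  have "\<sigma> (p (act u h)) (\<tau> (act u h)) = act u h"
    by (rule \<sigma>\<tau>) (simp only: p_act[OF h] V(2))
  then have "\<sigma> (p u') (\<tau> u') = act u h" unfolding p_act[OF h] \<tau>_h assms .
  moreover have "\<sigma> (p u') (\<tau> u') = u'" by (rule \<sigma>\<tau>) (use V assms in simp)
  ultimately have "u' = act u h" by (metis (no_types))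
  then show ?thesis using that h by blast
qed

lemma local_section:
  obtains V s where "open V" "p u \<in> V" "smooth_map_on AN AP V s" "s (p u) = u" "\<forall>y. y \<in> V \<longrightarrow> p (s y) = y"
proof -
  obtain V \<tau> \<sigma> where V: "open V" "p u \<in> V" and s\<tau>: "smooth_fun_on AP (p -` V) \<tau>"
    and \<tau>: "\<tau> ` (p -` V) \<subseteq> isotropy_group"
    and \<sigma>: "smooth_prod_map_on AN AP V isotropy_group \<sigma>"
    and \<sigma>\<tau>: "\<forall>u. p u \<in> V \<longrightarrow> \<sigma> (p u) (\<tau> u) = u"
    and p\<sigma>: "\<forall>y h. y \<in> V \<longrightarrow> h \<in> isotropy_group \<longrightarrow> p (\<sigma> y h) = y"
    and \<tau>_act: "\<forall>u h. p u \<in> V \<longrightarrow> h \<in> isotropy_group \<longrightarrow> \<tau> (act u h) = \<tau> u ** h"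
    by (rule local_trivialization[of "p u"])
  note \<sigma>\<tau> = \<sigma>\<tau>[rule_format] and p\<sigma> = p\<sigma>[rule_format] and \<tau>_act = \<tau>_act[rule_format]
  have u: "\<tau> u \<in> isotropy_group" using \<tau> V by auto
  show ?thesis
    by (rule that[OF V smooth_prod_map_slice[OF atlas_N atlas_P V(1) \<sigma> u]]) (simp_all add: \<sigma>\<tau> V p\<sigma> u)
qed

lemma surj_p: "\<exists>u. p u = x"
proof -
  obtain V \<tau> \<sigma> where V: "open V" "x \<in> V" and s\<tau>: "smooth_fun_on AP (p -` V) \<tau>"
    and \<tau>: "\<tau> ` (p -` V) \<subseteq> isotropy_group"
    and \<sigma>: "smooth_prod_map_on AN AP V isotropy_group \<sigma>"
    and \<sigma>\<tau>: "\<forall>u. p u \<in> V \<longrightarrow> \<sigma> (p u) (\<tau> u) = u"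
    and p\<sigma>: "\<forall>y h. y \<in> V \<longrightarrow> h \<in> isotropy_group \<longrightarrow> p (\<sigma> y h) = y"
    and \<tau>_act: "\<forall>u h. p u \<in> V \<longrightarrow> h \<in> isotropy_group \<longrightarrow> \<tau> (act u h) = \<tau> u ** h"
    by (rule local_trivialization[of "x"])
  note \<sigma>\<tau> = \<sigma>\<tau>[rule_format] and p\<sigma> = p\<sigma>[rule_format] and \<tau>_act = \<tau>_act[rule_format]
  show ?thesis using p\<sigma>[OF V(2) mat_1_isotropy] by blast
qed

lemma tangent_map_section:
  assumes V: "open V" "y \<in> V" and s: "smooth_map_on AN AP V s" and ps: "\<And>y. y \<in> V \<Longrightarrow> p (s y) = y"
    and v: "v \<in> tangent AN y"
  shows "tangent_map AP AN p (s y) (tangent_map AN AP s y v) = v"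
  using tangent_map_compose[OF atlas_N atlas_P atlas_N s V v smooth_p open_UNIV UNIV_I
      smooth_map_on_ident[OF atlas_N V(1)] ps] tangent_map_ident[OF atlas_N v] by simp

lemma tangent_map_p_surj:
  assumes "v \<in> tangent AN (p u)"
  obtains \<xi> where "\<xi> \<in> tangent AP u" "tangent_map AP AN p u \<xi> = v"
proof -
  obtain V s where V: "open V" "p u \<in> V" and s: "smooth_map_on AN AP V s" "s (p u) = u"
    and ps: "\<forall>y. y \<in> V \<longrightarrow> p (s y) = y"
    by (rule local_section[of u])
  note ps = ps[rule_format]
  show ?thesis
    using that[of "tangent_map AN AP s (p u) v"] tangent_map_section[OF V s(1) ps assms]
      tangent_map_tangent[OF atlas_N atlas_P s(1) V assms]
    unfolding s(2) by blast
qed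

lemma continuous_orbit:
  "X \<in> isotropy_algebra \<Longrightarrow> continuous_on UNIV (\<lambda>t. act u (mat_exp (t *\<^sub>R X)))"
proof -
  assume X: "X \<in> isotropy_algebra"
  have "continuous_on (UNIV \<times> isotropy_group) (\<lambda>(u, h). act u h)"
    using smooth_act by (simp add: smooth_prod_map_on_def)
  then have "continuous_on UNIV (\<lambda>t. (\<lambda>(u, h). act u h) (u, mat_exp (t *\<^sub>R X)))"
    by (rule continuous_on_compose2)
      (auto intro: continuous_on_Pair continuous_on_const continuous_on_mat_exp mat_exp_isotropy[OF X])
  then show ?thesis by simp
qed

text \<open>In a chart around \<open>u\<close>, vertical vectors and velocities of orbits of one-parameter
  subgroups are described by the same linear map \<open>X \<mapsto> G (0, \<theta> X)\<close>, where \<open>\<theta>\<close> is the group component of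
  \<open>u\<close> and \<open>G\<close> the derivative of an extension of the inverse trivialization. So each
  vertical vector is such a velocity.\<close>

lemma trivialization_chart:
  fixes u :: 'p
  assumes l: "l \<in> charts_at AP u" and k: "k \<in> charts_at AN (p u)"
  obtains G :: "'f \<times> 'm euc_mat \<Rightarrow> 'e" and \<theta> where
    "\<forall>X\<in>isotropy_algebra.
      ((cmap l \<circ> (\<lambda>t. act u (mat_exp (t *\<^sub>R X)))) has_vector_derivative G (0, \<theta> ** X)) (at 0)"
    "\<forall>\<xi>\<in>tangent AP u. tangent_map AP AN p u \<xi> k = 0 \<longrightarrow>
      (\<exists>X\<in>isotropy_algebra. \<xi> l = G (0, \<theta> ** X))"
proof -
  obtain V \<tau> \<sigma> where V: "open V" "p u \<in> V" and s\<tau>: "smooth_fun_on AP (p -` V) \<tau>"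
    and \<tau>: "\<tau> ` (p -` V) \<subseteq> isotropy_group"
    and \<sigma>: "smooth_prod_map_on AN AP V isotropy_group \<sigma>"
    and \<sigma>\<tau>: "\<forall>u. p u \<in> V \<longrightarrow> \<sigma> (p u) (\<tau> u) = u"
    and p\<sigma>: "\<forall>y h. y \<in> V \<longrightarrow> h \<in> isotropy_group \<longrightarrow> p (\<sigma> y h) = y"
    and \<tau>_act: "\<forall>u h. p u \<in> V \<longrightarrow> h \<in> isotropy_group \<longrightarrow> \<tau> (act u h) = \<tau> u ** h"
    by (rule local_trivialization[of "p u"])
  note \<sigma>\<tau> = \<sigma>\<tau>[rule_format] and p\<sigma> = p\<sigma>[rule_format] and \<tau>_act = \<tau>_act[rule_format]
  have \<tau>u: "\<tau> u \<in> isotropy_group" using \<tau> V by auto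
  have kl: "k \<in> AN" "p u \<in> cdom k" "l \<in> AP" "u \<in> cdom l" using k l by (auto simp: in_charts_at)
  obtain T g where T: "open T" "(cmap k (p u), \<tau> u) \<in> T" and sg: "smooth_on T g"
    and g: "\<And>y' h'. y' \<in> V \<Longrightarrow> y' \<in> cdom k \<Longrightarrow> h' \<in> isotropy_group \<Longrightarrow> \<sigma> y' h' \<in> cdom l \<Longrightarrow>
      (cmap k y', h') \<in> T \<Longrightarrow> g (cmap k y', h') = cmap l (\<sigma> y' h')"
    by (rule smooth_prod_map_extension[OF atlas_N \<sigma> V(2) \<tau>u k]) (use l \<sigma>\<tau>[OF V(2)] in auto)
  define G where "G = frechet_derivative g (at (cmap k (p u), \<tau> u))"
  have G: "(g has_derivative G) (at (cmap k (p u), \<tau> u))"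
    unfolding G_def by (rule smooth_on_has_derivative[OF sg T(2)])
  have linG: "linear G" by (rule has_derivative_linear[OF G])
  show ?thesis
  proof (rule that[of G "\<tau> u"]; intro ballI impI)
    fix X :: "'m euc_mat" assume X: "X \<in> isotropy_algebra"
    let ?\<gamma> = "\<lambda>t. act u (mat_exp (t *\<^sub>R X))"
    let ?c = "\<lambda>t. (cmap k (p u), \<tau> u ** mat_exp (t *\<^sub>R X))"
    have lin: "bounded_linear (\<lambda>B. \<tau> u ** B)"
      by (simp add: linear_conv_bounded_linear[symmetric])
        (rule linearI; simp add: matrix_add_ldistrib vec_eq_iff matrix_mult_nth sum_distrib_left mult_ac)
    have "((\<lambda>t. \<tau> u ** mat_exp (t *\<^sub>R X)) has_vector_derivative \<tau> u ** X) (at 0)"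
      by (rule bounded_linear.has_vector_derivative[OF lin has_vector_derivative_mat_exp_0])
    then have c: "(?c has_vector_derivative (0, \<tau> u ** X)) (at 0)"
      by (intro has_vector_derivative_Pair has_vector_derivative_const)
    have c0: "?c 0 = (cmap k (p u), \<tau> u)" using mat_exp_0[of X] by simp
    have "G (0, r *\<^sub>R (\<tau> u ** X)) = r *\<^sub>R G (0, \<tau> u ** X)" for r
      using linear_cmul[OF linG, of r "(0, \<tau> u ** X)"] by simp
    then have "((g \<circ> ?c) has_vector_derivative G (0, \<tau> u ** X)) (at 0)"
      using diff_chain_at[OF c[unfolded has_vector_derivative_def], of g G] G
      unfolding has_vector_derivative_def c0 by (simp add: o_def)
    moreover have "open (?\<gamma> -` cdom l \<inter> ?c -` T)"
    proof (intro open_Int open_vimage T(1) continuous_orbit X)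
      show "open (cdom l)" using kl by (intro open_cdom[OF atlas_P])
      show "continuous_on UNIV ?c"
        by (intro continuous_on_Pair continuous_on_const bounded_linear.continuous_on[OF lin]
            continuous_on_mat_exp)
    qed
    moreover have "0 \<in> ?\<gamma> -` cdom l \<inter> ?c -` T" using c0 T(2) kl mat_exp_0[of X] by (simp add: act_1)
    moreover have "(g \<circ> ?c) t = (cmap l \<circ> ?\<gamma>) t" if "t \<in> ?\<gamma> -` cdom l \<inter> ?c -` T" for t
    proof -
      let ?h = "mat_exp (t *\<^sub>R X)"
      have h: "?h \<in> isotropy_group" by (rule mat_exp_isotropy[OF X])
      \<comment> \<open>The orbit of \<open>u\<close> is a left translate of the one-parameter subgroup in the trivialization.\<close>
      have eq: "\<sigma> (p u) (\<tau> u ** ?h) = act u ?h"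
        using \<sigma>\<tau>[of "act u ?h"] p_act[OF h, of u] \<tau>_act[OF V(2) h] V(2) by simp
      show ?thesis
        using g[OF V(2) kl(2) isotropy_group_mult[OF \<tau>u h]] that by (simp add: eq)
    qed
    ultimately show "((cmap l \<circ> ?\<gamma>) has_vector_derivative G (0, \<tau> u ** X)) (at 0)"
      by (rule has_vector_derivative_transform_within_open)
  next
    fix \<xi> assume \<xi>: "\<xi> \<in> tangent AP u" and vert: "tangent_map AP AN p u \<xi> k = 0"
    let ?q = "cmap k \<circ> p \<circ> cinv l" and ?\<theta> = "\<tau> \<circ> cinv l"
    let ?W = "{u' \<in> cdom l \<inter> p -` V. p u' \<in> cdom k}"
    have pV: "open (p -` V)" by (rule open_vimage[OF V(1) continuous_p])
    have W: "open (cmap l ` ?W)"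
      using kl by (intro open_chart_domain[OF atlas_P atlas_N _ _ pV] continuous_on_subset[OF continuous_p]) auto
    have sq: "smooth_on (cmap l ` ?W) ?q"
    proof (rule smooth_on_mono)
      show "smooth_on (cmap l ` {u' \<in> cdom l \<inter> UNIV. p u' \<in> cdom k}) ?q"
        using smooth_p kl by (simp add: smooth_map_on_def)
    qed auto
    have s\<theta>: "smooth_on (cmap l ` ?W) ?\<theta>"
    proof (rule smooth_on_mono)
      show "smooth_on (cmap l ` (cdom l \<inter> p -` V)) ?\<theta>"
        using s\<tau> kl by (simp add: smooth_fun_on_def)
    qed auto
    have u: "cmap l u \<in> cmap l ` ?W" using kl V by auto
    have inv: "cinv l (cmap l u') = u'" if "u' \<in> cdom l" for u' using cinv_cmap[OF atlas_P kl(3) that] .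
    define Q where "Q = frechet_derivative ?q (at (cmap l u))"
    define Z where "Z = frechet_derivative ?\<theta> (at (cmap l u))"
    have Z: "(?\<theta> has_derivative Z) (at (cmap l u))"
      unfolding Z_def by (rule smooth_on_has_derivative[OF s\<theta> u])
    have QZ: "((\<lambda>b. (?q b, ?\<theta> b)) has_derivative (\<lambda>v. (Q v, Z v))) (at (cmap l u))"
      unfolding Q_def by (intro has_derivative_Pair smooth_on_has_derivative[OF sq u] Z)
    have "(g \<circ> (\<lambda>b. (?q b, ?\<theta> b)) has_derivative G \<circ> (\<lambda>v. (Q v, Z v))) (at (cmap l u))"
      by (rule diff_chain_at[OF QZ]) (use G inv kl in simp)
    moreover have "open (cmap l ` ?W \<inter> (\<lambda>b. (?q b, ?\<theta> b)) -` T)"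
      by (intro continuous_open_preimage W T(1) continuous_on_Pair smooth_on_continuous_on sq s\<theta>)
    moreover have "cmap l u \<in> cmap l ` ?W \<inter> (\<lambda>b. (?q b, ?\<theta> b)) -` T" using u inv kl T(2) by simp
    moreover have "(g \<circ> (\<lambda>b. (?q b, ?\<theta> b))) b = b" if "b \<in> cmap l ` ?W \<inter> (\<lambda>b. (?q b, ?\<theta> b)) -` T" for b
    proof -
      from that obtain u' where u': "b = cmap l u'" "u' \<in> cdom l" "p u' \<in> V" "p u' \<in> cdom k" by auto
      moreover have "\<tau> u' \<in> isotropy_group" using \<tau> u' by auto
      ultimately show ?thesis using g[of "p u'" "\<tau> u'"] that \<sigma>\<tau>[of u'] inv by simp
    qed
    ultimately have "((\<lambda>b. b) has_derivative G \<circ> (\<lambda>v. (Q v, Z v))) (at (cmap l u))"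
      by (rule has_derivative_transform_within_open)
    then have "G \<circ> (\<lambda>v. (Q v, Z v)) = (\<lambda>v. v)"
      by (rule has_derivative_unique[OF _ has_derivative_ident])
    \<comment> \<open>The derivative of \<open>u' = \<sigma> (p u') (\<tau> u')\<close> at \<open>u\<close>.\<close>
    from fun_cong[OF this] have id: "G (Q v, Z v) = v" for v by (simp only: comp_apply)
    have "Q (\<xi> l) = 0"
      using tangent_map_chart[OF atlas_P atlas_N smooth_p open_UNIV UNIV_I \<xi> l k] vert by (simp add: Q_def)
    then have \<xi>l: "\<xi> l = G (0, Z (\<xi> l))" using id[of "\<xi> l"] by simp
    define X where "X = transpose (\<tau> u) ** Z (\<xi> l)"
    have "?\<theta> ` cmap l ` ?W \<subseteq> isotropy_group" using \<tau> inv by auto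
    from isotropy_group_tangent[OF W u this Z]
    have X: "X \<in> isotropy_algebra" using inv kl by (simp add: X_def)
    have "\<tau> u ** X = Z (\<xi> l)"
      using isotropy_group_orthogonal[OF \<tau>u] by (simp add: X_def matrix_mul_assoc orthogonal_matrix_def)
    then have "\<xi> l = G (0, \<tau> u ** X)" by (rule ssubst) (rule \<xi>l)
    then show "\<exists>X\<in>isotropy_algebra. \<xi> l = G (0, \<tau> u ** X)" using X by blast
  qed
qed

lemma fundamental_field_vertical:
  assumes X: "X \<in> isotropy_algebra"
  shows "fundamental_field AP act X u \<in> tangent AP u"
    "tangent_map AP AN p u (fundamental_field AP act X u) = 0"
proof -
  let ?\<gamma> = "\<lambda>t. act u (mat_exp (t *\<^sub>R X))"
  obtain l where l: "l \<in> charts_at AP u" using charts_at_nonempty[OF atlas_P] .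
  obtain k where k: "k \<in> charts_at AN (p u)" using charts_at_nonempty[OF atlas_N] .
  obtain w where w: "((cmap l \<circ> ?\<gamma>) has_vector_derivative w) (at 0)"
    by (rule trivialization_chart[OF l k]) (use X in blast)
  have \<gamma>0: "?\<gamma> 0 = u" using mat_exp_0[of X] by (simp add: act_1)
  then have l': "l \<in> charts_at AP (?\<gamma> 0)" using l by simp
  note c = continuous_orbit[OF X, of u]
  show "fundamental_field AP act X u \<in> tangent AP u"
    using velocity_tangent[OF atlas_P c l' w] unfolding fundamental_field_def \<gamma>0 .
  show "tangent_map AP AN p u (fundamental_field AP act X u) = 0"
    using tangent_map_velocity_const[OF atlas_P atlas_N smooth_p c p_act[OF mat_exp_isotropy[OF X]] l' w]
    unfolding fundamental_field_def \<gamma>0 .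
qed

text \<open>The vector \<open>X\<close> depends a priori on the chart in which it was found, but a tangent vector
  is determined by its coordinates in that single chart.\<close>

lemma vertical_fundamental_field:
  assumes \<xi>: "\<xi> \<in> tangent AP u" "tangent_map AP AN p u \<xi> = 0"
  obtains X where "X \<in> isotropy_algebra" "\<xi> = fundamental_field AP act X u"
proof -
  obtain l where l: "l \<in> charts_at AP u" using charts_at_nonempty[OF atlas_P] .
  obtain k where k: "k \<in> charts_at AN (p u)" using charts_at_nonempty[OF atlas_N] .
  have "tangent_map AP AN p u \<xi> k = 0" using \<xi>(2) by simp
  then obtain X w where X: "X \<in> isotropy_algebra" and "\<xi> l = w"
    and w: "((cmap l \<circ> (\<lambda>t. act u (mat_exp (t *\<^sub>R X)))) has_vector_derivative w) (at 0)"
    using \<xi>(1) by (rule_tac trivialization_chart[OF l k]) blast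
  have l': "l \<in> charts_at AP (act u (mat_exp (0 *\<^sub>R X)))" using l unfolding mat_exp_0 act_1 .
  have "\<xi> = fundamental_field AP act X u"
    using velocity_chart[of l AP "\<lambda>t. act u (mat_exp (t *\<^sub>R X))" 0 w, OF l' w] \<open>\<xi> l = w\<close>
    by (intro tangent_eqI[OF \<xi>(1) fundamental_field_vertical(1)[OF X] l]) (simp add: fundamental_field_def)
  then show ?thesis using that X by blast
qed

text \<open>The kernel of \<open>T\<^sub>u p\<close> is \<open>\<omega>(u)\<^sup>-\<^sup>1(\<hh>)\<close>: vertical vectors are values of fundamental fields, which
  \<open>\<omega>\<close> reproduces; conversely injectivity of \<open>\<omega>(u)\<close> identifies \<open>\<xi>\<close> with such a value.\<close>

lemma tangent_map_p_eq_0_iff: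
  assumes \<xi>: "\<xi> \<in> tangent AP u"
  shows "tangent_map AP AN p u \<xi> = 0 \<longleftrightarrow> m_part (\<omega> u \<xi>) = 0"
  unfolding m_part_eq_0_iff[OF \<omega>_euc_algebra[OF \<xi>]]
proof
  assume "tangent_map AP AN p u \<xi> = 0"
  then show "\<omega> u \<xi> \<in> isotropy_algebra"
    using vertical_fundamental_field[OF \<xi>] \<omega>_fundamental by metis
next
  assume X: "\<omega> u \<xi> \<in> isotropy_algebra"
  have "\<xi> = fundamental_field AP act (\<omega> u \<xi>) u"
    by (rule inj_onD[OF bij_betw_imp_inj_on[OF \<omega>_bij] \<omega>_fundamental[OF X, symmetric] \<xi>
          fundamental_field_vertical(1)[OF X]])
  then show "tangent_map AP AN p u \<xi> = 0" using fundamental_field_vertical(2)[OF X, of u] by simp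
qed

lemma linear_on_tangent_map_p: "linear_on (tangent AP u) (tangent_map AP AN p u)"
  by (rule linear_on_tangent_map[OF atlas_P atlas_N smooth_p open_UNIV UNIV_I])

lemma tangent_map_p_tangent: "\<xi> \<in> tangent AP u \<Longrightarrow> tangent_map AP AN p u \<xi> \<in> tangent AN (p u)"
  by (rule tangent_map_tangent[OF atlas_P atlas_N smooth_p open_UNIV UNIV_I])

lemma coframe_tangent_map:
  assumes \<xi>: "\<xi> \<in> tangent AP u"
  shows "coframe AP AN p \<omega> u (tangent_map AP AN p u \<xi>) = m_part (\<omega> u \<xi>)"
proof -
  define \<eta> where "\<eta> = (SOME \<eta>. \<eta> \<in> tangent AP u \<and> tangent_map AP AN p u \<eta> = tangent_map AP AN p u \<xi>)"
  have \<eta>: "\<eta> \<in> tangent AP u \<and> tangent_map AP AN p u \<eta> = tangent_map AP AN p u \<xi>"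
    unfolding \<eta>_def by (rule someI[of _ \<xi>]) (simp add: \<xi>)
  then have \<eta>\<xi>: "\<eta> - \<xi> \<in> tangent AP u" using \<xi> subspace_tangent[OF atlas_P] by (auto intro: subspace_diff)
  have "tangent_map AP AN p u (\<eta> - \<xi>) = 0"
    using linear_on_diff[OF linear_on_tangent_map_p subspace_tangent[OF atlas_P]] \<eta> \<xi> by simp
  then have "m_part (\<omega> u (\<eta> - \<xi>)) = 0" by (simp add: tangent_map_p_eq_0_iff[OF \<eta>\<xi>])
  then have "m_part (\<omega> u \<eta>) = m_part (\<omega> u \<xi>)"
    using linear_on_diff[OF \<omega>_linear subspace_tangent[OF atlas_P]] \<eta> \<xi>
    by (simp add: linear_diff[OF linear_m_part])
  then show ?thesis unfolding coframe_def \<eta>_def by simp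
qed

lemma coframe_linear_iso: "linear_iso_on (tangent AN (p u)) UNIV (coframe AP AN p \<omega> u)"
  unfolding linear_iso_on_def
proof
  let ?\<theta> = "coframe AP AN p \<omega> u" and ?T = "tangent_map AP AN p u"
  note sub = subspace_tangent[OF atlas_P, of u]
  show lin: "linear_on (tangent AN (p u)) ?\<theta>"
    unfolding linear_on_def
  proof (intro conjI ballI allI)
    fix v assume "v \<in> tangent AN (p u)"
    then obtain \<xi> where \<xi>: "\<xi> \<in> tangent AP u" "?T \<xi> = v" by (rule tangent_map_p_surj)
    show "?\<theta> (r *\<^sub>R v) = r *\<^sub>R ?\<theta> v" for r
      using coframe_tangent_map[OF subspace_scale[OF sub \<xi>(1)], of r] coframe_tangent_map[OF \<xi>(1)] \<xi>
      by (simp add: linear_onD(2)[OF linear_on_tangent_map_p] linear_onD(2)[OF \<omega>_linear]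
          linear_cmul[OF linear_m_part])
    fix w assume "w \<in> tangent AN (p u)"
    then obtain \<eta> where \<eta>: "\<eta> \<in> tangent AP u" "?T \<eta> = w" by (rule tangent_map_p_surj)
    show "?\<theta> (v + w) = ?\<theta> v + ?\<theta> w"
      using coframe_tangent_map[OF subspace_add[OF sub \<xi>(1) \<eta>(1)]] coframe_tangent_map[OF \<xi>(1)]
        coframe_tangent_map[OF \<eta>(1)] \<xi> \<eta>
      by (simp add: linear_onD(1)[OF linear_on_tangent_map_p] linear_onD(1)[OF \<omega>_linear]
          linear_add[OF linear_m_part])
  qed
  show "bij_betw ?\<theta> (tangent AN (p u)) UNIV"
  proof (intro bij_betw_imageI)
    show "inj_on ?\<theta> (tangent AN (p u))"
    proof (rule inj_onI)
      fix v w assume vw: "v \<in> tangent AN (p u)" "w \<in> tangent AN (p u)" "?\<theta> v = ?\<theta> w"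
      then have "v - w \<in> tangent AN (p u)" using subspace_tangent[OF atlas_N] by (auto intro: subspace_diff)
      then obtain \<xi> where \<xi>: "\<xi> \<in> tangent AP u" "?T \<xi> = v - w" by (rule tangent_map_p_surj)
      have "?\<theta> (v - w) = 0" using linear_on_diff[OF lin subspace_tangent[OF atlas_N] vw(1,2)] vw(3) by simp
      then have "m_part (\<omega> u \<xi>) = 0" using coframe_tangent_map[OF \<xi>(1)] \<xi>(2) by simp
      then have "v - w = 0" using tangent_map_p_eq_0_iff[OF \<xi>(1)] \<xi>(2) by simp
      then show "v = w" by simp
    qed
    show "?\<theta> ` tangent AN (p u) = UNIV"
    proof (rule UNIV_eq_I[symmetric])
      fix z :: "real \<times> (real^'m) \<times> (real^'m)"
      obtain \<xi> where \<xi>: "\<xi> \<in> tangent AP u" "\<omega> u \<xi> = mvec z"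
        using \<omega>_bij[of u] mvec_in_euc_algebra[of z] unfolding bij_betw_def by (metis imageE)
      have "?\<theta> (?T \<xi>) = z" using coframe_tangent_map[OF \<xi>(1)] \<xi>(2) by simp
      then show "z \<in> ?\<theta> ` tangent AN (p u)" using tangent_map_p_tangent[OF \<xi>(1)] by blast
    qed
  qed
qed

lemma cartan_phi_coframe:
  assumes "v \<in> tangent AN (p u)"
  shows "cartan_phi AP AN p \<omega> u v = mvec (coframe AP AN p \<omega> u v)"
proof -
  let ?\<theta> = "coframe AP AN p \<omega> u" and ?T = "tangent AN (p u)"
  have lin: "linear (mvec :: _ \<Rightarrow> 'm euc_mat)"
    by (rule linearI) (auto simp: mvec_def vec_eq_iff split_option_all)
  define \<phi> where "\<phi> = restrict (\<lambda>v. mvec (?\<theta> v)) ?T"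
  have \<theta>: "linear_on ?T ?\<theta>" "bij_betw ?\<theta> ?T UNIV"
    using coframe_linear_iso[of u] by (simp_all add: linear_iso_on_def)
  note sub = subspace_tangent[OF atlas_N, of "p u"]
  have "linear_on ?T \<phi>"
    unfolding linear_on_def
    by (simp add: \<phi>_def subspace_add[OF sub] subspace_scale[OF sub] linear_onD[OF \<theta>(1)]
        linear_add[OF lin] linear_cmul[OF lin])
  moreover have "bij_betw \<phi> ?T m_space"
  proof -
    have "bij_betw mvec UNIV (m_space :: 'm euc_mat set)"
      unfolding m_space_def by (rule inj_on_imp_bij_betw[OF inj_mvec])
    from bij_betw_trans[OF \<theta>(2) this] show ?thesis
      by (rule bij_betw_cong[THEN iffD1, rotated]) (simp add: \<phi>_def)
  qed
  moreover have "\<phi> (tangent_map AP AN p u \<xi>) = pr_m (\<omega> u \<xi>)" if \<xi>: "\<xi> \<in> tangent AP u" for \<xi>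
    using tangent_map_p_tangent[OF \<xi>] coframe_tangent_map[OF \<xi>] pr_m_m_part[OF \<omega>_euc_algebra[OF \<xi>]]
    by (simp add: \<phi>_def)
  moreover have "\<psi> = \<phi>" if "\<psi> \<in> extensional ?T"
    "\<forall>\<xi>\<in>tangent AP u. \<psi> (tangent_map AP AN p u \<xi>) = pr_m (\<omega> u \<xi>)" for \<psi>
  proof (rule extensionalityI[OF that(1)])
    show "\<phi> \<in> extensional ?T" by (simp add: \<phi>_def)
    fix v assume "v \<in> ?T"
    then obtain \<xi> where "\<xi> \<in> tangent AP u" "tangent_map AP AN p u \<xi> = v" by (rule tangent_map_p_surj)
    then show "\<psi> v = \<phi> v"
      using that(2) \<open>\<And>\<xi>. \<xi> \<in> tangent AP u \<Longrightarrow> \<phi> (tangent_map AP AN p u \<xi>) = pr_m (\<omega> u \<xi>)\<close> by metis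
  qed
  ultimately have "cartan_phi AP AN p \<omega> u = \<phi>"
    unfolding cartan_phi_def linear_iso_on_def
    by (intro the_equality) (auto simp: \<phi>_def)
  then show ?thesis using assms by (simp add: \<phi>_def)
qed

text \<open>The right translate of \<open>\<xi>\<close> has the same image under \<open>T p\<close>, and equivariance of \<open>\<omega>\<close> turns its value by
  \<open>Ad(h\<^sup>-\<^sup>1)\<close>, which acts on \<open>\<mm>\<close> by a rotation.\<close>

lemma coframe_equivariant:
  assumes h: "h \<in> isotropy_group"
  obtains k where "orthogonal_matrix k"
    "\<forall>v\<in>tangent AN (p u). coframe AP AN p \<omega> (act u h) v = m_rotate k (coframe AP AN p \<omega> u v)"
proof -
  let ?r = "\<lambda>u'. act u' h"
  have r: "smooth_map_on AP AP UNIV ?r" by (rule smooth_prod_map_slice[OF atlas_P atlas_P open_UNIV smooth_act h])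
  obtain k where k: "orthogonal_matrix k"
    "\<forall>X\<in>euc_algebra. m_part (Ad (matrix_inv h) X) = m_rotate k (m_part X)"
    by (rule m_part_Ad[OF h])
  show ?thesis
  proof (rule that[OF k(1)]; intro ballI)
    fix v assume "v \<in> tangent AN (p u)"
    then obtain \<xi> where \<xi>: "\<xi> \<in> tangent AP u" "tangent_map AP AN p u \<xi> = v" by (rule tangent_map_p_surj)
    let ?\<eta> = "tangent_map AP AP ?r u \<xi>"
    have \<eta>: "?\<eta> \<in> tangent AP (act u h)" by (rule tangent_map_tangent[OF atlas_P atlas_P r open_UNIV UNIV_I \<xi>(1)])
    have "tangent_map AP AN p (act u h) ?\<eta> = v"
      using tangent_map_compose[OF atlas_P atlas_P atlas_N r open_UNIV UNIV_I \<xi>(1) smooth_p open_UNIV UNIV_I smooth_p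
          p_act[OF h]] \<xi>(2) by simp
    then have "coframe AP AN p \<omega> (act u h) v = m_part (\<omega> (act u h) ?\<eta>)"
      using coframe_tangent_map[OF \<eta>] by simp
    also have "\<dots> = m_rotate k (coframe AP AN p \<omega> u v)"
      using coframe_tangent_map[OF \<xi>(1)] \<xi>(2)
      by (simp add: \<omega>_equivariant[OF h \<xi>(1)] k(2)[rule_format, OF \<omega>_euc_algebra[OF \<xi>(1)]])
    finally show "coframe AP AN p \<omega> (act u h) v = m_rotate k (coframe AP AN p \<omega> u v)" .
  qed
qed

text \<open>Since \<open>T p \<circ> T s\<close> is the identity, the coframe at \<open>s y\<close> is the \<open>\<mm>\<close>-part of the pullback \<open>s\<^sup>* \<omega>\<close>. In
  charts this is the smooth family \<open>\<omega>\<close> of linear maps evaluated at the derivative of \<open>s\<close>.\<close>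

lemma coframe_section_smooth:
  assumes V: "open V" and s: "smooth_map_on AN AP V s" and ps: "\<And>y. y \<in> V \<Longrightarrow> p (s y) = y" and k: "k \<in> AN"
  shows "smooth_on (cmap k ` (cdom k \<inter> V))
    (\<lambda>a. coframe AP AN p \<omega> (s (cinv k a)) (chart_vec AN k (cinv k a) v))"
proof (rule smooth_on_local)
  fix a assume "a \<in> cmap k ` (cdom k \<inter> V)"
  then obtain y where y: "a = cmap k y" "y \<in> cdom k" "y \<in> V" by auto
  obtain l where "l \<in> charts_at AP (s y)" using charts_at_nonempty[OF atlas_P] .
  then have l: "l \<in> AP" "s y \<in> cdom l" by (auto simp: in_charts_at)
  let ?W = "{y \<in> cdom k \<inter> V. s y \<in> cdom l}"
  let ?S = "cmap k ` ?W" and ?f = "cmap l \<circ> s \<circ> cinv k"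
  have S: "open ?S" by (rule open_chart_domain[OF atlas_N atlas_P k l(1) V smooth_map_on_continuous[OF s]])
  have f: "smooth_on ?S ?f" using s k l(1) by (simp add: smooth_map_on_def)
  let ?w = "\<lambda>b i. m_part (\<omega> (cinv l b) (chart_vec AP l (cinv l b) i))"
  have inv: "cinv k (cmap k y) = y" if "y \<in> cdom k" for y using cinv_cmap[OF atlas_N k that] .
  have "smooth_on (cmap l ` cdom l) (\<lambda>b. ?w b i)" for i
    using one_form_\<omega> l(1) open_cmap_image[OF atlas_P l(1) open_cdom[OF atlas_P l(1)] subset_refl] linear_m_part
    by (intro smooth_on_linear[where L=m_part]) (auto simp: one_form_def linear_conv_bounded_linear)
  then have w: "smooth_on ?S (\<lambda>a. ?w (?f a) i)" for i
    using inv open_cmap_image[OF atlas_P l(1) open_cdom[OF atlas_P l(1)] subset_refl]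
    by (intro smooth_on_compose[OF S _ _ _ f, of "cmap l ` cdom l"]) auto
  have sa: "cinv l (?f a) = s (cinv k a)" "cinv k a \<in> V" "k \<in> charts_at AN (cinv k a)"
    "l \<in> charts_at AP (s (cinv k a))" "cmap k (cinv k a) = a" if "a \<in> ?S" for a
    using that inv k l by (auto simp: cinv_cmap[OF atlas_P l(1)] in_charts_at)
  have "smooth_on ?S (\<lambda>a. ?w (?f a) (frechet_derivative ?f (at a) v))"
  proof (rule smooth_on_family[OF S _ w smooth_on_frechet_derivative[OF f]])
    fix a assume a: "a \<in> ?S"
    have "linear (chart_vec AP l (s (cinv k a)))" by (rule linear_chart_vec[OF atlas_P sa(4)[OF a]])
    then show "linear (?w (?f a))"
      unfolding sa(1)[OF a]
      by (intro linearI)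
        (simp_all add: linear_add linear_cmul linear_onD[OF \<omega>_linear] chart_vec_tangent[OF atlas_P sa(4)[OF a]]
          linear_add[OF linear_m_part] linear_cmul[OF linear_m_part])
  qed
  then have "smooth_on ?S (\<lambda>a. coframe AP AN p \<omega> (s (cinv k a)) (chart_vec AN k (cinv k a) v))"
  proof (rule smooth_on_cong[OF S, rotated])
    fix a assume a: "a \<in> ?S"
    let ?y = "cinv k a" and ?v = "chart_vec AN k (cinv k a) v"
    note V' = V sa(2)[OF a]
    have v: "?v \<in> tangent AN ?y" by (rule chart_vec_tangent[OF atlas_N sa(3)[OF a]])
    note \<xi> = tangent_map_tangent[OF atlas_N atlas_P s V' v]
    have "tangent_map AN AP s ?y ?v l = frechet_derivative ?f (at a) v"
      using tangent_map_chart[OF atlas_N atlas_P s V' v sa(3)[OF a] sa(4)[OF a]]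
      by (simp add: sa(5)[OF a] chart_vec_self[OF atlas_N sa(3)[OF a]])
    then have "chart_vec AP l (s ?y) (frechet_derivative ?f (at a) v) = tangent_map AN AP s ?y ?v"
      using chart_vec_of_tangent[OF atlas_P sa(4)[OF a] \<xi>] by simp
    then show "?w (?f a) (frechet_derivative ?f (at a) v) = coframe AP AN p \<omega> (s ?y) ?v"
      using coframe_tangent_map[OF \<xi>] tangent_map_section[OF V' s ps v] by (simp only: sa(1)[OF a])
  qed
  then show "\<exists>T. open T \<and> a \<in> T \<and> smooth_on T
      (\<lambda>a. coframe AP AN p \<omega> (s (cinv k a)) (chart_vec AN k (cinv k a) v))"
    using S y l by (intro exI[of _ ?S]) auto
qed

end

section \<open>Tensors induced by rotating coframes\<close>

text \<open>The constituents of \<open>\<mm>\<close> in the coordinates \<open>\<real> \<times> \<real>\<^sup>n\<^sup>-\<^sup>1 \<times> \<real>\<^sup>n\<^sup>-\<^sup>1\<close>: the vector \<open>e\<^sub>0\<close>, the inclusions of \<open>E\<close> and \<open>B\<close>,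
  and the map \<open>\<psi>\<close>.\<close>

definition m_e0 :: "real \<times> (real^'m::finite) \<times> (real^'m)" where "m_e0 = (1, 0, 0)"
definition m_E :: "real^'m::finite \<Rightarrow> real \<times> (real^'m) \<times> (real^'m)" where "m_E v = (0, v, 0)"
definition m_B :: "real^'m::finite \<Rightarrow> real \<times> (real^'m) \<times> (real^'m)" where "m_B w = (0, 0, w)"
definition m_J :: "real \<times> (real^'m::finite) \<times> (real^'m) \<Rightarrow> real \<times> (real^'m) \<times> (real^'m)"
  where "m_J z = (0, - snd (snd z), fst (snd z))"

lemma orthogonal_matrix_inner:
  fixes k :: "real^'m::finite^'m"
  assumes "orthogonal_matrix k"
  shows "(k *v a) \<bullet> (k *v b) = a \<bullet> b"
proof -
  have "orthogonal_transformation ((*v) k)"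
    using assms by (simp add: orthogonal_transformation_matrix)
  then show ?thesis by (simp add: orthogonal_transformation_def)
qed

lemma m_rotate_inner: "orthogonal_matrix k \<Longrightarrow> m_rotate k z \<bullet> m_rotate k z' = z \<bullet> z'"
  by (simp add: m_rotate_def inner_prod_def orthogonal_matrix_inner)

lemma m_rotate_model:
  "m_rotate k m_e0 = m_e0" "m_rotate k (m_E v) = m_E (k *v v)" "m_rotate k (m_B v) = m_B (k *v v)"
  "m_rotate k (m_J z) = m_J (m_rotate k z)"
  by (simp_all add: m_rotate_def m_e0_def m_E_def m_B_def m_J_def linear_neg[OF matrix_vector_mul_linear])

lemma m_model_linear: "linear m_E" "linear m_B" "linear m_J"
  by (auto intro!: linearI simp: m_E_def m_B_def m_J_def)

lemma m_model_inj: "inj m_E" "inj m_B"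
  by (auto simp: inj_def m_E_def m_B_def)

lemma m_J_model: "m_J m_e0 = 0" "m_J (m_E v) = m_B v" "m_J (m_B v) = - m_E v"
  by (simp_all add: m_J_def m_e0_def m_E_def m_B_def zero_prod_def)

lemma m_J_square: "m_J (m_J z) = - z + (m_e0 \<bullet> z) *\<^sub>R m_e0"
  by (cases z) (simp add: m_J_def m_e0_def inner_prod_def)

lemma m_J_inner: "m_J z \<bullet> m_J z' = z \<bullet> z' - (m_e0 \<bullet> z) * (m_e0 \<bullet> z')"
  by (simp add: m_J_def m_e0_def inner_prod_def inner_real_def)

lemma m_orthogonal: "m_e0 \<bullet> m_e0 = 1" "m_e0 \<bullet> m_E v = 0" "m_e0 \<bullet> m_B w = 0" "m_E v \<bullet> m_B w = 0"
  by (simp_all add: m_e0_def m_E_def m_B_def inner_prod_def)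

lemma m_decompose: "z = (m_e0 \<bullet> z) *\<^sub>R m_e0 + m_E (fst (snd z)) + m_B (snd (snd z))"
  by (cases z) (simp add: m_e0_def m_E_def m_B_def inner_prod_def)

lemma m_decompose_unique:
  assumes "r *\<^sub>R m_e0 + m_E v + m_B w = r' *\<^sub>R m_e0 + m_E v' + m_B w'"
  shows "r = r'" "v = v'" "w = w'"
  using assms by (simp_all add: m_e0_def m_E_def m_B_def)

lemma mvec_span_axis:
  fixes L :: "real^'m::finite \<Rightarrow> real \<times> (real^'m) \<times> (real^'m)"
  assumes L: "linear L"
  shows "span (range (\<lambda>i. mvec (L (axis i 1)))) = mvec ` range L"
proof -
  have lin: "linear (mvec :: _ \<Rightarrow> 'm euc_mat)"
    by (rule linearI) (auto simp: mvec_def vec_eq_iff split_option_all)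
  have B: "range (\<lambda>i. axis i 1) = (Basis :: (real^'m) set)"
    by (auto simp: Basis_vec_def)
  have "range (\<lambda>i. mvec (L (axis i 1))) = (mvec \<circ> L) ` Basis"
    unfolding B[symmetric] by (simp add: image_image o_def)
  then have "span (range (\<lambda>i. mvec (L (axis i 1)))) = (mvec \<circ> L) ` UNIV"
    by (simp only: linear_span_image[OF linear_compose[OF L lin]] span_Basis)
  then show ?thesis by (simp only: image_comp)
qed

lemma mvec_in_E_space:
  fixes z :: "real \<times> (real^'m::finite) \<times> (real^'m)"
  shows "mvec z \<in> E_space \<longleftrightarrow> z \<in> range m_E"
proof -
  have *: "E_space = mvec ` range (m_E :: real^'m \<Rightarrow> _)"
    unfolding E_space_def ee_def using mvec_span_axis[OF m_model_linear(1)] by (simp add: m_E_def)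
  show ?thesis unfolding * by (rule inj_image_mem_iff[OF inj_mvec])
qed

lemma mvec_in_B_space:
  fixes z :: "real \<times> (real^'m::finite) \<times> (real^'m)"
  shows "mvec z \<in> B_space \<longleftrightarrow> z \<in> range m_B"
proof -
  have *: "B_space = mvec ` range (m_B :: real^'m \<Rightarrow> _)"
    unfolding B_space_def bb_def using mvec_span_axis[OF m_model_linear(2)] by (simp add: m_B_def)
  show ?thesis unfolding * by (rule inj_image_mem_iff[OF inj_mvec])
qed

lemma m_psi_mvec: "m_psi (mvec z) = mvec (m_J z)"
  by (cases z) (simp add: m_psi_def m_J_def)

text \<open>A coframe \<open>\<theta>\<close> at \<open>x\<close> is a linear isomorphism from the tangent space to a fixed vector space;
  the dual frame is its inverse.\<close>

definition dual_frame ::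
    "('x, 'f::euclidean_space) chart set \<Rightarrow> 'x \<Rightarrow> (('x, 'f) tvec \<Rightarrow> 'w) \<Rightarrow> 'w \<Rightarrow> ('x, 'f) tvec"
  where "dual_frame A x \<theta> = inv_into (tangent A x) \<theta>"

context
  fixes A :: "('x::{t2_space, second_countable_topology}, 'f::euclidean_space) chart set"
    and x :: 'x and \<theta> :: "('x, 'f) tvec \<Rightarrow> 'w::euclidean_space"
  assumes A: "smooth_atlas A" and \<theta>: "linear_iso_on (tangent A x) UNIV \<theta>"
begin

lemma coframe_add: "v \<in> tangent A x \<Longrightarrow> w \<in> tangent A x \<Longrightarrow> \<theta> (v + w) = \<theta> v + \<theta> w"
  and coframe_scale: "v \<in> tangent A x \<Longrightarrow> \<theta> (r *\<^sub>R v) = r *\<^sub>R \<theta> v"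
  and coframe_inj: "inj_on \<theta> (tangent A x)"
  and coframe_surj: "\<theta> ` tangent A x = UNIV"
  using \<theta> by (simp_all add: linear_iso_on_def linear_on_def bij_betw_def)

lemma dual_frame_tangent: "dual_frame A x \<theta> z \<in> tangent A x"
  unfolding dual_frame_def by (rule inv_into_into) (simp add: coframe_surj)

lemma coframe_dual_frame: "\<theta> (dual_frame A x \<theta> z) = z"
  unfolding dual_frame_def by (rule f_inv_into_f[of z \<theta> "tangent A x"]) (simp add: coframe_surj)

lemma dual_frame_eqI: "v \<in> tangent A x \<Longrightarrow> \<theta> v = z \<Longrightarrow> dual_frame A x \<theta> z = v"
  unfolding dual_frame_def by (rule inv_into_f_eq[OF coframe_inj])

lemma dual_frame_coframe: "v \<in> tangent A x \<Longrightarrow> dual_frame A x \<theta> (\<theta> v) = v"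
  by (rule dual_frame_eqI) auto

lemma linear_dual_frame: "linear (dual_frame A x \<theta>)"
  using subspace_tangent[OF A]
  by (intro linearI dual_frame_eqI)
    (auto simp: coframe_add coframe_scale coframe_dual_frame dual_frame_tangent
      intro: subspace_add subspace_scale)

lemma inj_dual_frame: "inj (dual_frame A x \<theta>)"
  by (rule inj_on_inverseI[of _ \<theta>]) (rule coframe_dual_frame)

lemma coframe_zero_iff:
  assumes v: "v \<in> tangent A x"
  shows "\<theta> v = 0 \<longleftrightarrow> v = 0"
proof
  assume "\<theta> v = 0"
  then show "v = 0" using dual_frame_coframe[OF v] linear_0[OF linear_dual_frame] by simp
next
  assume "v = 0"
  then show "\<theta> v = 0" using coframe_scale[OF v, of 0] by simp
qed

lemma linear_coframe_chart_vec: "k \<in> charts_at A x \<Longrightarrow> linear (\<lambda>v. \<theta> (chart_vec A k x v))"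
  using linear_add[OF linear_chart_vec[OF A]] linear_cmul[OF linear_chart_vec[OF A]]
  by (intro linearI) (simp_all add: coframe_add coframe_scale chart_vec_tangent[OF A])

lemma coframe_chart_vec_inverse:
  assumes k: "k \<in> charts_at A x"
  shows "\<theta> (chart_vec A k x (dual_frame A x \<theta> z k)) = z"
    "dual_frame A x \<theta> (\<theta> (chart_vec A k x v)) k = v"
  by (simp_all add: chart_vec_of_tangent[OF A k dual_frame_tangent] coframe_dual_frame
      dual_frame_coframe chart_vec_tangent[OF A k] chart_vec_self[OF A k])

lemma coframe_dimension: "DIM('f) = DIM('w)"
proof -
  obtain k where k: "k \<in> charts_at A x" using charts_at_nonempty[OF A] .
  let ?F = "\<lambda>v. \<theta> (chart_vec A k x v)"
  have "inj ?F" by (rule inj_on_inverseI[where g="\<lambda>z. dual_frame A x \<theta> z k"]) (rule coframe_chart_vec_inverse(2)[OF k])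
  from inj_on_subset[OF this subset_UNIV]
  have "dim (range ?F) = dim (UNIV :: 'f set)" by (rule dim_image_eq[OF linear_coframe_chart_vec[OF k]])
  moreover have "range ?F = UNIV" by (rule surjI) (rule coframe_chart_vec_inverse(1)[OF k])
  ultimately show ?thesis by (simp add: dim_UNIV)
qed

end

lemma smooth_on_chart_local:
  assumes A: "smooth_atlas A" and k: "k \<in> A"
    and "\<And>x. x \<in> cdom k \<Longrightarrow> \<exists>V. open V \<and> x \<in> V \<and> smooth_on (cmap k ` (cdom k \<inter> V)) f"
  shows "smooth_on (cmap k ` cdom k) f"
proof (rule smooth_on_local)
  fix a assume "a \<in> cmap k ` cdom k"
  then obtain x where x: "x \<in> cdom k" "a = cmap k x" by blast
  then obtain V where V: "open V" "x \<in> V" "smooth_on (cmap k ` (cdom k \<inter> V)) f" using assms(3) by blast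
  have "open (cmap k ` (cdom k \<inter> V))"
    using V(1) open_cdom[OF A k] by (intro open_cmap_image[OF A k]) auto
  then show "\<exists>T. open T \<and> a \<in> T \<and> smooth_on T f" using V x by (intro exI[of _ "cmap k ` (cdom k \<inter> V)"]) auto
qed

text \<open>A family of admissible coframes such that two of them at the same point differ by a rotation
  and that admits smooth local sections: the analogue of a reduction of the frame bundle to
  \<open>O(n-1)\<close>.\<close>

definition coframe_reduction ::
    "('x::{t2_space, second_countable_topology}, 'f::euclidean_space) chart set \<Rightarrow>
     ('x \<Rightarrow> (('x, 'f) tvec \<Rightarrow> real \<times> (real^'m::finite) \<times> (real^'m)) \<Rightarrow> bool) \<Rightarrow> bool"
  where "coframe_reduction A C \<longleftrightarrow>
    (\<forall>x \<theta>. C x \<theta> \<longrightarrow> linear_iso_on (tangent A x) UNIV \<theta>) \<and>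
    (\<forall>x \<theta> \<theta>'. C x \<theta> \<longrightarrow> C x \<theta>' \<longrightarrow>
      (\<exists>k. orthogonal_matrix k \<and> (\<forall>v\<in>tangent A x. \<theta>' v = m_rotate k (\<theta> v)))) \<and>
    (\<forall>x. \<exists>V \<Theta>. open V \<and> x \<in> V \<and> (\<forall>y\<in>V. C y (\<Theta> y)) \<and>
      (\<forall>k\<in>A. \<forall>v. smooth_on (cmap k ` (cdom k \<inter> V)) (\<lambda>a. \<Theta> (cinv k a) (chart_vec A k (cinv k a) v))))"

context
  fixes A :: "('x::{t2_space, second_countable_topology}, 'f::euclidean_space) chart set"
    and C :: "'x \<Rightarrow> (('x, 'f) tvec \<Rightarrow> real \<times> (real^'m::finite) \<times> (real^'m)) \<Rightarrow> bool"
  assumes A: "smooth_atlas A" and C: "coframe_reduction A C"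
begin

text \<open>The tensors are defined by one admissible coframe at each point, chosen without any
  regularity. That every other admissible coframe gives the same result makes it possible to use smooth local
  coframes in the proofs of smoothness.\<close>

definition chosen_coframe :: "'x \<Rightarrow> ('x, 'f) tvec \<Rightarrow> real \<times> (real^'m) \<times> (real^'m)"
  where "chosen_coframe x = (SOME \<theta>. C x \<theta>)"

abbreviation (input) "\<Phi> \<equiv> chosen_coframe"
abbreviation (input) "dual x \<equiv> dual_frame A x (\<Phi> x)"

definition induced_metric where "induced_metric x v w = \<Phi> x v \<bullet> \<Phi> x w"
definition induced_reeb where "induced_reeb x = dual x m_e0"
definition induced_dist where "induced_dist L x = {v \<in> tangent A x. \<Phi> x v \<in> range L}"
definition induced_tensor where "induced_tensor x v = dual x (m_J (\<Phi> x v))"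

lemma coframe_iso: "C x \<theta> \<Longrightarrow> linear_iso_on (tangent A x) UNIV \<theta>"
  using C by (simp add: coframe_reduction_def)

lemma coframe_change:
  assumes "C x \<theta>" "C x \<theta>'"
  obtains k where "orthogonal_matrix k" "\<forall>v\<in>tangent A x. \<theta>' v = m_rotate k (\<theta> v)"
  using C assms unfolding coframe_reduction_def by blast

lemma cinv_chart_domain:
  assumes "k \<in> A" "a \<in> cmap k ` (cdom k \<inter> V)"
  shows "cinv k a \<in> V" "k \<in> charts_at A (cinv k a)"
  using assms by (auto simp: cinv_cmap[OF A assms(1)] in_charts_at)

lemma open_chart_inter: "k \<in> A \<Longrightarrow> open V \<Longrightarrow> open (cmap k ` (cdom k \<inter> V))"
  by (intro open_cmap_image[OF A] open_Int open_cdom[OF A]) auto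

lemma local_coframe:
  obtains V \<Theta> where "open V" "x \<in> V" "\<forall>y\<in>V. C y (\<Theta> y)"
    "\<forall>k\<in>A. \<forall>v. smooth_on (cmap k ` (cdom k \<inter> V)) (\<lambda>a. \<Theta> (cinv k a) (chart_vec A k (cinv k a) v))"
    "\<forall>k\<in>A. \<forall>z. smooth_on (cmap k ` (cdom k \<inter> V)) (\<lambda>a. dual_frame A (cinv k a) (\<Theta> (cinv k a)) z k)"
proof -
  have "\<exists>V \<Theta>. open V \<and> x \<in> V \<and> (\<forall>y\<in>V. C y (\<Theta> y)) \<and>
      (\<forall>k\<in>A. \<forall>v. smooth_on (cmap k ` (cdom k \<inter> V)) (\<lambda>a. \<Theta> (cinv k a) (chart_vec A k (cinv k a) v)))"
    using C by (simp only: coframe_reduction_def)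
  then obtain V \<Theta> where V: "open V" "x \<in> V" and \<Theta>: "\<forall>y\<in>V. C y (\<Theta> y)"
    and s: "\<forall>k\<in>A. \<forall>v. smooth_on (cmap k ` (cdom k \<inter> V)) (\<lambda>a. \<Theta> (cinv k a) (chart_vec A k (cinv k a) v))"
    by (elim exE conjE)
  show ?thesis
  proof (rule that[OF V \<Theta> s], intro ballI allI)
    fix k z assume k: "k \<in> A"
    let ?S = "cmap k ` (cdom k \<inter> V)"
    have y: "k \<in> charts_at A (cinv k a)" "linear_iso_on (tangent A (cinv k a)) UNIV (\<Theta> (cinv k a))"
      if a: "a \<in> ?S" for a
      by (rule cinv_chart_domain(2)[OF k a])
        (rule coframe_iso[OF \<Theta>[rule_format, OF cinv_chart_domain(1)[OF k a]]])
    show "smooth_on ?S (\<lambda>a. dual_frame A (cinv k a) (\<Theta> (cinv k a)) z k)"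
    proof (rule smooth_on_linear_inverse[where F="\<lambda>a v. \<Theta> (cinv k a) (chart_vec A k (cinv k a) v)"])
      show "open ?S" by (rule open_chart_inter[OF k V(1)])
      show "smooth_on ?S (\<lambda>a. \<Theta> (cinv k a) (chart_vec A k (cinv k a) v))" for v
        using s k by blast
      fix a assume a: "a \<in> ?S"
      show "linear (\<lambda>v. \<Theta> (cinv k a) (chart_vec A k (cinv k a) v))"
        by (rule linear_coframe_chart_vec[OF A y(2)[OF a] y(1)[OF a]])
      show "\<Theta> (cinv k a) (chart_vec A k (cinv k a) (dual_frame A (cinv k a) (\<Theta> (cinv k a)) e k)) = e" for e
        by (rule coframe_chart_vec_inverse(1)[OF A y(2)[OF a] y(1)[OF a]])
      show "dual_frame A (cinv k a) (\<Theta> (cinv k a)) (\<Theta> (cinv k a) (chart_vec A k (cinv k a) v)) k = v" for v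
        by (rule coframe_chart_vec_inverse(2)[OF A y(2)[OF a] y(1)[OF a]])
    qed
  qed
qed

lemma chosen_coframe: "C x (\<Phi> x)"
proof -
  obtain V \<Theta> where V: "open V" "x \<in> V" and \<Theta>: "\<forall>y\<in>V. C y (\<Theta> y)"
    and s: "\<forall>k\<in>A. \<forall>v. smooth_on (cmap k ` (cdom k \<inter> V)) (\<lambda>a. \<Theta> (cinv k a) (chart_vec A k (cinv k a) v))"
    and s': "\<forall>k\<in>A. \<forall>z. smooth_on (cmap k ` (cdom k \<inter> V)) (\<lambda>a. dual_frame A (cinv k a) (\<Theta> (cinv k a)) z k)"
    by (rule local_coframe)
  have "C x (\<Theta> x)" using V \<Theta> by blast
  then show ?thesis unfolding chosen_coframe_def by (rule someI[of "C x"])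
qed

lemma chosen_iso: "linear_iso_on (tangent A x) UNIV (\<Phi> x)"
  by (rule coframe_iso[OF chosen_coframe])

lemma induced_metric_eq:
  assumes "C x \<theta>" "v \<in> tangent A x" "w \<in> tangent A x"
  shows "induced_metric x v w = \<theta> v \<bullet> \<theta> w"
proof -
  obtain k where "orthogonal_matrix k" "\<forall>v\<in>tangent A x. \<theta> v = m_rotate k (\<Phi> x v)"
    by (rule coframe_change[OF chosen_coframe assms(1)])
  then show ?thesis using assms by (simp add: induced_metric_def m_rotate_inner)
qed

lemma dual_frame_change:
  assumes \<theta>: "C x \<theta>" and k: "\<forall>v\<in>tangent A x. \<theta> v = m_rotate k (\<Phi> x v)"
  shows "dual_frame A x \<theta> (m_rotate k z) = dual x z"
  using k coframe_dual_frame[OF A chosen_iso] dual_frame_tangent[OF A chosen_iso]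
  by (intro dual_frame_eqI[OF A coframe_iso[OF \<theta>]]) auto

lemma induced_reeb_eq:
  assumes "C x \<theta>"
  shows "induced_reeb x = dual_frame A x \<theta> m_e0"
proof -
  obtain k where "\<forall>v\<in>tangent A x. \<theta> v = m_rotate k (\<Phi> x v)"
    by (rule coframe_change[OF chosen_coframe assms])
  from dual_frame_change[OF assms this, of m_e0] show ?thesis
    by (simp add: m_rotate_model induced_reeb_def)
qed

lemma induced_tensor_eq:
  assumes "C x \<theta>" "v \<in> tangent A x"
  shows "induced_tensor x v = dual_frame A x \<theta> (m_J (\<theta> v))"
proof -
  obtain k where k: "\<forall>v\<in>tangent A x. \<theta> v = m_rotate k (\<Phi> x v)"
    by (rule coframe_change[OF chosen_coframe assms(1)])
  from dual_frame_change[OF assms(1) k, of "m_J (\<Phi> x v)"] show ?thesis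
    using k assms(2) by (simp add: m_rotate_model induced_tensor_def)
qed

lemma induced_dist_eq:
  assumes \<theta>: "C x \<theta>" and L: "\<And>k v. m_rotate k (L v) = L (k *v v)"
  shows "induced_dist L x = {v \<in> tangent A x. \<theta> v \<in> range L}"
proof -
  have "\<theta>2 v \<in> range L" if C12: "C x \<theta>1" "C x \<theta>2" and v: "v \<in> tangent A x" "\<theta>1 v \<in> range L"
    for \<theta>1 \<theta>2 v
  proof -
    obtain k where "\<forall>v\<in>tangent A x. \<theta>2 v = m_rotate k (\<theta>1 v)"
      by (rule coframe_change[OF C12])
    then show ?thesis using v L by auto
  qed
  from this[OF \<theta> chosen_coframe] this[OF chosen_coframe \<theta>] show ?thesis
    unfolding induced_dist_def by blast
qed

lemma riemannian_induced_metric: "riemannian_metric A induced_metric"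
  unfolding riemannian_metric_def
proof (intro conjI allI ballI impI)
  fix x v w assume v: "v \<in> tangent A x"
  show "linear_on (tangent A x) (induced_metric x v)"
    by (simp add: linear_on_def induced_metric_def coframe_add[OF A chosen_iso] coframe_scale[OF A chosen_iso]
        inner_add_right)
  show "induced_metric x v w = induced_metric x w v" by (simp add: induced_metric_def inner_commute)
  show "induced_metric x v v > 0" if "v \<noteq> 0"
    using that coframe_zero_iff[OF A chosen_iso v] by (simp add: induced_metric_def)
next
  fix k v w assume k: "k \<in> A"
  show "smooth_on (cmap k ` cdom k)
    (\<lambda>a. induced_metric (cinv k a) (chart_vec A k (cinv k a) v) (chart_vec A k (cinv k a) w))"
  proof (rule smooth_on_chart_local[OF A k])
    fix x assume "x \<in> cdom k"
    obtain V \<Theta> where V: "open V" "x \<in> V" and \<Theta>: "\<forall>y\<in>V. C y (\<Theta> y)"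
      and s: "\<forall>k\<in>A. \<forall>v. smooth_on (cmap k ` (cdom k \<inter> V)) (\<lambda>a. \<Theta> (cinv k a) (chart_vec A k (cinv k a) v))"
      and s': "\<forall>k\<in>A. \<forall>z. smooth_on (cmap k ` (cdom k \<inter> V)) (\<lambda>a. dual_frame A (cinv k a) (\<Theta> (cinv k a)) z k)"
      by (rule local_coframe)
    have "smooth_on (cmap k ` (cdom k \<inter> V)) (\<lambda>a. \<Theta> (cinv k a) (chart_vec A k (cinv k a) v) \<bullet>
        \<Theta> (cinv k a) (chart_vec A k (cinv k a) w))"
      using s k by (intro smooth_on_bilinear[OF bounded_bilinear_inner] open_chart_inter V(1)) auto
    then have "smooth_on (cmap k ` (cdom k \<inter> V))
        (\<lambda>a. induced_metric (cinv k a) (chart_vec A k (cinv k a) v) (chart_vec A k (cinv k a) w))"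
    proof (rule smooth_on_cong[OF open_chart_inter[OF k V(1)], rotated])
      fix a assume a: "a \<in> cmap k ` (cdom k \<inter> V)"
      note c = \<Theta>[rule_format, OF cinv_chart_domain(1)[OF k a]]
      show "\<Theta> (cinv k a) (chart_vec A k (cinv k a) v) \<bullet> \<Theta> (cinv k a) (chart_vec A k (cinv k a) w) =
          induced_metric (cinv k a) (chart_vec A k (cinv k a) v) (chart_vec A k (cinv k a) w)"
        by (simp add: induced_metric_eq[OF c] chart_vec_tangent[OF A cinv_chart_domain(2)[OF k a]])
    qed
    then show "\<exists>V. open V \<and> x \<in> V \<and> smooth_on (cmap k ` (cdom k \<inter> V))
        (\<lambda>a. induced_metric (cinv k a) (chart_vec A k (cinv k a) v) (chart_vec A k (cinv k a) w))"
      using V by blast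
  qed
qed

lemma vector_field_induced_reeb: "vector_field A induced_reeb"
  unfolding vector_field_on_def
proof (intro conjI ballI)
  show "induced_reeb x \<in> tangent A x" for x
    unfolding induced_reeb_def by (rule dual_frame_tangent[OF A chosen_iso])
  fix k assume k: "k \<in> A"
  have "smooth_on (cmap k ` cdom k) (\<lambda>a. induced_reeb (cinv k a) k)"
  proof (rule smooth_on_chart_local[OF A k])
    fix x assume "x \<in> cdom k"
    obtain V \<Theta> where V: "open V" "x \<in> V" and \<Theta>: "\<forall>y\<in>V. C y (\<Theta> y)"
      and s: "\<forall>k\<in>A. \<forall>v. smooth_on (cmap k ` (cdom k \<inter> V)) (\<lambda>a. \<Theta> (cinv k a) (chart_vec A k (cinv k a) v))"
      and s': "\<forall>k\<in>A. \<forall>z. smooth_on (cmap k ` (cdom k \<inter> V)) (\<lambda>a. dual_frame A (cinv k a) (\<Theta> (cinv k a)) z k)"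
      by (rule local_coframe)
    have "smooth_on (cmap k ` (cdom k \<inter> V)) (\<lambda>a. induced_reeb (cinv k a) k)"
    proof (rule smooth_on_cong[OF open_chart_inter[OF k V(1)] _ s'[rule_format, OF k, of m_e0]])
      fix a assume a: "a \<in> cmap k ` (cdom k \<inter> V)"
      note c = \<Theta>[rule_format, OF cinv_chart_domain(1)[OF k a]]
      show "dual_frame A (cinv k a) (\<Theta> (cinv k a)) m_e0 k = induced_reeb (cinv k a) k"
        by (simp add: induced_reeb_eq[OF c])
    qed
    then show "\<exists>V. open V \<and> x \<in> V \<and> smooth_on (cmap k ` (cdom k \<inter> V)) (\<lambda>a. induced_reeb (cinv k a) k)"
      using V by blast
  qed
  then show "smooth_on (cmap k ` (cdom k \<inter> UNIV)) (\<lambda>a. induced_reeb (cinv k a) k)" by simp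
qed

lemma tensor_field_induced_tensor: "tensor_field_11 A induced_tensor"
  unfolding tensor_field_11_def
proof (intro conjI ballI allI)
  fix x
  show "linear_on (tangent A x) (induced_tensor x)"
    by (simp add: linear_on_def induced_tensor_def coframe_add[OF A chosen_iso] coframe_scale[OF A chosen_iso]
        linear_add[OF m_model_linear(3)] linear_cmul[OF m_model_linear(3)]
        linear_add[OF linear_dual_frame[OF A chosen_iso]] linear_cmul[OF linear_dual_frame[OF A chosen_iso]])
  show "induced_tensor x ` tangent A x \<subseteq> tangent A x"
    by (auto simp: induced_tensor_def intro: dual_frame_tangent[OF A chosen_iso])
next
  fix k v assume k: "k \<in> A"
  let ?f = "\<lambda>a. induced_tensor (cinv k a) (chart_vec A k (cinv k a) v) k"
  show "smooth_on (cmap k ` cdom k) ?f"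
  proof (rule smooth_on_chart_local[OF A k])
    fix x assume "x \<in> cdom k"
    obtain V \<Theta> where V: "open V" "x \<in> V" and \<Theta>: "\<forall>y\<in>V. C y (\<Theta> y)"
      and s: "\<forall>k\<in>A. \<forall>v. smooth_on (cmap k ` (cdom k \<inter> V)) (\<lambda>a. \<Theta> (cinv k a) (chart_vec A k (cinv k a) v))"
      and s': "\<forall>k\<in>A. \<forall>z. smooth_on (cmap k ` (cdom k \<inter> V)) (\<lambda>a. dual_frame A (cinv k a) (\<Theta> (cinv k a)) z k)"
      by (rule local_coframe)
    note S = open_chart_inter[OF k V(1)]
    have J: "smooth_on (cmap k ` (cdom k \<inter> V)) (\<lambda>a. m_J (\<Theta> (cinv k a) (chart_vec A k (cinv k a) v)))"
      using s k
      by (intro smooth_on_linear[OF m_model_linear(3)[unfolded linear_conv_bounded_linear] S]) blast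
    have "smooth_on (cmap k ` (cdom k \<inter> V))
        (\<lambda>a. (\<lambda>z. dual_frame A (cinv k a) (\<Theta> (cinv k a)) z k) (m_J (\<Theta> (cinv k a) (chart_vec A k (cinv k a) v))))"
    proof (rule smooth_on_family[OF S _ _ J])
      fix a assume a: "a \<in> cmap k ` (cdom k \<inter> V)"
      have "linear (dual_frame A (cinv k a) (\<Theta> (cinv k a)))"
        by (rule linear_dual_frame[OF A coframe_iso[OF \<Theta>[rule_format, OF cinv_chart_domain(1)[OF k a]]]])
      then show "linear (\<lambda>z. dual_frame A (cinv k a) (\<Theta> (cinv k a)) z k)"
        by (intro linearI) (simp_all add: linear_add linear_cmul scaleR_fun_def)
    qed (use s' k in blast)
    then have "smooth_on (cmap k ` (cdom k \<inter> V)) ?f"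
    proof (rule smooth_on_cong[OF S, rotated])
      fix a assume a: "a \<in> cmap k ` (cdom k \<inter> V)"
      note c = \<Theta>[rule_format, OF cinv_chart_domain(1)[OF k a]]
      show "dual_frame A (cinv k a) (\<Theta> (cinv k a)) (m_J (\<Theta> (cinv k a) (chart_vec A k (cinv k a) v))) k = ?f a"
        by (simp add: induced_tensor_eq[OF c] chart_vec_tangent[OF A cinv_chart_domain(2)[OF k a]])
    qed
    then show "\<exists>V. open V \<and> x \<in> V \<and> smooth_on (cmap k ` (cdom k \<inter> V)) ?f" using V by blast
  qed
qed

lemma induced_dist_image:
  assumes "C x \<theta>" "\<And>k v. m_rotate k (L v) = L (k *v v)"
  shows "induced_dist L x = range (\<lambda>v. dual_frame A x \<theta> (L v))"
proof -
  note iso = coframe_iso[OF assms(1)]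
  show ?thesis
    unfolding induced_dist_eq[OF assms]
  proof (intro equalityI subsetI)
    fix v assume "v \<in> {v \<in> tangent A x. \<theta> v \<in> range L}"
    then obtain a where v: "v \<in> tangent A x" and "\<theta> v = L a" by blast
    then have "v = dual_frame A x \<theta> (L a)" using dual_frame_coframe[OF A iso v] by simp
    then show "v \<in> range (\<lambda>v. dual_frame A x \<theta> (L v))" by (rule image_eqI) simp
  next
    fix v assume "v \<in> range (\<lambda>v. dual_frame A x \<theta> (L v))"
    then obtain a where v: "v = dual_frame A x \<theta> (L a)" by blast
    show "v \<in> {v \<in> tangent A x. \<theta> v \<in> range L}"
      unfolding v by (simp add: dual_frame_tangent[OF A iso] coframe_dual_frame[OF A iso])
  qed
qed

text \<open>An equivariant inclusion \<open>L\<close> of \<open>\<real>\<^sup>n\<^sup>-\<^sup>1\<close> into \<open>\<mm>\<close> defines a distribution, spanned locally by the images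
  of the standard basis under a smooth dual frame.\<close>

lemma distribution_induced_dist:
  assumes L: "linear L" "inj L" "\<And>k v. m_rotate k (L v) = L (k *v v)"
  shows "distribution A CARD('m) (induced_dist L)"
  unfolding distribution_def
proof (intro conjI allI)
  have span: "induced_dist L x = span ((\<lambda>v. dual_frame A x \<theta> (L v)) ` Basis)" if "C x \<theta>" for x \<theta>
    using linear_span_image[OF linear_compose[OF L(1) linear_dual_frame[OF A coframe_iso[OF that]]], of Basis]
    by (simp add: o_def induced_dist_image[OF that L(3)])
  have card: "card (Basis :: (real^'m) set) = CARD('m)" by simp
  fix x
  let ?f = "\<lambda>v. dual x (L v)"
  have lin: "linear ?f"
    using linear_compose[OF L(1) linear_dual_frame[OF A chosen_iso]] by (simp add: o_def)
  have inj: "inj ?f"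
    using inj_compose[OF inj_dual_frame[OF A chosen_iso] L(2)] by (simp add: o_def)
  have "independent (?f ` Basis)"
    by (rule linear_independent_injective_image[OF lin independent_Basis inj_on_subset[OF inj subset_UNIV]])
  then have "dim (span (?f ` Basis)) = card (?f ` Basis)" by (rule dim_span_eq_card_independent)
  also have "\<dots> = CARD('m)" by (simp add: card_image inj_on_subset[OF inj])
  finally show "dim (induced_dist L x) = CARD('m)" by (simp add: span[OF chosen_coframe])
  obtain V \<Theta> where V: "open V" "x \<in> V" and \<Theta>: "\<forall>y\<in>V. C y (\<Theta> y)"
    and s: "\<forall>k\<in>A. \<forall>v. smooth_on (cmap k ` (cdom k \<inter> V)) (\<lambda>a. \<Theta> (cinv k a) (chart_vec A k (cinv k a) v))"
    and s': "\<forall>k\<in>A. \<forall>z. smooth_on (cmap k ` (cdom k \<inter> V)) (\<lambda>a. dual_frame A (cinv k a) (\<Theta> (cinv k a)) z k)"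
    by (rule local_coframe)
  obtain e where e: "bij_betw e {..<CARD('m)} (Basis :: (real^'m) set)"
    using ex_bij_betw_nat_finite[of "Basis :: (real^'m) set"] card by (auto simp: atLeast0LessThan)
  let ?X = "\<lambda>i y. dual_frame A y (\<Theta> y) (L (e i))"
  have vf: "vector_field_on A V (?X i)" for i
    unfolding vector_field_on_def
  proof (intro conjI ballI)
    show "?X i y \<in> tangent A y" if "y \<in> V" for y
      by (rule dual_frame_tangent[OF A coframe_iso[OF \<Theta>[rule_format, OF that]]])
    show "smooth_on (cmap k ` (cdom k \<inter> V)) (\<lambda>a. ?X i (cinv k a) k)" if "k \<in> A" for k
      by (rule s'[rule_format, OF that])
  qed
  have sp: "induced_dist L y = span ((\<lambda>i. ?X i y) ` {..<CARD('m)})" if "y \<in> V" for y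
    unfolding span[OF \<Theta>[rule_format, OF that]] bij_betw_imp_surj_on[OF e, symmetric] image_image ..
  show "\<exists>S X. open S \<and> x \<in> S \<and> (\<forall>i<CARD('m). vector_field_on A S (X i)) \<and>
      (\<forall>y\<in>S. induced_dist L y = span ((\<lambda>i. X i y) ` {..<CARD('m)}))"
    by (intro exI[of _ V] exI[of _ ?X] conjI allI impI ballI V vf sp)
qed

lemma induced_inner: "induced_metric x (dual x z) (dual x z') = z \<bullet> z'"
  by (simp add: induced_metric_def coframe_dual_frame[OF A chosen_iso])

lemma induced_alpha: "induced_metric x (induced_reeb x) v = m_e0 \<bullet> \<Phi> x v"
  by (simp add: induced_metric_def induced_reeb_def coframe_dual_frame[OF A chosen_iso])

lemma induced_tensor_dual: "induced_tensor x (dual x z) = dual x (m_J z)"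
  by (simp add: induced_tensor_def coframe_dual_frame[OF A chosen_iso])

lemma tangent_dual: "v \<in> tangent A x \<Longrightarrow> dual x (\<Phi> x v) = v"
  by (rule dual_frame_coframe[OF A chosen_iso])

lemma induced_tensor_square:
  assumes v: "v \<in> tangent A x"
  shows "induced_tensor x (induced_tensor x v) = - v + induced_metric x (induced_reeb x) v *\<^sub>R induced_reeb x"
proof -
  note lin = linear_dual_frame[OF A chosen_iso, of x]
  have "induced_tensor x (induced_tensor x v) = dual x (- \<Phi> x v + (m_e0 \<bullet> \<Phi> x v) *\<^sub>R m_e0)"
    unfolding m_J_square[symmetric] by (simp add: induced_tensor_def[of x v] induced_tensor_dual)
  then show ?thesis
    by (simp add: linear_add[OF lin] linear_neg[OF lin] linear_cmul[OF lin] tangent_dual[OF v]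
        induced_alpha induced_reeb_def[symmetric] linear_diff[OF lin])
qed

lemma induced_tensor_metric:
  "induced_metric x (induced_tensor x v) (induced_tensor x w) =
    induced_metric x v w - induced_metric x (induced_reeb x) v * induced_metric x (induced_reeb x) w"
  unfolding induced_alpha
  by (simp add: induced_tensor_def coframe_dual_frame[OF A chosen_iso] m_J_inner induced_metric_def)

lemma one_form_induced_alpha: "one_form A (\<lambda>x v. induced_metric x (induced_reeb x) v)"
  unfolding one_form_def
proof (intro conjI allI ballI)
  show "linear_on (tangent A x) (induced_metric x (induced_reeb x))" for x
    by (simp add: linear_on_def induced_metric_def coframe_add[OF A chosen_iso] coframe_scale[OF A chosen_iso]
        inner_add_right)
  fix k v assume k: "k \<in> A"
  let ?f = "\<lambda>a. induced_metric (cinv k a) (induced_reeb (cinv k a)) (chart_vec A k (cinv k a) v)"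
  show "smooth_on (cmap k ` cdom k) ?f"
  proof (rule smooth_on_chart_local[OF A k])
    fix x assume "x \<in> cdom k"
    obtain V \<Theta> where V: "open V" "x \<in> V" and \<Theta>: "\<forall>y\<in>V. C y (\<Theta> y)"
      and s: "\<forall>k\<in>A. \<forall>v. smooth_on (cmap k ` (cdom k \<inter> V)) (\<lambda>a. \<Theta> (cinv k a) (chart_vec A k (cinv k a) v))"
      and s': "\<forall>k\<in>A. \<forall>z. smooth_on (cmap k ` (cdom k \<inter> V)) (\<lambda>a. dual_frame A (cinv k a) (\<Theta> (cinv k a)) z k)"
      by (rule local_coframe)
    note S = open_chart_inter[OF k V(1)]
    have "smooth_on (cmap k ` (cdom k \<inter> V)) (\<lambda>a. m_e0 \<bullet> \<Theta> (cinv k a) (chart_vec A k (cinv k a) v))"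
      using s k by (intro smooth_on_linear[OF bounded_linear_inner_right S]) auto
    then have "smooth_on (cmap k ` (cdom k \<inter> V)) ?f"
    proof (rule smooth_on_cong[OF S, rotated])
      fix a assume a: "a \<in> cmap k ` (cdom k \<inter> V)"
      have c: "C (cinv k a) (\<Theta> (cinv k a))" using \<Theta> cinv_chart_domain(1)[OF k a] by blast
      note iso = coframe_iso[OF c]
      show "m_e0 \<bullet> \<Theta> (cinv k a) (chart_vec A k (cinv k a) v) = ?f a"
        unfolding induced_reeb_eq[OF c]
        by (simp add: induced_metric_eq[OF c] dual_frame_tangent[OF A iso] coframe_dual_frame[OF A iso]
            chart_vec_tangent[OF A cinv_chart_domain(2)[OF k a]])
    qed
    then show "\<exists>V. open V \<and> x \<in> V \<and> smooth_on (cmap k ` (cdom k \<inter> V)) ?f" using V by blast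
  qed
qed

lemma induced_dist_E: "induced_dist m_E x = range (\<lambda>v. dual x (m_E v))"
  and induced_dist_B: "induced_dist m_B x = range (\<lambda>v. dual x (m_B v))"
  by (rule induced_dist_image[OF chosen_coframe m_rotate_model(2)], rule induced_dist_image[OF chosen_coframe m_rotate_model(3)])

lemma induced_splitting:
  assumes v: "v \<in> tangent A x"
  shows "\<exists>!z. case z of (r, e, b) \<Rightarrow> e \<in> induced_dist m_E x \<and> b \<in> induced_dist m_B x \<and> v = r *\<^sub>R induced_reeb x + e + b"
proof -
  note lin = linear_dual_frame[OF A chosen_iso, of x]
  have combine: "r *\<^sub>R induced_reeb x + dual x (m_E a) + dual x (m_B b) = dual x (r *\<^sub>R m_e0 + m_E a + m_B b)" for r a b
    by (simp add: induced_reeb_def linear_add[OF lin] linear_cmul[OF lin])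
  let ?z = "\<Phi> x v"
  show ?thesis
    unfolding induced_dist_E induced_dist_B
  proof (rule ex1I[of _ "(m_e0 \<bullet> ?z, dual x (m_E (fst (snd ?z))), dual x (m_B (snd (snd ?z))))"])
    show "case (m_e0 \<bullet> ?z, dual x (m_E (fst (snd ?z))), dual x (m_B (snd (snd ?z)))) of (r, e, b) \<Rightarrow>
      e \<in> range (\<lambda>v. dual x (m_E v)) \<and> b \<in> range (\<lambda>v. dual x (m_B v)) \<and> v = r *\<^sub>R induced_reeb x + e + b"
      unfolding prod.case combine m_decompose[symmetric] using tangent_dual[OF v] by simp
    fix y :: "real \<times> ('x, 'f) tvec \<times> ('x, 'f) tvec"
    assume y: "case y of (r, e, b) \<Rightarrow>
      e \<in> range (\<lambda>v. dual x (m_E v)) \<and> b \<in> range (\<lambda>v. dual x (m_B v)) \<and> v = r *\<^sub>R induced_reeb x + e + b"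
    obtain r a b where yr: "y = (r, dual x (m_E a), dual x (m_B b))"
      and "v = r *\<^sub>R induced_reeb x + dual x (m_E a) + dual x (m_B b)"
      using y by (cases y) auto
    then have "\<Phi> x v = r *\<^sub>R m_e0 + m_E a + m_B b"
      unfolding combine by (simp add: coframe_dual_frame[OF A chosen_iso])
    from m_decompose_unique[OF trans[OF sym[OF this] m_decompose[of ?z]]]
    show "y = (m_e0 \<bullet> ?z, dual x (m_E (fst (snd ?z))), dual x (m_B (snd (snd ?z))))"
      unfolding yr by simp
  qed
qed

lemma induced_tensor_images:
  "induced_tensor x (induced_reeb x) = 0"
  "induced_tensor x ` induced_dist m_E x = induced_dist m_B x"
  "induced_tensor x ` induced_dist m_B x = induced_dist m_E x"
proof -
  show "induced_tensor x (induced_reeb x) = 0"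
    by (simp add: induced_reeb_def induced_tensor_dual m_J_model linear_0[OF linear_dual_frame[OF A chosen_iso]])
  show "induced_tensor x ` induced_dist m_E x = induced_dist m_B x"
    unfolding induced_dist_E induced_dist_B by (simp add: image_image induced_tensor_dual m_J_model)
  have "range (\<lambda>v. dual x (- m_E v)) = range (\<lambda>v. dual x (m_E v))"
  proof -
    have "range (\<lambda>v. dual x (m_E v)) = (\<lambda>v. dual x (m_E v)) ` range uminus" by simp
    also have "\<dots> = range (\<lambda>v. dual x (- m_E v))"
      by (simp only: image_image linear_neg[OF m_model_linear(1)])
    finally show ?thesis by simp
  qed
  then show "induced_tensor x ` induced_dist m_B x = induced_dist m_E x"
    unfolding induced_dist_E induced_dist_B by (simp add: image_image induced_tensor_dual m_J_model)
qed

lemma induced_orthogonal: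
  assumes "e \<in> induced_dist m_E x" "b \<in> induced_dist m_B x"
  shows "induced_metric x (induced_reeb x) e = 0" "induced_metric x (induced_reeb x) b = 0" "induced_metric x e b = 0"
  using assms unfolding induced_dist_E induced_dist_B induced_reeb_def by (auto simp: induced_inner m_orthogonal)

lemma induced_reeb_unit: "induced_metric x (induced_reeb x) (induced_reeb x) = 1"
  by (simp add: induced_reeb_def induced_inner m_orthogonal)

lemma induced_almost_contact:
  "almost_contact_metric A induced_metric induced_reeb (\<lambda>x v. induced_metric x (induced_reeb x) v) induced_tensor"
  unfolding almost_contact_metric_def
  by (intro conjI allI ballI refl riemannian_induced_metric vector_field_induced_reeb induced_reeb_unit
      one_form_induced_alpha tensor_field_induced_tensor induced_tensor_square induced_tensor_metric)

end

definition cartan_coframe ::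
    "('p, 'e::euclidean_space) chart set \<Rightarrow> ('x, 'f::euclidean_space) chart set \<Rightarrow> ('p \<Rightarrow> 'x) \<Rightarrow>
     ('p \<Rightarrow> ('p, 'e) tvec \<Rightarrow> 'm::finite euc_mat) \<Rightarrow>
     'x \<Rightarrow> (('x, 'f) tvec \<Rightarrow> real \<times> (real^'m) \<times> (real^'m)) \<Rightarrow> bool"
  where "cartan_coframe AP AN p \<omega> x \<theta> \<longleftrightarrow> (\<exists>u. p u = x \<and> \<theta> = coframe AP AN p \<omega> u)"

lemma coframe_reduction_cartan:
  fixes AP :: "('p::{t2_space, second_countable_topology}, 'e::euclidean_space) chart set"
    and AN :: "('x::{t2_space, second_countable_topology}, 'f::euclidean_space) chart set"
    and act :: "'p \<Rightarrow> 'm::finite euc_mat \<Rightarrow> 'p"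
  assumes cartan: "cartan_geometry AP AN euc_algebra isotropy_group isotropy_algebra p act \<omega>"
  shows "coframe_reduction AN (cartan_coframe AP AN p \<omega>)"
  unfolding coframe_reduction_def cartan_coframe_def
proof (intro conjI allI impI)
  fix x \<theta> assume "\<exists>u. p u = x \<and> \<theta> = coframe AP AN p \<omega> u"
  then show "linear_iso_on (tangent AN x) UNIV \<theta>" using coframe_linear_iso[OF cartan] by blast
  fix \<theta>' assume "\<exists>u. p u = x \<and> \<theta> = coframe AP AN p \<omega> u" "\<exists>u. p u = x \<and> \<theta>' = coframe AP AN p \<omega> u"
  then obtain u u' where u: "p u = x" "\<theta> = coframe AP AN p \<omega> u" "p u' = x" "\<theta>' = coframe AP AN p \<omega> u'" by blast
  obtain h where h: "h \<in> isotropy_group" "u' = act u h"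
    by (rule fibre_transitive[OF cartan, of u u']) (use u in auto)
  obtain k where "orthogonal_matrix k"
    "\<forall>v\<in>tangent AN (p u). coframe AP AN p \<omega> (act u h) v = m_rotate k (coframe AP AN p \<omega> u v)"
    by (rule coframe_equivariant[OF cartan h(1)])
  then show "\<exists>k. orthogonal_matrix k \<and> (\<forall>v\<in>tangent AN x. \<theta>' v = m_rotate k (\<theta> v))"
    using u h(2) by blast
next
  fix x
  obtain u where u: "p u = x" using surj_p[OF cartan] by blast
  obtain V s where V: "open V" "p u \<in> V" and s: "smooth_map_on AN AP V s" and "s (p u) = u"
    and ps: "\<forall>y. y \<in> V \<longrightarrow> p (s y) = y"
    by (rule local_section[OF cartan, of u])
  show "\<exists>V \<Theta>. open V \<and> x \<in> V \<and> (\<forall>y\<in>V. \<exists>u. p u = y \<and> \<Theta> y = coframe AP AN p \<omega> u) \<and>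
      (\<forall>k\<in>AN. \<forall>v. smooth_on (cmap k ` (cdom k \<inter> V)) (\<lambda>a. \<Theta> (cinv k a) (chart_vec AN k (cinv k a) v)))"
  proof (intro exI conjI)
    show "open V" "x \<in> V" using V u by simp_all
    show "\<forall>y\<in>V. \<exists>u. p u = y \<and> coframe AP AN p \<omega> (s y) = coframe AP AN p \<omega> u" using ps by blast
    show "\<forall>k\<in>AN. \<forall>v. smooth_on (cmap k ` (cdom k \<inter> V))
        (\<lambda>a. coframe AP AN p \<omega> (s (cinv k a)) (chart_vec AN k (cinv k a) v))"
      using coframe_section_smooth[OF cartan V(1) s ps[rule_format]] by blast
  qed
qed

theorem proposition4p1:
  fixes n :: nat
    and AP :: "('p::{t2_space, second_countable_topology}, 'e::euclidean_space) chart set"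
    and AN :: "('x::{t2_space, second_countable_topology}, 'f::euclidean_space) chart set"
    and p :: "'p \<Rightarrow> 'x"
    and act :: "'p \<Rightarrow> 'm::finite euc_mat \<Rightarrow> 'p"
    and \<omega> :: "'p \<Rightarrow> ('p, 'e) tvec \<Rightarrow> 'm euc_mat"
  assumes "n \<ge> 2" and "CARD('m) = n - 1"
    and "cartan_geometry AP AN euc_algebra isotropy_group isotropy_algebra p act \<omega>"
  shows "DIM('f) = 2 * n - 1 \<and>
    (\<exists>g U \<alpha> \<E> \<B> \<Psi>.
      induced_tuple AP AN p \<omega> g U \<E> \<B> \<Psi> \<and>
      riemannian_metric AN g \<and>
      vector_field AN U \<and> (\<forall>x. g x (U x) (U x) = 1) \<and>
      \<alpha> = (\<lambda>x v. g x (U x) v) \<and>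
      distribution AN (n - 1) \<E> \<and> distribution AN (n - 1) \<B> \<and>
      (\<forall>x. \<forall>v\<in>tangent AN x. \<exists>!z. case z of (r, e, b) \<Rightarrow>
        e \<in> \<E> x \<and> b \<in> \<B> x \<and> v = r *\<^sub>R U x + e + b) \<and>
      (\<forall>x. \<forall>e\<in>\<E> x. \<forall>b\<in>\<B> x. g x (U x) e = 0 \<and> g x (U x) b = 0 \<and> g x e b = 0) \<and>
      tensor_field_11 AN \<Psi> \<and>
      (\<forall>x. \<forall>v\<in>tangent AN x. \<Psi> x (\<Psi> x v) = - v + \<alpha> x v *\<^sub>R U x) \<and>
      (\<forall>V W. vector_field AN V \<longrightarrow> vector_field AN W \<longrightarrow>
        (\<forall>x. g x (\<Psi> x (V x)) (\<Psi> x (W x)) = g x (V x) (W x) - \<alpha> x (V x) * \<alpha> x (W x))) \<and>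
      (\<forall>x. \<Psi> x (U x) = 0 \<and> \<Psi> x ` \<E> x = \<B> x \<and> \<Psi> x ` \<B> x = \<E> x) \<and>
      almost_contact_metric AN g U \<alpha> \<Psi>)"
proof
  note cartan = assms(3)
  let ?C = "cartan_coframe AP AN p \<omega>"
  have N: "smooth_atlas AN" using cartan by (simp add: cartan_geometry_def)
  note C = coframe_reduction_cartan[OF cartan]
  note NC = N C
  show "DIM('f) = 2 * n - 1"
    using coframe_dimension[OF N coframe_linear_iso[OF cartan]] assms(1,2) by simp
  let ?g = "induced_metric ?C" and ?U = "induced_reeb AN ?C" and ?\<Psi> = "induced_tensor AN ?C"
    and ?D = "\<lambda>L. induced_dist AN ?C L"
  have tuple: "induced_tuple AP AN p \<omega> ?g ?U (?D m_E) (?D m_B) ?\<Psi>"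
    unfolding induced_tuple_def Let_def
  proof (intro allI ballI)
    fix x u assume "u \<in> p -` {x}"
    then have pu: "p u = x" by simp
    let ?T = "tangent AN x" and ?\<phi> = "cartan_phi AP AN p \<omega> u" and ?\<theta> = "coframe AP AN p \<omega> u"
    have c: "?C x ?\<theta>" using pu by (auto simp: cartan_coframe_def)
    have \<phi>: "?\<phi> v = mvec (?\<theta> v)" if "v \<in> ?T" for v
      using cartan_phi_coframe[OF cartan, of v u] that pu by simp
    have iso: "linear_iso_on ?T UNIV ?\<theta>" using coframe_linear_iso[OF cartan, of u] pu by simp
    have inj: "inj_on ?\<phi> ?T"
    proof (rule inj_onI)
      fix v w assume vw: "v \<in> ?T" "w \<in> ?T" "?\<phi> v = ?\<phi> w"
      then have "?\<theta> v = ?\<theta> w" using inj_mvec by (auto simp: \<phi> dest: injD)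
      then show "v = w" using vw coframe_inj[OF N iso] by (auto dest: inj_onD)
    qed
    have inv: "inv_into ?T ?\<phi> (mvec z) = dual_frame AN x ?\<theta> z" for z
      by (rule inv_into_f_eq[OF inj dual_frame_tangent[OF N iso]])
        (simp add: \<phi> dual_frame_tangent[OF N iso] coframe_dual_frame[OF N iso])
    show "(\<forall>v\<in>?T. \<forall>w\<in>?T. ?g x v w = m_inner (?\<phi> v) (?\<phi> w)) \<and>
        ?U x = inv_into ?T ?\<phi> e0 \<and>
        ?D m_E x = {v \<in> ?T. ?\<phi> v \<in> E_space} \<and>
        ?D m_B x = {v \<in> ?T. ?\<phi> v \<in> B_space} \<and>
        (\<forall>v\<in>?T. ?\<Psi> x v = inv_into ?T ?\<phi> (m_psi (?\<phi> v)))"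
    proof (intro conjI ballI)
      show "?g x v w = m_inner (?\<phi> v) (?\<phi> w)" if "v \<in> ?T" "w \<in> ?T" for v w
        using that by (simp add: induced_metric_eq[OF NC, OF c] \<phi> m_inner_def)
      show "?U x = inv_into ?T ?\<phi> e0"
        using inv[of m_e0] by (simp add: induced_reeb_eq[OF NC, OF c] e0_def m_e0_def)
      show "?D m_E x = {v \<in> ?T. ?\<phi> v \<in> E_space}"
        unfolding induced_dist_eq[OF NC, OF c m_rotate_model(2)] by (auto simp: \<phi> mvec_in_E_space)
      show "?D m_B x = {v \<in> ?T. ?\<phi> v \<in> B_space}"
        unfolding induced_dist_eq[OF NC, OF c m_rotate_model(3)] by (auto simp: \<phi> mvec_in_B_space)
      show "?\<Psi> x v = inv_into ?T ?\<phi> (m_psi (?\<phi> v))" if "v \<in> ?T" for v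
        using that by (simp add: induced_tensor_eq[OF NC, OF c] \<phi> m_psi_mvec inv)
    qed
  qed
  note dist = distribution_induced_dist[OF NC m_model_linear(1) m_model_inj(1) m_rotate_model(2)]
    distribution_induced_dist[OF NC m_model_linear(2) m_model_inj(2) m_rotate_model(3)]
  show "\<exists>g U \<alpha> \<E> \<B> \<Psi>.
      induced_tuple AP AN p \<omega> g U \<E> \<B> \<Psi> \<and>
      riemannian_metric AN g \<and>
      vector_field AN U \<and> (\<forall>x. g x (U x) (U x) = 1) \<and>
      \<alpha> = (\<lambda>x v. g x (U x) v) \<and>
      distribution AN (n - 1) \<E> \<and> distribution AN (n - 1) \<B> \<and>
      (\<forall>x. \<forall>v\<in>tangent AN x. \<exists>!z. case z of (r, e, b) \<Rightarrow>
        e \<in> \<E> x \<and> b \<in> \<B> x \<and> v = r *\<^sub>R U x + e + b) \<and>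
      (\<forall>x. \<forall>e\<in>\<E> x. \<forall>b\<in>\<B> x. g x (U x) e = 0 \<and> g x (U x) b = 0 \<and> g x e b = 0) \<and>
      tensor_field_11 AN \<Psi> \<and>
      (\<forall>x. \<forall>v\<in>tangent AN x. \<Psi> x (\<Psi> x v) = - v + \<alpha> x v *\<^sub>R U x) \<and>
      (\<forall>V W. vector_field AN V \<longrightarrow> vector_field AN W \<longrightarrow>
        (\<forall>x. g x (\<Psi> x (V x)) (\<Psi> x (W x)) = g x (V x) (W x) - \<alpha> x (V x) * \<alpha> x (W x))) \<and>
      (\<forall>x. \<Psi> x (U x) = 0 \<and> \<Psi> x ` \<E> x = \<B> x \<and> \<Psi> x ` \<B> x = \<E> x) \<and>
      almost_contact_metric AN g U \<alpha> \<Psi>"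
  proof (intro exI conjI)
    show "induced_tuple AP AN p \<omega> ?g ?U (?D m_E) (?D m_B) ?\<Psi>" by (rule tuple)
    show "(\<lambda>x v. ?g x (?U x) v) = (\<lambda>x v. ?g x (?U x) v)" ..
    show "distribution AN (n - 1) (?D m_E)" "distribution AN (n - 1) (?D m_B)"
      using dist assms(2) by simp_all
  qed (intro allI ballI impI conjI riemannian_induced_metric[OF NC] vector_field_induced_reeb[OF NC]
        induced_reeb_unit[OF NC] induced_splitting[OF NC] induced_orthogonal[OF NC] tensor_field_induced_tensor[OF NC]
        induced_tensor_square[OF NC] induced_tensor_metric[OF NC] induced_tensor_images[OF NC] induced_almost_contact[OF NC];
      assumption)+
qed

end
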